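(* The sequence $$LS^2(C[1])\to L\Gamma_2(C[1])\to (C\otimes^{L}\mathbb{Z}/2)[1],$$ for $C\in\mathsf{DAb}_{\leq 0}$, does not split in the category $\mathsf{DAb}_{\leq 0}$ functorially in $C$.
   Context: $\mathsf{DAb}_{\leq 0}$ denotes the derived category of abelian groups formed by chain complexes living in non-negative (homological) degrees; via the Dold-Kan correspondence it is equivalent to the homotopy category of simplicial abelian groups. $\pi_i$ is the $i$-th homotopy group of the corresponding simplicial abelian group (the $i$-th homology of the complex). $[1]$ is the shift with $\pi_{i+1}(C[1])=\pi_i(C)$. $\otimes^L$ is the derived tensor product. $S^2$ is the symmetric square functor and $\Gamma_2$ the divided square (degree $2$ divided power) functor on abelian groups. For an endofunctor $F$ of abelian groups, $LF(C)$ is the Dold-Puppe derived functor: $LF(C)=F(K(P_* ))$, where $P_*$ is a complex of projective abelian groups in non-negative degrees quasi-isomorphic to $C$, $K$ is the Dold-Kan functor from chain complexes to simplicial abelian groups, and $F$ is applied degreewise. The sequence in the claim is obtained by deriving, and evaluating at $C[1]$, the natural short exact sequence $0\to S^2(A)\to\Gamma_2(A)\to A\otimes\mathbb{Z}/2\to 0$ for free abelian $A$, in which $ab\mapsto \gamma_2(a+b)-\gamma_2(a)-\gamma_2(b)$ and $\gamma_2(a)\mapsto a\otimes 1$. *)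

theory Defs
  imports "HOL-Algebra.Free_Abelian_Groups" "HOL-Algebra.Generated_Groups"
begin

text \<open>Abelian groups are the (multiplicatively written) commutative groups of HOL-Algebra.\<close>

text \<open>\<open>bd C n\<close> is the differential from degree \<open>n + 1\<close> to degree \<open>n\<close>.\<close>

record 'a cplx =
  grp :: "nat \<Rightarrow> 'a monoid"
  bd :: "nat \<Rightarrow> 'a \<Rightarrow> 'a"

definition chain_complex :: "'a cplx \<Rightarrow> bool" where
  "chain_complex C \<longleftrightarrow>
     (\<forall>n. comm_group (grp C n)) \<and>
     (\<forall>n. bd C n \<in> hom (grp C (Suc n)) (grp C n)) \<and>
     (\<forall>n. \<forall>x \<in> carrier (grp C (Suc (Suc n))). bd C n (bd C (Suc n) x) = \<one>\<^bsub>grp C n\<^esub>)"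

definition chain_map :: "'a cplx \<Rightarrow> 'b cplx \<Rightarrow> (nat \<Rightarrow> 'a \<Rightarrow> 'b) \<Rightarrow> bool" where
  "chain_map X Y f \<longleftrightarrow>
     chain_complex X \<and> chain_complex Y \<and>
     (\<forall>n. f n \<in> hom (grp X n) (grp Y n)) \<and>
     (\<forall>n. \<forall>x \<in> carrier (grp X (Suc n)). f n (bd X n x) = bd Y n (f (Suc n) x))"

fun cycles :: "'a cplx \<Rightarrow> nat \<Rightarrow> 'a set" where
  "cycles C 0 = carrier (grp C 0)"
| "cycles C (Suc n) = kernel (grp C (Suc n)) (grp C n) (bd C n)"

definition boundaries :: "'a cplx \<Rightarrow> nat \<Rightarrow> 'a set" where
  "boundaries C n = bd C n ` carrier (grp C (Suc n))"

definition homology :: "'a cplx \<Rightarrow> nat \<Rightarrow> 'a set monoid" where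
  "homology C n = (grp C n)\<lparr>carrier := cycles C n\<rparr> Mod boundaries C n"

definition homology_map :: "'b cplx \<Rightarrow> (nat \<Rightarrow> 'a \<Rightarrow> 'b) \<Rightarrow> nat \<Rightarrow> 'a set \<Rightarrow> 'b set" where
  "homology_map Y f n c = boundaries Y n <#>\<^bsub>grp Y n\<^esub> (f n ` c)"

definition quasi_iso :: "'a cplx \<Rightarrow> 'b cplx \<Rightarrow> (nat \<Rightarrow> 'a \<Rightarrow> 'b) \<Rightarrow> bool" where
  "quasi_iso X Y f \<longleftrightarrow>
     chain_map X Y f \<and> (\<forall>n. homology_map Y f n \<in> iso (homology X n) (homology Y n))"

text \<open>The shift \<open>C[1]\<close>, with the usual sign on the differential; it is the trivial group in degree 0.\<close>

definition shift :: "'a cplx \<Rightarrow> 'a cplx" where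
  "shift C =
     \<lparr>grp = (\<lambda>n. case n of 0 \<Rightarrow> (grp C 0)\<lparr>carrier := {\<one>\<^bsub>grp C 0\<^esub>}\<rparr> | Suc m \<Rightarrow> grp C m),
      bd = (\<lambda>n x. case n of 0 \<Rightarrow> \<one>\<^bsub>grp C 0\<^esub> | Suc m \<Rightarrow> inv\<^bsub>grp C m\<^esub> (bd C m x))\<rparr>"

definition shift_map :: "(nat \<Rightarrow> 'a \<Rightarrow> 'b) \<Rightarrow> nat \<Rightarrow> 'a \<Rightarrow> 'b" where
  "shift_map f n = f (n - 1)"

text \<open>
  The derived category is the localization (in the sense of Gabriel and Zisman) of the category of
  complexes at the quasi-isomorphisms.  A morphism is represented by a word of composable steps,
  written in diagrammatic order: \<open>Fwd X Y f\<close> is a chain map \<open>f\<close> from \<open>X\<close> to \<open>Y\<close>, and \<open>Bwd X Y s\<close> is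
  the formal inverse, from \<open>X\<close> to \<open>Y\<close>, of a quasi-isomorphism \<open>s\<close> from \<open>Y\<close> to \<open>X\<close>.  Composition
  is concatenation, and \<open>D_eq X u v Y\<close> says that the words \<open>u\<close> and \<open>v\<close> from \<open>X\<close> to \<open>Y\<close> represent
  the same morphism.  The type \<open>'a\<close> plays the role of the universe.
\<close>

datatype 'a step =
    Fwd "'a cplx" "'a cplx" "nat \<Rightarrow> 'a \<Rightarrow> 'a"
  | Bwd "'a cplx" "'a cplx" "nat \<Rightarrow> 'a \<Rightarrow> 'a"

inductive D_mor :: "'a cplx \<Rightarrow> 'a step list \<Rightarrow> 'a cplx \<Rightarrow> bool" where
  nil: "chain_complex X \<Longrightarrow> D_mor X [] X"
| fwd: "chain_map X Y f \<Longrightarrow> D_mor Y w Z \<Longrightarrow> D_mor X (Fwd X Y f # w) Z"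
| bwd: "quasi_iso Y X s \<Longrightarrow> D_mor Y w Z \<Longrightarrow> D_mor X (Bwd X Y s # w) Z"

inductive D_eq :: "'a cplx \<Rightarrow> 'a step list \<Rightarrow> 'a step list \<Rightarrow> 'a cplx \<Rightarrow> bool" where
  refl: "D_mor X u Y \<Longrightarrow> D_eq X u u Y"
| sym: "D_eq X u v Y \<Longrightarrow> D_eq X v u Y"
| trans: "D_eq X u v Y \<Longrightarrow> D_eq X v w Y \<Longrightarrow> D_eq X u w Y"
| cong: "D_eq X u u' Y \<Longrightarrow> D_eq Y v v' Z \<Longrightarrow> D_eq X (u @ v) (u' @ v') Z"
| ident: "chain_map X X f \<Longrightarrow> (\<And>n x. x \<in> carrier (grp X n) \<Longrightarrow> f n x = x) \<Longrightarrow>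
    D_eq X [Fwd X X f] [] X"
| comp: "chain_map X Y f \<Longrightarrow> chain_map Y Z g \<Longrightarrow> chain_map X Z h \<Longrightarrow>
    (\<And>n x. x \<in> carrier (grp X n) \<Longrightarrow> h n x = g n (f n x)) \<Longrightarrow>
    D_eq X [Fwd X Y f, Fwd Y Z g] [Fwd X Z h] Z"
| inv_right: "quasi_iso X Y s \<Longrightarrow> D_eq X [Fwd X Y s, Bwd Y X s] [] X"
| inv_left: "quasi_iso X Y s \<Longrightarrow> D_eq Y [Bwd Y X s, Fwd X Y s] [] Y"

text \<open>
  The lifting property is tested against groups over the types \<open>'a \<Rightarrow>\<^sub>0 int\<close> and \<open>'a\<close> only.  This
  is the full property, since it includes lifting the identity of \<open>G\<close> along the surjection onto
  \<open>G\<close> from the free abelian group on the set \<open>carrier G\<close>.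
\<close>

definition projective_group :: "'a monoid \<Rightarrow> bool" where
  "projective_group G \<longleftrightarrow>
     comm_group G \<and>
     (\<forall>(A :: ('a \<Rightarrow>\<^sub>0 int) monoid) (B :: 'a monoid) e g.
        comm_group A \<and> comm_group B \<and> e \<in> epi A B \<and> g \<in> hom G B \<longrightarrow>
        (\<exists>h \<in> hom G A. \<forall>x \<in> carrier G. e (h x) = g x))"

definition projective_resolutions ::
    "('a cplx \<Rightarrow> 'a cplx) \<Rightarrow> ('a cplx \<Rightarrow> nat \<Rightarrow> 'a \<Rightarrow> 'a) \<Rightarrow> bool" where
  "projective_resolutions P \<epsilon> \<longleftrightarrow>
     (\<forall>C. chain_complex C \<longrightarrow>
        (\<forall>n. projective_group (grp (P C) n)) \<and> quasi_iso (P C) C (\<epsilon> C))"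

text \<open>
  \<open>sact X m n \<alpha>\<close> is the operator from \<open>sgrp X n\<close> to \<open>sgrp X m\<close> given by a weakly monotone map
  \<open>\<alpha>\<close> from \<open>{..m}\<close> to \<open>{..n}\<close>.
\<close>

record 'a simp_group =
  sgrp :: "nat \<Rightarrow> 'a monoid"
  sact :: "nat \<Rightarrow> nat \<Rightarrow> (nat \<Rightarrow> nat) \<Rightarrow> 'a \<Rightarrow> 'a"

definition coface :: "nat \<Rightarrow> nat \<Rightarrow> nat" where
  "coface i j = (if j < i then j else Suc j)"

text \<open>The normalized chain complex: the common kernel of the faces \<open>d_i\<close>, \<open>i > 0\<close>, with differential \<open>d_0\<close>.\<close>

definition normalized :: "'a simp_group \<Rightarrow> 'a cplx" where
  "normalized X =
     \<lparr>grp = (\<lambda>n. (sgrp X n)\<lparr>carrier :=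
          {x \<in> carrier (sgrp X n). \<forall>i \<in> {1..n}. sact X (n - 1) n (coface i) x = \<one>\<^bsub>sgrp X (n - 1)\<^esub>}\<rparr>),
      bd = (\<lambda>n. sact X n (Suc n) (coface 0))\<rparr>"

text \<open>
  The Dold-Kan functor \<open>K\<close>, in the form that \<open>K(C)\<close> in degree \<open>n\<close> is the group of chain maps to
  \<open>C\<close> from the normalized chain complex of the standard \<open>n\<close>-simplex, with the simplicial
  operators acting by precomposition.  That complex is free on the non-degenerate simplices, which
  are the non-empty sets of vertices \<open>\<sigma> \<subseteq> {..n}\<close>, so such a chain map is a family
  \<open>c \<sigma> \<in> C\<^sub>k\<close>, where \<open>k\<close> is \<open>card \<sigma> - 1\<close>, for which \<open>d (c \<sigma>)\<close> is the alternating
  sum of \<open>c\<close> over the faces of \<open>\<sigma>\<close>.  An operator \<open>\<alpha>\<close> kills the simplices on which it is not injective.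
\<close>

definition faces :: "nat \<Rightarrow> nat set set" where
  "faces n = {\<sigma>. \<sigma> \<subseteq> {..n} \<and> \<sigma> \<noteq> {}}"

definition DK_grp :: "'a cplx \<Rightarrow> nat \<Rightarrow> (nat set \<Rightarrow> 'a) monoid" where
  "DK_grp C n = (product_group (faces n) (\<lambda>\<sigma>. grp C (card \<sigma> - 1)))\<lparr>carrier :=
     {c \<in> carrier (product_group (faces n) (\<lambda>\<sigma>. grp C (card \<sigma> - 1))).
        \<forall>\<sigma> \<in> faces n. 2 \<le> card \<sigma> \<longrightarrow>
          bd C (card \<sigma> - 2) (c \<sigma>) =
          finprod (grp C (card \<sigma> - 2))
            (\<lambda>v. c (\<sigma> - {v}) [^]\<^bsub>grp C (card \<sigma> - 2)\<^esub> ((-1) ^ card {u \<in> \<sigma>. u < v} :: int)) \<sigma>}\<rparr>"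

definition DK_act ::
    "'a cplx \<Rightarrow> nat \<Rightarrow> nat \<Rightarrow> (nat \<Rightarrow> nat) \<Rightarrow> (nat set \<Rightarrow> 'a) \<Rightarrow> nat set \<Rightarrow> 'a" where
  "DK_act C m n \<alpha> c =
     (\<lambda>\<tau> \<in> faces m. if inj_on \<alpha> \<tau> then c (\<alpha> ` \<tau>) else \<one>\<^bsub>grp C (card \<tau> - 1)\<^esub>)"

definition DK :: "'a cplx \<Rightarrow> (nat set \<Rightarrow> 'a) simp_group" where
  "DK C = \<lparr>sgrp = DK_grp C, sact = DK_act C\<rparr>"

definition DK_map :: "(nat \<Rightarrow> 'a \<Rightarrow> 'b) \<Rightarrow> nat \<Rightarrow> (nat set \<Rightarrow> 'a) \<Rightarrow> nat set \<Rightarrow> 'b" where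
  "DK_map f n c = (\<lambda>\<sigma> \<in> faces n. f (card \<sigma> - 1) (c \<sigma>))"

text \<open>
  These are given by generators and relations; an element is a coset of the subgroup of relations
  in a free abelian group, which is written additively.  All three use the same type of
  generators, so that their values live in one universe: \<open>Prod a b\<close> stands for \<open>ab\<close>, \<open>Divsq a\<close> for
  \<open>\<gamma>\<^sub>2(a)\<close> and \<open>Tens a t\<close> for \<open>a \<otimes> t\<close>.
\<close>

datatype ('a, 'b) gen = Prod 'a 'a | Divsq 'a | Tens 'b int

type_synonym ('a, 'b) gens = "(('a, 'b) gen \<Rightarrow>\<^sub>0 int) set"

definition rel_subgroup :: "'g set \<Rightarrow> ('g \<Rightarrow>\<^sub>0 int) set \<Rightarrow> ('g \<Rightarrow>\<^sub>0 int) set" where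
  "rel_subgroup S R = generate (free_Abelian_group S) R"

definition presented :: "'g set \<Rightarrow> ('g \<Rightarrow>\<^sub>0 int) set \<Rightarrow> ('g \<Rightarrow>\<^sub>0 int) set monoid" where
  "presented S R = free_Abelian_group S Mod rel_subgroup S R"

text \<open>The map into \<open>presented S R\<close> induced by the values \<open>\<phi>\<close> on generators.\<close>

definition presented_map ::
    "'h set \<Rightarrow> ('h \<Rightarrow>\<^sub>0 int) set \<Rightarrow> ('g \<Rightarrow> 'h \<Rightarrow>\<^sub>0 int) \<Rightarrow> ('g \<Rightarrow>\<^sub>0 int) set \<Rightarrow> ('h \<Rightarrow>\<^sub>0 int) set" where
  "presented_map S R \<phi> X = rel_subgroup S R <#>\<^bsub>free_Abelian_group S\<^esub> (frag_extend \<phi> ` X)"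

definition prod_gens :: "'a monoid \<Rightarrow> ('a, 'b) gen set" where
  "prod_gens A = {Prod a b | a b. a \<in> carrier A \<and> b \<in> carrier A}"

definition prod_rels :: "'a monoid \<Rightarrow> (('a, 'b) gen \<Rightarrow>\<^sub>0 int) set" where
  "prod_rels A =
     {frag_of (Prod (a \<otimes>\<^bsub>A\<^esub> a') b) - frag_of (Prod a b) - frag_of (Prod a' b) | a a' b.
        a \<in> carrier A \<and> a' \<in> carrier A \<and> b \<in> carrier A} \<union>
     {frag_of (Prod a b) - frag_of (Prod b a) | a b. a \<in> carrier A \<and> b \<in> carrier A}"

definition S2 :: "'a monoid \<Rightarrow> ('a, 'b) gens monoid" where
  "S2 A = presented (prod_gens A) (prod_rels A)"

definition S2_map :: "'c monoid \<Rightarrow> ('a \<Rightarrow> 'c) \<Rightarrow> ('a, 'b) gens \<Rightarrow> ('c, 'b) gens" where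
  "S2_map A' f = presented_map (prod_gens A') (prod_rels A')
     (\<lambda>g. case g of Prod a b \<Rightarrow> frag_of (Prod (f a) (f b)) | _ \<Rightarrow> 0)"

text \<open>
  \<open>\<Gamma>\<^sub>2(A)\<close> is the degree 2 part of the divided power algebra of \<open>A\<close>; here \<open>Prod a b\<close> stands for
  \<open>\<gamma>\<^sub>1(a) \<gamma>\<^sub>1(b)\<close>.
\<close>

definition G2_gens :: "'a monoid \<Rightarrow> ('a, 'b) gen set" where
  "G2_gens A = prod_gens A \<union> Divsq ` carrier A"

definition G2_rels :: "'a monoid \<Rightarrow> (('a, 'b) gen \<Rightarrow>\<^sub>0 int) set" where
  "G2_rels A = prod_rels A \<union>
     {frag_of (Divsq (a \<otimes>\<^bsub>A\<^esub> b)) - frag_of (Divsq a) - frag_of (Prod a b) - frag_of (Divsq b) | a b.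
        a \<in> carrier A \<and> b \<in> carrier A} \<union>
     {frag_of (Divsq (a [^]\<^bsub>A\<^esub> k)) - frag_cmul (k\<^sup>2) (frag_of (Divsq a)) | a (k :: int).
        a \<in> carrier A} \<union>
     {frag_of (Prod a a) - frag_cmul 2 (frag_of (Divsq a)) | a. a \<in> carrier A}"

definition G2 :: "'a monoid \<Rightarrow> ('a, 'b) gens monoid" where
  "G2 A = presented (G2_gens A) (G2_rels A)"

definition G2_map :: "'c monoid \<Rightarrow> ('a \<Rightarrow> 'c) \<Rightarrow> ('a, 'b) gens \<Rightarrow> ('c, 'b) gens" where
  "G2_map A' f = presented_map (G2_gens A') (G2_rels A')
     (\<lambda>g. case g of Prod a b \<Rightarrow> frag_of (Prod (f a) (f b)) | Divsq a \<Rightarrow> frag_of (Divsq (f a)) | _ \<Rightarrow> 0)"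

definition tens_gens :: "'b monoid \<Rightarrow> int monoid \<Rightarrow> ('a, 'b) gen set" where
  "tens_gens A B = {Tens a t | a t. a \<in> carrier A \<and> t \<in> carrier B}"

definition tens_rels :: "'b monoid \<Rightarrow> int monoid \<Rightarrow> (('a, 'b) gen \<Rightarrow>\<^sub>0 int) set" where
  "tens_rels A B =
     {frag_of (Tens (a \<otimes>\<^bsub>A\<^esub> a') t) - frag_of (Tens a t) - frag_of (Tens a' t) | a a' t.
        a \<in> carrier A \<and> a' \<in> carrier A \<and> t \<in> carrier B} \<union>
     {frag_of (Tens a (t \<otimes>\<^bsub>B\<^esub> t')) - frag_of (Tens a t) - frag_of (Tens a t') | a t t'.
        a \<in> carrier A \<and> t \<in> carrier B \<and> t' \<in> carrier B}"

abbreviation Z2 :: "int monoid" where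
  "Z2 \<equiv> integer_mod_group 2"

definition tensZ2 :: "'b monoid \<Rightarrow> ('a, 'b) gens monoid" where
  "tensZ2 A = presented (tens_gens A Z2) (tens_rels A Z2)"

definition tensZ2_map :: "'c monoid \<Rightarrow> ('b \<Rightarrow> 'c) \<Rightarrow> ('a, 'b) gens \<Rightarrow> ('a, 'c) gens" where
  "tensZ2_map A' f = presented_map (tens_gens A' Z2) (tens_rels A' Z2)
     (\<lambda>g. case g of Tens a t \<Rightarrow> frag_of (Tens (f a) t) | _ \<Rightarrow> 0)"

definition S2_to_G2 :: "'a monoid \<Rightarrow> ('a, 'b) gens \<Rightarrow> ('a, 'b) gens" where
  "S2_to_G2 A = presented_map (G2_gens A) (G2_rels A)
     (\<lambda>g. case g of
         Prod a b \<Rightarrow> frag_of (Divsq (a \<otimes>\<^bsub>A\<^esub> b)) - frag_of (Divsq a) - frag_of (Divsq b)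
       | _ \<Rightarrow> 0)"

definition G2_to_tensZ2 :: "'a monoid \<Rightarrow> ('a, 'b) gens \<Rightarrow> ('c, 'a) gens" where
  "G2_to_tensZ2 A = presented_map (tens_gens A Z2) (tens_rels A Z2)
     (\<lambda>g. case g of Divsq a \<Rightarrow> frag_of (Tens a 1) | _ \<Rightarrow> 0)"

definition degreewise ::
    "('a monoid \<Rightarrow> 'b monoid) \<Rightarrow> ('a monoid \<Rightarrow> ('a \<Rightarrow> 'a) \<Rightarrow> 'b \<Rightarrow> 'b) \<Rightarrow>
     'a simp_group \<Rightarrow> 'b simp_group" where
  "degreewise F Fmap X =
     \<lparr>sgrp = (\<lambda>n. F (sgrp X n)), sact = (\<lambda>m n \<alpha>. Fmap (sgrp X m) (sact X m n \<alpha>))\<rparr>"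

type_synonym 'a univ = "(nat set \<Rightarrow> 'a, 'a) gens"

text \<open>
  A functor on the derived category obtained by deriving is given by its values on projective
  complexes \<open>Q\<close> and on chain maps \<open>f\<close> into \<open>Q'\<close> between them: its value at \<open>C\<close> is
  \<open>obj F (P C)\<close>.  For \<open>Q\<close> a projective resolution of \<open>C\<close>, \<open>shift Q\<close> is one of \<open>C[1]\<close>, so
  that \<open>LS2_shift\<close> and \<open>LG2_shift\<close> give \<open>LS\<^sup>2(C[1])\<close> and \<open>L\<Gamma>\<^sub>2(C[1])\<close>, and
  \<open>tensZ2_shift\<close> gives \<open>(C \<otimes>\<^sup>L Z/2)[1]\<close>.
\<close>

record ('a, 'b) dfun =
  obj :: "'a cplx \<Rightarrow> 'b cplx"
  arr :: "'a cplx \<Rightarrow> (nat \<Rightarrow> 'a \<Rightarrow> 'a) \<Rightarrow> nat \<Rightarrow> 'b \<Rightarrow> 'b"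

definition LS2_shift :: "('a, 'a univ) dfun" where
  "LS2_shift =
     \<lparr>obj = (\<lambda>Q. normalized (degreewise S2 S2_map (DK (shift Q)))),
      arr = (\<lambda>Q' f n. S2_map (DK_grp (shift Q') n) (DK_map (shift_map f) n))\<rparr>"

definition LG2_shift :: "('a, 'a univ) dfun" where
  "LG2_shift =
     \<lparr>obj = (\<lambda>Q. normalized (degreewise G2 G2_map (DK (shift Q)))),
      arr = (\<lambda>Q' f n. G2_map (DK_grp (shift Q') n) (DK_map (shift_map f) n))\<rparr>"

definition tensZ2_cplx :: "'a cplx \<Rightarrow> 'a univ cplx" where
  "tensZ2_cplx Q = \<lparr>grp = (\<lambda>n. tensZ2 (grp Q n)), bd = (\<lambda>n. tensZ2_map (grp Q n) (bd Q n))\<rparr>"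

definition tensZ2_shift :: "('a, 'a univ) dfun" where
  "tensZ2_shift =
     \<lparr>obj = (\<lambda>Q. shift (tensZ2_cplx Q)),
      arr = (\<lambda>Q' f. shift_map (\<lambda>n. tensZ2_map (grp Q' n) (f n)))\<rparr>"

definition LS2_to_LG2 :: "'a cplx \<Rightarrow> nat \<Rightarrow> 'a univ \<Rightarrow> 'a univ" where
  "LS2_to_LG2 Q n = S2_to_G2 (DK_grp (shift Q) n)"

text \<open>
  The second map: \<open>L\<Gamma>\<^sub>2(C[1])\<close> maps to the normalized complex of \<open>K(Q[1]) \<otimes> Z/2\<close>, which is
  identified with \<open>(Q \<otimes> Z/2)[1]\<close> by the Dold-Kan isomorphism, that is, by evaluating \<open>c\<close> at the top simplex
  \<open>{..n}\<close>.  In degree 0 the value lies in the trivial subgroup of \<open>Q\<^sub>0 \<otimes> Z/2\<close>.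
\<close>

definition LG2_to_tensZ2 :: "'a cplx \<Rightarrow> nat \<Rightarrow> 'a univ \<Rightarrow> 'a univ" where
  "LG2_to_tensZ2 Q n x =
     tensZ2_map (grp Q (n - 1)) (\<lambda>c. c {..n})
       (G2_to_tensZ2 (DK_grp (shift Q) n) x :: (nat set \<Rightarrow> 'a, nat set \<Rightarrow> 'a) gens)"

definition represents ::
    "('a cplx \<Rightarrow> 'a cplx) \<Rightarrow> ('a cplx \<Rightarrow> nat \<Rightarrow> 'a \<Rightarrow> 'a) \<Rightarrow>
     'a cplx \<Rightarrow> 'a cplx \<Rightarrow> 'a step list \<Rightarrow> (nat \<Rightarrow> 'a \<Rightarrow> 'a) \<Rightarrow> bool" where
  "represents P \<epsilon> C C' w f \<longleftrightarrow>
     chain_map (P C) (P C') f \<and> D_mor C w C' \<and>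
     D_eq (P C) [Fwd (P C) (P C') f, Fwd (P C') C' (\<epsilon> C')] (Fwd (P C) C (\<epsilon> C) # w) C'"

text \<open>
  Naturality is required for all morphisms \<open>w\<close> of the derived category.  The value of a derived
  functor on \<open>w\<close> is computed with any chain map \<open>f\<close> representing \<open>w\<close>; such \<open>f\<close> exist and are
  unique up to homotopy, so the choice does not matter.
\<close>

definition D_natural ::
    "('a cplx \<Rightarrow> 'a cplx) \<Rightarrow> ('a cplx \<Rightarrow> nat \<Rightarrow> 'a \<Rightarrow> 'a) \<Rightarrow>
     ('a, 'b) dfun \<Rightarrow> ('a, 'b) dfun \<Rightarrow> ('a cplx \<Rightarrow> 'b step list) \<Rightarrow> bool" where
  "D_natural P \<epsilon> F G \<eta> \<longleftrightarrow>
     (\<forall>C. chain_complex C \<longrightarrow> D_mor (obj F (P C)) (\<eta> C) (obj G (P C))) \<and>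
     (\<forall>C C' w f. chain_complex C \<and> chain_complex C' \<and> represents P \<epsilon> C C' w f \<longrightarrow>
        D_eq (obj F (P C))
          (\<eta> C @ [Fwd (obj G (P C)) (obj G (P C')) (arr G (P C') f)])
          (Fwd (obj F (P C)) (obj F (P C')) (arr F (P C') f) # \<eta> C')
          (obj G (P C')))"

definition functorial_retraction ::
    "('a cplx \<Rightarrow> 'a cplx) \<Rightarrow> ('a cplx \<Rightarrow> nat \<Rightarrow> 'a \<Rightarrow> 'a) \<Rightarrow> ('a, 'b) dfun \<Rightarrow> ('a, 'b) dfun \<Rightarrow>
     ('a cplx \<Rightarrow> nat \<Rightarrow> 'b \<Rightarrow> 'b) \<Rightarrow> ('a cplx \<Rightarrow> 'b step list) \<Rightarrow> bool" where
  "functorial_retraction P \<epsilon> A E i r \<longleftrightarrow>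
     D_natural P \<epsilon> E A r \<and>
     (\<forall>C. chain_complex C \<longrightarrow>
        D_eq (obj A (P C)) (Fwd (obj A (P C)) (obj E (P C)) (i (P C)) # r C) [] (obj A (P C)))"

definition functorial_section ::
    "('a cplx \<Rightarrow> 'a cplx) \<Rightarrow> ('a cplx \<Rightarrow> nat \<Rightarrow> 'a \<Rightarrow> 'a) \<Rightarrow> ('a, 'b) dfun \<Rightarrow> ('a, 'b) dfun \<Rightarrow>
     ('a cplx \<Rightarrow> nat \<Rightarrow> 'b \<Rightarrow> 'b) \<Rightarrow> ('a cplx \<Rightarrow> 'b step list) \<Rightarrow> bool" where
  "functorial_section P \<epsilon> E B p s \<longleftrightarrow>
     D_natural P \<epsilon> B E s \<and>
     (\<forall>C. chain_complex C \<longrightarrow>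
        D_eq (obj B (P C)) (s C @ [Fwd (obj E (P C)) (obj B (P C)) (p (P C))]) [] (obj B (P C)))"

end

theory Submission
  imports Defs
begin

text \<open>
  The sequence is split neither by a retraction nor by a section because the extension that it induces on
  homology with coefficients in \<open>Z/2\<close> does not split naturally.  Take \<open>C\<close> to be a free abelian group \<open>A\<close> of
  rank two in degree 0.  In \<open>H\<^sub>2(-; Z/2)\<close> the sequence then becomes
  \<open>\<Lambda>\<^sup>2(A/2) \<rightarrow> \<Gamma>\<^sub>2(A/2) \<rightarrow> A/2\<close>, with the divided square taken over \<open>Z/2\<close>.  Naturality for the maps
  \<open>A \<rightarrow> A\<close> of rank one forces a section to be a multiple of \<open>a \<mapsto> \<gamma>\<^sub>2(a)\<close>, which is not additive because
  \<open>\<gamma>\<^sub>2(a + b) - \<gamma>\<^sub>2(a) - \<gamma>\<^sub>2(b) = ab\<close>.  Similarly, a retraction cannot take a nonzero value on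
  \<open>\<gamma>\<^sub>2(a)\<close>, an element that comes from rank one, where \<open>\<Lambda>\<^sup>2\<close> vanishes; hence it kills the deviation
  \<open>ab\<close>, although this is the image of \<open>a \<and> b \<noteq> 0\<close>.

  Homology mod 2 is defined on words of the derived category (\<open>m2_word_cong\<close>), because the homology of the
  cone of multiplication by 2 turns quasi-isomorphisms into bijections (\<open>m2_inj\<close>, \<open>m2_surj\<close>).

  The value \<open>P C\<close> is an arbitrary resolution of \<open>A\<close>, so no homology group is computed completely.  All that
  is retained of the resolution \<open>R\<close> is a pair of functionals on \<open>H\<^sub>0(R)\<close> with a dual pair of elements
  (\<open>dual_pair\<close>); they define the chain maps \<open>scale\<close> of rank one.  The elements of \<open>H\<^sub>2\<close> are told apart by
  explicit cocycles on the simplicial group \<open>\<Gamma>\<^sub>2(K(R[1]))\<close>, the cup products \<open>t\<^sub>i \<union> t\<^sub>j\<close> of the functionals,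
  which are 1-cocycles on \<open>K(R[1])\<close>.  In terms of \<open>\<Gamma>\<^sub>2(A/2)\<close> the value of \<open>t\<^sub>1 \<union> t\<^sub>2\<close> at \<open>\<gamma>\<^sub>2(a)\<close> is
  \<open>t\<^sub>1(a) t\<^sub>2(a)\<close>, up to sign.  Two facts about them carry the proof: along \<open>scale w\<close> the cocycle
  \<open>t\<^sub>1 \<union> t\<^sub>2\<close> pulls back to \<open>t\<^sub>1(w) t\<^sub>2(w) (t\<^sub>1 \<union> t\<^sub>1)\<close> (\<open>has_val_scale_G2\<close>, \<open>has_val_scale_S2\<close>), and there is
  the coboundary formula \<open>2 (t\<^sub>1 \<union> t\<^sub>1) = - \<delta>(t\<^sub>1\<^sup>2)\<close> (\<open>edge_sq_coboundary\<close>), by which \<open>t\<^sub>1 \<union> t\<^sub>1\<close> computes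
  \<open>t\<^sub>1\<close> of the projection to \<open>A/2\<close> and vanishes mod 2 on the image of \<open>S\<^sup>2\<close>.
\<close>

section \<open>Cosets and subgroups\<close>

lemma (in comm_group) comm_group_subgroup:
  assumes "subgroup H G"
  shows "comm_group (G\<lparr>carrier := H\<rparr>)"
proof (rule group.group_comm_groupI)
  show "group (G\<lparr>carrier := H\<rparr>)"
    using assms by (rule subgroup_imp_group)
qed (use subgroup.subset [OF assms] in \<open>auto intro: m_comm\<close>)

lemma DirProd_comm_group:
  assumes "comm_group G" "comm_group H"
  shows "comm_group (G \<times>\<times> H)"
proof -
  interpret G: comm_group G by fact
  interpret H: comm_group H by fact
  show ?thesis
    by (rule group.group_comm_groupI)
       (auto simp: DirProd_group G.is_group H.is_group G.m_comm H.m_comm)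
qed

text \<open>
  A map induced on presented groups and a map induced on homology are both given on a coset by taking the
  image and adding the subgroup back, so this computes either of them on representatives.
\<close>

lemma image_r_coset:
  assumes "group G" "group G'" "subgroup N G" "subgroup N' G'"
    and \<phi>: "\<phi> \<in> hom G G'" and N: "\<phi> ` N \<subseteq> N'" and x: "x \<in> carrier G"
  shows "N' <#>\<^bsub>G'\<^esub> (\<phi> ` (N #>\<^bsub>G\<^esub> x)) = N' #>\<^bsub>G'\<^esub> \<phi> x"
proof -
  interpret G: group G by fact
  interpret G': group G' by fact
  interpret N: subgroup N G by fact
  interpret N': subgroup N' G' by fact
  have \<phi>c: "\<phi> y \<in> carrier G'" if "y \<in> carrier G" for y
    using \<phi> that by (auto simp: hom_def)
  have \<phi>m: "\<phi> (y \<otimes>\<^bsub>G\<^esub> z) = \<phi> y \<otimes>\<^bsub>G'\<^esub> \<phi> z" if "y \<in> carrier G" "z \<in> carrier G" for y z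
    using \<phi> that by (auto simp: hom_def)
  show ?thesis
  proof (intro equalityI subsetI)
    fix z assume "z \<in> N' <#>\<^bsub>G'\<^esub> (\<phi> ` (N #>\<^bsub>G\<^esub> x))"
    then obtain n' n where n: "n' \<in> N'" "n \<in> N" "z = n' \<otimes>\<^bsub>G'\<^esub> \<phi> (n \<otimes>\<^bsub>G\<^esub> x)"
      by (auto simp: set_mult_def r_coset_def)
    have "\<phi> n \<in> N'" using N n by auto
    then have "z = (n' \<otimes>\<^bsub>G'\<^esub> \<phi> n) \<otimes>\<^bsub>G'\<^esub> \<phi> x"
      using n x \<phi>m \<phi>c by (simp add: G'.m_assoc)
    then show "z \<in> N' #>\<^bsub>G'\<^esub> \<phi> x"
      using \<open>\<phi> n \<in> N'\<close> n by (auto simp: r_coset_def)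
  next
    fix z assume "z \<in> N' #>\<^bsub>G'\<^esub> \<phi> x"
    then obtain n' where "n' \<in> N'" "z = n' \<otimes>\<^bsub>G'\<^esub> \<phi> x"
      by (auto simp: r_coset_def)
    moreover have "x \<in> N #>\<^bsub>G\<^esub> x"
      using x N.subgroup_axioms by (simp add: G.rcos_self)
    ultimately show "z \<in> N' <#>\<^bsub>G'\<^esub> (\<phi> ` (N #>\<^bsub>G\<^esub> x))"
      by (auto simp: set_mult_def)
  qed
qed

lemma r_coset_eq_iff:
  assumes "group G" "subgroup N G" "x \<in> carrier G" "y \<in> carrier G"
  shows "N #>\<^bsub>G\<^esub> x = N #>\<^bsub>G\<^esub> y \<longleftrightarrow> (\<exists>n\<in>N. x = n \<otimes>\<^bsub>G\<^esub> y)"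
proof -
  interpret G: group G by fact
  have "N #>\<^bsub>G\<^esub> x = N #>\<^bsub>G\<^esub> y \<longleftrightarrow> x \<in> N #>\<^bsub>G\<^esub> y"
    using assms G.repr_independence G.rcos_self by metis
  then show ?thesis by (auto simp: r_coset_def)
qed

lemma (in comm_group) mult_mult_swap:
  assumes "a \<in> carrier G" "b \<in> carrier G" "c \<in> carrier G" "d \<in> carrier G"
  shows "(a \<otimes> b) \<otimes> (c \<otimes> d) = (a \<otimes> c) \<otimes> (b \<otimes> d)"
  using assms by (simp add: m_ac)

lemma (in comm_group) telescope_one:
  assumes "a \<in> carrier G" "b \<in> carrier G" "c \<in> carrier G"
  shows "(c \<otimes> inv b) \<otimes> (inv (c \<otimes> inv a) \<otimes> (b \<otimes> inv a)) = \<one>"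
proof -
  have "(c \<otimes> inv b) \<otimes> (inv (c \<otimes> inv a) \<otimes> (b \<otimes> inv a)) = inv (c \<otimes> inv a) \<otimes> ((c \<otimes> inv b) \<otimes> (b \<otimes> inv a))"
    using assms by (simp add: m_lcomm)
  also have "(c \<otimes> inv b) \<otimes> (b \<otimes> inv a) = c \<otimes> inv a"
    using assms by (simp add: m_assoc) (simp add: m_assoc [symmetric])
  finally show ?thesis using assms by simp
qed

section \<open>Chain complexes and quasi-isomorphisms\<close>

lemma chain_complexD:
  assumes "chain_complex X"
  shows "comm_group (grp X n)" "bd X n \<in> hom (grp X (Suc n)) (grp X n)"
    "x \<in> carrier (grp X (Suc (Suc n))) \<Longrightarrow> bd X n (bd X (Suc n) x) = \<one>\<^bsub>grp X n\<^esub>"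
  using assms by (auto simp: chain_complex_def)

lemma bd_group_hom:
  assumes "chain_complex X"
  shows "group_hom (grp X (Suc n)) (grp X n) (bd X n)"
  using chain_complexD [OF assms] by (auto simp: group_hom_def group_hom_axioms_def comm_group_def)

lemma subgroup_cycles:
  assumes "chain_complex X"
  shows "subgroup (cycles X n) (grp X n)"
proof (cases n)
  case 0
  then show ?thesis
    using chain_complexD(1) [OF assms, of 0] by (simp add: group.subgroup_self comm_group_def)
next
  case (Suc m)
  then show ?thesis
    using group_hom.subgroup_kernel [OF bd_group_hom [OF assms, of m]] by simp
qed

lemma subgroup_boundaries:
  assumes "chain_complex X"
  shows "subgroup (boundaries X n) (grp X n)"
  unfolding boundaries_def
  using bd_group_hom [OF assms] by (rule group_hom.img_is_subgroup)

lemma boundaries_subset_cycles: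
  assumes "chain_complex X"
  shows "boundaries X n \<subseteq> cycles X n"
proof -
  have "bd X n x \<in> cycles X n" if "x \<in> carrier (grp X (Suc n))" for x
    using that chain_complexD [OF assms]
    by (cases n) (auto simp: kernel_def hom_def Pi_iff)
  then show ?thesis by (auto simp: boundaries_def)
qed

lemma chain_mapD:
  assumes "chain_map X Y f"
  shows "chain_complex X" "chain_complex Y" "f n \<in> hom (grp X n) (grp Y n)"
    "x \<in> carrier (grp X (Suc n)) \<Longrightarrow> f n (bd X n x) = bd Y n (f (Suc n) x)"
  using assms by (auto simp: chain_map_def)

lemma chain_map_group_hom:
  assumes "chain_map X Y f"
  shows "group_hom (grp X n) (grp Y n) (f n)"
  using chain_mapD(3) [OF assms] chain_complexD(1) [OF chain_mapD(1) [OF assms]]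
    chain_complexD(1) [OF chain_mapD(2) [OF assms]]
  by (simp add: group_hom_def group_hom_axioms_def comm_group_def)

lemma chain_map_cycles:
  assumes f: "chain_map X Y f" and x: "x \<in> cycles X n"
  shows "f n x \<in> cycles Y n"
proof (cases n)
  case 0
  interpret h: group_hom "grp X 0" "grp Y 0" "f 0" by (rule chain_map_group_hom [OF f])
  show ?thesis using x 0 by auto
next
  case (Suc m)
  interpret h: group_hom "grp X (Suc m)" "grp Y (Suc m)" "f (Suc m)" by (rule chain_map_group_hom [OF f])
  interpret k: group_hom "grp X m" "grp Y m" "f m" by (rule chain_map_group_hom [OF f])
  show ?thesis using x Suc chain_mapD(4) [OF f, of x m] k.hom_one by (auto simp: kernel_def)
qed

lemma chain_map_boundaries:
  assumes f: "chain_map X Y f"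
  shows "f n ` boundaries X n \<subseteq> boundaries Y n"
proof -
  interpret h: group_hom "grp X (Suc n)" "grp Y (Suc n)" "f (Suc n)" by (rule chain_map_group_hom [OF f])
  show ?thesis
    using chain_mapD(4) [OF f, of _ n] by (auto simp: boundaries_def)
qed

lemma homology_cosets:
  assumes "chain_complex X"
  shows "carrier (homology X n) = (\<lambda>x. boundaries X n #>\<^bsub>grp X n\<^esub> x) ` cycles X n"
  by (simp add: homology_def carrier_FactGroup r_coset_def)

lemma homology_map_coset:
  assumes f: "chain_map X Y f" and x: "x \<in> cycles X n"
  shows "homology_map Y f n (boundaries X n #>\<^bsub>grp X n\<^esub> x) = boundaries Y n #>\<^bsub>grp Y n\<^esub> f n x"
  unfolding homology_map_def
proof (rule image_r_coset)
  show "group (grp X n)" "group (grp Y n)"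
    using chain_mapD(1,2) [OF f] chain_complexD(1) by (auto simp: comm_group_def)
  show "x \<in> carrier (grp X n)"
    using x subgroup.subset [OF subgroup_cycles [OF chain_mapD(1) [OF f]]] by auto
qed (use f in \<open>auto simp: chain_mapD subgroup_boundaries chain_map_boundaries\<close>)

text \<open>
  Injectivity and surjectivity on homology are restated for representatives, which is the form used in
  diagram chases.
\<close>

lemma quasi_iso_inj:
  assumes s: "quasi_iso X Y f" and x: "x \<in> cycles X n" and fx: "f n x \<in> boundaries Y n"
  shows "x \<in> boundaries X n"
proof -
  have f: "chain_map X Y f" and iso: "homology_map Y f n \<in> iso (homology X n) (homology Y n)"
    using s by (auto simp: quasi_iso_def)
  interpret A: comm_group "grp X n" by (rule chain_complexD [OF chain_mapD(1) [OF f]])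
  interpret B: comm_group "grp Y n" by (rule chain_complexD [OF chain_mapD(2) [OF f]])
  interpret h: group_hom "grp X n" "grp Y n" "f n" by (rule chain_map_group_hom [OF f])
  note bX = subgroup_boundaries [OF chain_mapD(1) [OF f], of n]
  note bY = subgroup_boundaries [OF chain_mapD(2) [OF f], of n]
  interpret Z: subgroup "cycles X n" "grp X n" by (rule subgroup_cycles [OF chain_mapD(1) [OF f]])
  have "homology_map Y f n (boundaries X n #>\<^bsub>grp X n\<^esub> x) =
      homology_map Y f n (boundaries X n #>\<^bsub>grp X n\<^esub> \<one>\<^bsub>grp X n\<^esub>)"
    using x fx bY B.coset_join2 [OF _ bY] B.coset_mult_one [OF subgroup.subset [OF bY]]
    by (simp add: homology_map_coset [OF f])
  then have "boundaries X n #>\<^bsub>grp X n\<^esub> x = boundaries X n #>\<^bsub>grp X n\<^esub> \<one>\<^bsub>grp X n\<^esub>"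
    using iso x by (auto simp: iso_def bij_betw_def homology_cosets [OF chain_mapD(1) [OF f]] inj_on_def)
  then show ?thesis
    using A.coset_mult_one [OF subgroup.subset [OF bX]] A.rcos_self [OF _ bX, of x] x by auto
qed

lemma quasi_iso_surj:
  assumes s: "quasi_iso X Y f" and y: "y \<in> cycles Y n"
  obtains x b where "x \<in> cycles X n" "b \<in> carrier (grp Y (Suc n))" "f n x = bd Y n b \<otimes>\<^bsub>grp Y n\<^esub> y"
proof -
  have f: "chain_map X Y f" and iso: "homology_map Y f n \<in> iso (homology X n) (homology Y n)"
    using s by (auto simp: quasi_iso_def)
  interpret B: comm_group "grp Y n" by (rule chain_complexD [OF chain_mapD(2) [OF f]])
  interpret h: group_hom "grp X n" "grp Y n" "f n" by (rule chain_map_group_hom [OF f])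
  note bY = subgroup_boundaries [OF chain_mapD(2) [OF f], of n]
  have "boundaries Y n #>\<^bsub>grp Y n\<^esub> y \<in> homology_map Y f n ` carrier (homology X n)"
    using iso y by (simp add: iso_def bij_betw_def homology_cosets [OF chain_mapD(2) [OF f]])
  then obtain x where x: "x \<in> cycles X n"
      "boundaries Y n #>\<^bsub>grp Y n\<^esub> y = boundaries Y n #>\<^bsub>grp Y n\<^esub> f n x"
    by (auto simp: homology_cosets [OF chain_mapD(1) [OF f]] homology_map_coset [OF f])
  then have "f n x \<in> boundaries Y n #>\<^bsub>grp Y n\<^esub> y"
    using B.rcos_self [OF _ bY] subgroup.mem_carrier [OF subgroup_cycles [OF chain_mapD(1) [OF f]]]
    by simp
  then show thesis
    using that x(1) by (auto simp: r_coset_def boundaries_def)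
qed

section \<open>Homology with coefficients in \<open>Z/2\<close>\<close>

text \<open>
  These are the cycles and boundaries of degree \<open>n + 1\<close> in the mapping cone of multiplication by 2 on \<open>X\<close>,
  up to the sign of the second component, so their quotient is \<open>H\<close> in degree \<open>n + 1\<close> with coefficients in
  \<open>Z/2\<close>.  Unlike the homology of \<open>X \<otimes> Z/2\<close> it is homotopy invariant also when \<open>X\<close> has torsion, as
  \<open>(C \<otimes> Z/2)[1]\<close> does.
\<close>

definition m2_cycles :: "'b cplx \<Rightarrow> nat \<Rightarrow> ('b \<times> 'b) monoid" where
  "m2_cycles X n = (grp X (Suc n) \<times>\<times> grp X n)\<lparr>carrier :=
     {(x, y). x \<in> carrier (grp X (Suc n)) \<and> y \<in> cycles X n \<and> bd X n x = y \<otimes>\<^bsub>grp X n\<^esub> y}\<rparr>"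

definition m2_bd :: "'b cplx \<Rightarrow> nat \<Rightarrow> ('b \<times> 'b) set" where
  "m2_bd X n = {(b \<otimes>\<^bsub>grp X (Suc n)\<^esub> b \<otimes>\<^bsub>grp X (Suc n)\<^esub> bd X (Suc n) a, bd X n b) | a b.
     a \<in> carrier (grp X (Suc (Suc n))) \<and> b \<in> carrier (grp X (Suc n))}"

definition m2_map :: "(nat \<Rightarrow> 'b \<Rightarrow> 'c) \<Rightarrow> nat \<Rightarrow> 'b \<times> 'b \<Rightarrow> 'c \<times> 'c" where
  "m2_map f n c = (f (Suc n) (fst c), f n (snd c))"

abbreviation m2_class :: "'b cplx \<Rightarrow> nat \<Rightarrow> 'b \<times> 'b \<Rightarrow> ('b \<times> 'b) set" where
  "m2_class X n c \<equiv> m2_bd X n #>\<^bsub>m2_cycles X n\<^esub> c"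

lemma m2_cycles_simps [simp]:
  "c \<in> carrier (m2_cycles X n) \<longleftrightarrow> fst c \<in> carrier (grp X (Suc n)) \<and> snd c \<in> cycles X n \<and>
     bd X n (fst c) = snd c \<otimes>\<^bsub>grp X n\<^esub> snd c"
  "c \<otimes>\<^bsub>m2_cycles X n\<^esub> d = (fst c \<otimes>\<^bsub>grp X (Suc n)\<^esub> fst d, snd c \<otimes>\<^bsub>grp X n\<^esub> snd d)"
  "\<one>\<^bsub>m2_cycles X n\<^esub> = (\<one>\<^bsub>grp X (Suc n)\<^esub>, \<one>\<^bsub>grp X n\<^esub>)"
  by (auto simp: m2_cycles_def DirProd_def split: prod.splits)

lemma m2_cycles_1:
  "c \<in> carrier (m2_cycles Z 1) \<longleftrightarrow>
     fst c \<in> carrier (grp Z 2) \<and> snd c \<in> cycles Z 1 \<and> bd Z 1 (fst c) = snd c \<otimes>\<^bsub>grp Z 1\<^esub> snd c"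
  by (simp add: numeral_2_eq_2)

lemma cycles_1: "y \<in> cycles Z 1 \<longleftrightarrow> y \<in> carrier (grp Z 1) \<and> bd Z 0 y = \<one>\<^bsub>grp Z 0\<^esub>"
  by (simp add: kernel_def)

lemma m2_cycles_comm_group:
  assumes X: "chain_complex X"
  shows "comm_group (m2_cycles X n)"
proof -
  interpret A: comm_group "grp X (Suc n)" by (rule chain_complexD [OF X])
  interpret B: comm_group "grp X n" by (rule chain_complexD [OF X])
  interpret h: group_hom "grp X (Suc n)" "grp X n" "bd X n" by (rule bd_group_hom [OF X])
  interpret Z: subgroup "cycles X n" "grp X n" by (rule subgroup_cycles [OF X])
  interpret D: comm_group "grp X (Suc n) \<times>\<times> grp X n"
    by (intro DirProd_comm_group A.comm_group_axioms B.comm_group_axioms)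
  let ?S = "{(x, y). x \<in> carrier (grp X (Suc n)) \<and> y \<in> cycles X n \<and> bd X n x = y \<otimes>\<^bsub>grp X n\<^esub> y}"
  show ?thesis unfolding m2_cycles_def
  proof (rule D.comm_group_subgroup, rule D.subgroupI)
    have "(\<one>\<^bsub>grp X (Suc n)\<^esub>, \<one>\<^bsub>grp X n\<^esub>) \<in> ?S" by simp
    then show "?S \<noteq> {}" by blast
  next
    fix c assume "c \<in> ?S"
    then obtain x y where c: "c = (x, y)" "x \<in> carrier (grp X (Suc n))" "y \<in> cycles X n"
      "bd X n x = y \<otimes>\<^bsub>grp X n\<^esub> y" by blast
    then have "bd X n (inv\<^bsub>grp X (Suc n)\<^esub> x) = inv\<^bsub>grp X n\<^esub> y \<otimes>\<^bsub>grp X n\<^esub> inv\<^bsub>grp X n\<^esub> y"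
      by (simp add: B.inv_mult_group)
    then show "inv\<^bsub>grp X (Suc n) \<times>\<times> grp X n\<^esub> c \<in> ?S"
      using c by (simp add: inv_DirProd [OF A.is_group B.is_group])
  next
    fix c d assume "c \<in> ?S" "d \<in> ?S"
    then obtain x y x' y' where c: "c = (x, y)" "x \<in> carrier (grp X (Suc n))" "y \<in> cycles X n"
        "bd X n x = y \<otimes>\<^bsub>grp X n\<^esub> y"
      and d: "d = (x', y')" "x' \<in> carrier (grp X (Suc n))" "y' \<in> cycles X n"
        "bd X n x' = y' \<otimes>\<^bsub>grp X n\<^esub> y'" by blast
    have "(y \<otimes>\<^bsub>grp X n\<^esub> y) \<otimes>\<^bsub>grp X n\<^esub> (y' \<otimes>\<^bsub>grp X n\<^esub> y') =
        (y \<otimes>\<^bsub>grp X n\<^esub> y') \<otimes>\<^bsub>grp X n\<^esub> (y \<otimes>\<^bsub>grp X n\<^esub> y')"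
      using c d by (intro B.mult_mult_swap) auto
    then show "c \<otimes>\<^bsub>grp X (Suc n) \<times>\<times> grp X n\<^esub> d \<in> ?S"
      using c d by simp
  qed (use Z.subset in auto)
qed

lemma subgroup_m2_bd:
  assumes X: "chain_complex X"
  shows "subgroup (m2_bd X n) (m2_cycles X n)"
proof -
  let ?X0 = "grp X n" and ?X1 = "grp X (Suc n)" and ?X2 = "grp X (Suc (Suc n))"
  interpret A: comm_group "?X1" by (rule chain_complexD [OF X])
  interpret B: comm_group "?X0" by (rule chain_complexD [OF X])
  interpret h: group_hom "?X1" "?X0" "bd X n" by (rule bd_group_hom [OF X])
  interpret h': group_hom "?X2" "?X1" "bd X (Suc n)"
    by (rule bd_group_hom [OF X])
  interpret M: comm_group "m2_cycles X n" by (rule m2_cycles_comm_group [OF X])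
  have sub: "m2_bd X n \<subseteq> carrier (m2_cycles X n)"
    using boundaries_subset_cycles [OF X, of n] chain_complexD(3) [OF X, of _ n]
    by (auto simp: m2_bd_def boundaries_def)
  show ?thesis
  proof (rule M.subgroupI [OF sub])
    show "m2_bd X n \<noteq> {}"
      unfolding m2_bd_def using A.one_closed h'.one_closed by blast
  next
    fix c assume "c \<in> m2_bd X n"
    then obtain a b where ab: "a \<in> carrier ?X2" "b \<in> carrier ?X1"
      "c = (b \<otimes>\<^bsub>?X1\<^esub> b \<otimes>\<^bsub>?X1\<^esub> bd X (Suc n) a, bd X n b)"
      by (auto simp: m2_bd_def)
    define c' where "c' = (inv\<^bsub>?X1\<^esub> b \<otimes>\<^bsub>?X1\<^esub> inv\<^bsub>?X1\<^esub> b
        \<otimes>\<^bsub>?X1\<^esub> bd X (Suc n) (inv\<^bsub>?X2\<^esub> a), bd X n (inv\<^bsub>?X1\<^esub> b))"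
    have c': "c' \<in> m2_bd X n"
      unfolding c'_def m2_bd_def using ab by blast
    have "c' \<otimes>\<^bsub>m2_cycles X n\<^esub> c = \<one>\<^bsub>m2_cycles X n\<^esub>"
      unfolding c'_def ab using ab(1,2)
      by (simp add: A.mult_mult_swap)
    then have "inv\<^bsub>m2_cycles X n\<^esub> c = c'"
      using sub c' \<open>c \<in> m2_bd X n\<close> by (intro M.inv_equality) auto
    then show "inv\<^bsub>m2_cycles X n\<^esub> c \<in> m2_bd X n" using c' by simp
  next
    fix c d assume "c \<in> m2_bd X n" "d \<in> m2_bd X n"
    then obtain a b a' b' where ab: "a \<in> carrier ?X2" "b \<in> carrier ?X1"
      "c = (b \<otimes>\<^bsub>?X1\<^esub> b \<otimes>\<^bsub>?X1\<^esub> bd X (Suc n) a, bd X n b)"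
      and ab': "a' \<in> carrier ?X2" "b' \<in> carrier ?X1"
      "d = (b' \<otimes>\<^bsub>?X1\<^esub> b' \<otimes>\<^bsub>?X1\<^esub> bd X (Suc n) a', bd X n b')"
      by (auto simp: m2_bd_def)
    have "c \<otimes>\<^bsub>m2_cycles X n\<^esub> d =
      ((b \<otimes>\<^bsub>?X1\<^esub> b') \<otimes>\<^bsub>?X1\<^esub> (b \<otimes>\<^bsub>?X1\<^esub> b')
        \<otimes>\<^bsub>?X1\<^esub> bd X (Suc n) (a \<otimes>\<^bsub>?X2\<^esub> a'),
        bd X n (b \<otimes>\<^bsub>?X1\<^esub> b'))"
      using ab ab' by (simp add: A.m_ac B.m_comm)
    then show "c \<otimes>\<^bsub>m2_cycles X n\<^esub> d \<in> m2_bd X n"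
      unfolding m2_bd_def using ab(1,2) ab'(1,2) by blast
  qed
qed

lemma m2_normal:
  assumes "chain_complex X"
  shows "m2_bd X n \<lhd> m2_cycles X n"
  using comm_group.subgroup_imp_normal [OF m2_cycles_comm_group [OF assms] subgroup_m2_bd [OF assms]] .

definition m2_homology :: "'b cplx \<Rightarrow> nat \<Rightarrow> ('b \<times> 'b) set monoid" where
  "m2_homology X n = m2_cycles X n Mod m2_bd X n"

lemma carrier_m2_homology: "carrier (m2_homology X n) = m2_class X n ` carrier (m2_cycles X n)"
  by (simp add: m2_homology_def carrier_FactGroup)

lemma m2_class_mult:
  assumes "chain_complex X" "c \<in> carrier (m2_cycles X n)" "d \<in> carrier (m2_cycles X n)"
  shows "m2_class X n c \<otimes>\<^bsub>m2_homology X n\<^esub> m2_class X n d = m2_class X n (c \<otimes>\<^bsub>m2_cycles X n\<^esub> d)"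
  unfolding m2_homology_def FactGroup_def monoid.simps
  by (rule normal.rcos_sum [OF m2_normal [OF assms(1)] assms(2,3)])

lemma m2_class_eq_iff:
  assumes "chain_complex X" "c \<in> carrier (m2_cycles X n)" "d \<in> carrier (m2_cycles X n)"
  shows "m2_class X n c = m2_class X n d \<longleftrightarrow> (\<exists>e\<in>m2_bd X n. c = e \<otimes>\<^bsub>m2_cycles X n\<^esub> d)"
  using r_coset_eq_iff [OF _ subgroup_m2_bd [OF assms(1)] assms(2,3)]
    m2_cycles_comm_group [OF assms(1)] by (simp add: comm_group_def)

lemma m2_map_hom:
  assumes f: "chain_map X Y f"
  shows "m2_map f n \<in> hom (m2_cycles X n) (m2_cycles Y n)"
proof -
  interpret h: group_hom "grp X (Suc n)" "grp Y (Suc n)" "f (Suc n)" by (rule chain_map_group_hom [OF f])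
  interpret k: group_hom "grp X n" "grp Y n" "f n" by (rule chain_map_group_hom [OF f])
  have Z: "cycles X n \<subseteq> carrier (grp X n)"
    using subgroup_cycles [OF chain_mapD(1) [OF f]] by (rule subgroup.subset)
  show ?thesis
    using Z chain_map_cycles [OF f]
    by (intro homI) (auto simp: m2_map_def subset_iff simp flip: chain_mapD(4) [OF f])
qed

lemma m2_map_carrier:
  assumes "chain_map X Y f" "c \<in> carrier (m2_cycles X n)"
  shows "m2_map f n c \<in> carrier (m2_cycles Y n)"
  using m2_map_hom [OF assms(1)] assms(2) by (rule hom_in_carrier)

lemma m2_map_bd:
  assumes f: "chain_map X Y f"
  shows "m2_map f n ` m2_bd X n \<subseteq> m2_bd Y n"
proof
  interpret h: group_hom "grp X (Suc n)" "grp Y (Suc n)" "f (Suc n)" by (rule chain_map_group_hom [OF f])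
  interpret h': group_hom "grp X (Suc (Suc n))" "grp Y (Suc (Suc n))" "f (Suc (Suc n))"
    by (rule chain_map_group_hom [OF f])
  interpret d: group_hom "grp X (Suc (Suc n))" "grp X (Suc n)" "bd X (Suc n)"
    by (rule bd_group_hom [OF chain_mapD(1) [OF f]])
  fix c assume "c \<in> m2_map f n ` m2_bd X n"
  then obtain a b where ab: "a \<in> carrier (grp X (Suc (Suc n)))" "b \<in> carrier (grp X (Suc n))"
    "c = m2_map f n (b \<otimes>\<^bsub>grp X (Suc n)\<^esub> b \<otimes>\<^bsub>grp X (Suc n)\<^esub> bd X (Suc n) a, bd X n b)"
    by (auto simp: m2_bd_def)
  then have "c = (f (Suc n) b \<otimes>\<^bsub>grp Y (Suc n)\<^esub> f (Suc n) b
      \<otimes>\<^bsub>grp Y (Suc n)\<^esub> bd Y (Suc n) (f (Suc (Suc n)) a), bd Y n (f (Suc n) b))"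
    by (simp add: m2_map_def chain_mapD(4) [OF f])
  then show "c \<in> m2_bd Y n"
    unfolding m2_bd_def using ab(1,2) h.hom_closed h'.hom_closed by blast
qed

text \<open>
  The next two lemmas are the five lemma for the long exact sequence of the cone, with the chase carried out
  on elements: the component \<open>y\<close> is treated by the assumption in degree \<open>n\<close>, and \<open>x\<close> is then corrected by
  the assumption in degree \<open>n + 1\<close>.
\<close>

lemma m2_inj:
  assumes s: "quasi_iso Y X s" and c: "c \<in> carrier (m2_cycles Y n)" and sc: "m2_map s n c \<in> m2_bd X n"
  shows "c \<in> m2_bd Y n"
proof -
  let ?X0 = "grp X n" and ?X1 = "grp X (Suc n)" and ?X2 = "grp X (Suc (Suc n))"
  let ?Y0 = "grp Y n" and ?Y1 = "grp Y (Suc n)" and ?Y2 = "grp Y (Suc (Suc n))"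
  have f: "chain_map Y X s" using s by (simp add: quasi_iso_def)
  note Y = chain_mapD(1) [OF f] and X = chain_mapD(2) [OF f]
  interpret X0: comm_group "?X0" by (rule chain_complexD [OF X])
  interpret X1: comm_group "?X1" by (rule chain_complexD [OF X])
  interpret X2: comm_group "?X2" by (rule chain_complexD [OF X])
  interpret Y0: comm_group "?Y0" by (rule chain_complexD [OF Y])
  interpret Y1: comm_group "?Y1" by (rule chain_complexD [OF Y])
  interpret s0: group_hom "?Y0" "?X0" "s n" by (rule chain_map_group_hom [OF f])
  interpret s1: group_hom "?Y1" "?X1" "s (Suc n)" by (rule chain_map_group_hom [OF f])
  interpret dX: group_hom "?X1" "?X0" "bd X n" by (rule bd_group_hom [OF X])
  interpret dX': group_hom "?X2" "?X1" "bd X (Suc n)" by (rule bd_group_hom [OF X])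
  interpret dY: group_hom "?Y1" "?Y0" "bd Y n" by (rule bd_group_hom [OF Y])
  obtain x y where xy: "c = (x, y)" "x \<in> carrier ?Y1" "y \<in> cycles Y n"
      "bd Y n x = y \<otimes>\<^bsub>?Y0\<^esub> y"
    using c by (cases c) auto
  obtain a b where ab: "a \<in> carrier ?X2" "b \<in> carrier ?X1"
    "s (Suc n) x = b \<otimes>\<^bsub>?X1\<^esub> b \<otimes>\<^bsub>?X1\<^esub> bd X (Suc n) a" "s n y = bd X n b"
    using sc by (auto simp: m2_bd_def m2_map_def xy)
  have "y \<in> boundaries Y n"
    using quasi_iso_inj [OF s xy(3)] ab by (auto simp: boundaries_def)
  then obtain b' where b': "b' \<in> carrier ?Y1" "y = bd Y n b'"
    by (auto simp: boundaries_def)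
  \<comment> \<open>\<open>s b'\<close> and \<open>b\<close> have the same boundary; a cycle is added to \<open>b'\<close> to make them homologous.\<close>
  have "bd X n (s (Suc n) b') = bd X n b"
    using chain_mapD(4) [OF f b'(1)] b'(2) ab(4) by simp
  then have "b \<otimes>\<^bsub>?X1\<^esub> inv\<^bsub>?X1\<^esub> s (Suc n) b' \<in> cycles X (Suc n)"
    using ab b' by (simp add: kernel_def)
  then obtain u e where ue: "u \<in> cycles Y (Suc n)" "e \<in> carrier ?X2"
      "s (Suc n) u = bd X (Suc n) e \<otimes>\<^bsub>?X1\<^esub> (b \<otimes>\<^bsub>?X1\<^esub> inv\<^bsub>?X1\<^esub> s (Suc n) b')"
    using quasi_iso_surj [OF s] by blast
  then have u: "u \<in> carrier ?Y1" "bd Y n u = \<one>\<^bsub>?Y0\<^esub>"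
    by (auto simp: kernel_def)
  define b'' where "b'' = u \<otimes>\<^bsub>?Y1\<^esub> b'"
  have b'': "b'' \<in> carrier ?Y1" "bd Y n b'' = y"
    using u b' by (auto simp: b''_def)
  have sb'': "s (Suc n) b'' = bd X (Suc n) e \<otimes>\<^bsub>?X1\<^esub> b"
    using u b' ue ab by (simp add: b''_def X1.m_assoc)
  define x' where "x' = inv\<^bsub>?Y1\<^esub> (b'' \<otimes>\<^bsub>?Y1\<^esub> b'') \<otimes>\<^bsub>?Y1\<^esub> x"
  have x': "x' \<in> cycles Y (Suc n)"
    using b'' xy by (auto simp: x'_def kernel_def)
  have eq: "s (Suc n) x = (b \<otimes>\<^bsub>?X1\<^esub> b) \<otimes>\<^bsub>?X1\<^esub> bd X (Suc n) a"
     using ab by simp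
  have "s (Suc n) x' = bd X (Suc n) (inv\<^bsub>?X2\<^esub> (e \<otimes>\<^bsub>?X2\<^esub> e) \<otimes>\<^bsub>?X2\<^esub> a)"
  proof -
    have "s (Suc n) x' = inv\<^bsub>?X1\<^esub> (s (Suc n) b'' \<otimes>\<^bsub>?X1\<^esub> s (Suc n) b'') \<otimes>\<^bsub>?X1\<^esub> s (Suc n) x"
      using b'' xy by (simp add: x'_def)
    also have "s (Suc n) b'' \<otimes>\<^bsub>?X1\<^esub> s (Suc n) b'' =
       (bd X (Suc n) e \<otimes>\<^bsub>?X1\<^esub> bd X (Suc n) e) \<otimes>\<^bsub>?X1\<^esub> (b \<otimes>\<^bsub>?X1\<^esub> b)"
      using sb'' ue ab by (simp add: X1.mult_mult_swap)
    also have "inv\<^bsub>?X1\<^esub> \<dots> = inv\<^bsub>?X1\<^esub> (bd X (Suc n) e \<otimes>\<^bsub>?X1\<^esub> bd X (Suc n) e)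
        \<otimes>\<^bsub>?X1\<^esub> inv\<^bsub>?X1\<^esub> (b \<otimes>\<^bsub>?X1\<^esub> b)"
      using ue ab by (simp add: X1.inv_mult)
    also have "\<dots> \<otimes>\<^bsub>?X1\<^esub> s (Suc n) x =
       inv\<^bsub>?X1\<^esub> (bd X (Suc n) e \<otimes>\<^bsub>?X1\<^esub> bd X (Suc n) e) \<otimes>\<^bsub>?X1\<^esub> bd X (Suc n) a"
      unfolding eq using ue ab by (simp add: X1.m_assoc X1.inv_solve_left' X1.inv_mult)
    finally show ?thesis using ue ab by simp
  qed
  then have "s (Suc n) x' \<in> boundaries X (Suc n)"
    unfolding boundaries_def using ue ab by blast
  then have "x' \<in> boundaries Y (Suc n)"
    by (rule quasi_iso_inj [OF s x'])
  then obtain a' where a': "a' \<in> carrier ?Y2" "x' = bd Y (Suc n) a'"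
    by (auto simp: boundaries_def)
  then have "x = b'' \<otimes>\<^bsub>?Y1\<^esub> b'' \<otimes>\<^bsub>?Y1\<^esub> bd Y (Suc n) a'"
    using b'' xy by (simp add: x'_def flip: a'(2) Y1.m_assoc)
  then show ?thesis
    unfolding m2_bd_def using a' b'' xy by auto
qed

lemma m2_surj:
  assumes s: "quasi_iso Y X s" and c: "c \<in> carrier (m2_cycles X n)"
  obtains c' where "c' \<in> carrier (m2_cycles Y n)" "m2_class X n (m2_map s n c') = m2_class X n c"
proof -
  let ?X0 = "grp X n" and ?X1 = "grp X (Suc n)" and ?X2 = "grp X (Suc (Suc n))"
  let ?Y0 = "grp Y n" and ?Y1 = "grp Y (Suc n)"
  have f: "chain_map Y X s" using s by (simp add: quasi_iso_def)
  note Y = chain_mapD(1) [OF f] and X = chain_mapD(2) [OF f]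
  interpret X0: comm_group "?X0" by (rule chain_complexD [OF X])
  interpret X1: comm_group "?X1" by (rule chain_complexD [OF X])
  interpret X2: comm_group "?X2" by (rule chain_complexD [OF X])
  interpret Y0: comm_group "?Y0" by (rule chain_complexD [OF Y])
  interpret Y1: comm_group "?Y1" by (rule chain_complexD [OF Y])
  interpret s0: group_hom "?Y0" "?X0" "s n" by (rule chain_map_group_hom [OF f])
  interpret s1: group_hom "?Y1" "?X1" "s (Suc n)" by (rule chain_map_group_hom [OF f])
  interpret dX: group_hom "?X1" "?X0" "bd X n" by (rule bd_group_hom [OF X])
  interpret dX': group_hom "?X2" "?X1" "bd X (Suc n)" by (rule bd_group_hom [OF X])
  interpret dY: group_hom "?Y1" "?Y0" "bd Y n" by (rule bd_group_hom [OF Y])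
  interpret ZX: subgroup "cycles X n" "?X0" by (rule subgroup_cycles [OF X])
  interpret ZY: subgroup "cycles Y n" "?Y0" by (rule subgroup_cycles [OF Y])
  interpret MX: comm_group "m2_cycles X n" by (rule m2_cycles_comm_group [OF X])
  obtain x y where xy: "c = (x, y)" "x \<in> carrier ?X1" "y \<in> cycles X n"
      "bd X n x = y \<otimes>\<^bsub>?X0\<^esub> y"
    using c by (cases c) auto
  obtain y' b where y': "y' \<in> cycles Y n" "b \<in> carrier ?X1"
      "s n y' = bd X n b \<otimes>\<^bsub>?X0\<^esub> y"
    using quasi_iso_surj [OF s xy(3)] by blast
  have "s n (y' \<otimes>\<^bsub>?Y0\<^esub> y') = bd X n ((b \<otimes>\<^bsub>?X1\<^esub> b) \<otimes>\<^bsub>?X1\<^esub> x)"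
    using y' xy by (simp add: X0.mult_mult_swap)
  then have "s n (y' \<otimes>\<^bsub>?Y0\<^esub> y') \<in> boundaries X n"
    unfolding boundaries_def using y' xy by blast
  then have "y' \<otimes>\<^bsub>?Y0\<^esub> y' \<in> boundaries Y n"
    using quasi_iso_inj [OF s] y' ZY.m_closed by blast
  then obtain x0 where x0: "x0 \<in> carrier ?Y1" "bd Y n x0 = y' \<otimes>\<^bsub>?Y0\<^esub> y'"
    by (auto simp: boundaries_def)
  define q where "q = (b \<otimes>\<^bsub>?X1\<^esub> b) \<otimes>\<^bsub>?X1\<^esub> x"
  have q: "q \<in> carrier ?X1" using xy y' by (simp add: q_def)
  have "bd X n (s (Suc n) x0) = bd X n q"
    using chain_mapD(4) [OF f x0(1)] x0(2) \<open>s n (y' \<otimes>\<^bsub>?Y0\<^esub> y') = _\<close> by (simp add: q_def)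
  \<comment> \<open>\<open>x0\<close> is corrected by a cycle whose image is homologous to \<open>s x0 - q\<close>.\<close>
  then have "s (Suc n) x0 \<otimes>\<^bsub>?X1\<^esub> inv\<^bsub>?X1\<^esub> q \<in> cycles X (Suc n)"
    using q x0 by (simp add: kernel_def)
  then obtain u e where ue: "u \<in> cycles Y (Suc n)" "e \<in> carrier ?X2"
      "s (Suc n) u = bd X (Suc n) e \<otimes>\<^bsub>?X1\<^esub> (s (Suc n) x0 \<otimes>\<^bsub>?X1\<^esub> inv\<^bsub>?X1\<^esub> q)"
    using quasi_iso_surj [OF s] by blast
  then have u: "u \<in> carrier ?Y1" "bd Y n u = \<one>\<^bsub>?Y0\<^esub>"
    by (auto simp: kernel_def)
  define x' where "x' = x0 \<otimes>\<^bsub>?Y1\<^esub> inv\<^bsub>?Y1\<^esub> u"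
  have x': "x' \<in> carrier ?Y1" "bd Y n x' = y' \<otimes>\<^bsub>?Y0\<^esub> y'"
    using x0 u y' by (auto simp: x'_def)
  have "s (Suc n) x' = s (Suc n) x0 \<otimes>\<^bsub>?X1\<^esub> inv\<^bsub>?X1\<^esub> s (Suc n) u"
    using x0 u by (simp add: x'_def)
  also have "inv\<^bsub>?X1\<^esub> s (Suc n) u = 
       inv\<^bsub>?X1\<^esub> s (Suc n) x0 \<otimes>\<^bsub>?X1\<^esub> (inv\<^bsub>?X1\<^esub> bd X (Suc n) e \<otimes>\<^bsub>?X1\<^esub> q)"
    using ue x0 q by (simp add: X1.inv_mult X1.m_lcomm)
  also have "s (Suc n) x0 \<otimes>\<^bsub>?X1\<^esub> \<dots> = inv\<^bsub>?X1\<^esub> bd X (Suc n) e \<otimes>\<^bsub>?X1\<^esub> q"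
    using ue x0 q by (simp flip: X1.m_assoc)
  also have "\<dots> = (b \<otimes>\<^bsub>?X1\<^esub> b \<otimes>\<^bsub>?X1\<^esub> bd X (Suc n) (inv\<^bsub>?X2\<^esub> e)) \<otimes>\<^bsub>?X1\<^esub> x"
    using ue q xy y' by (simp add: q_def X1.m_ac)
  finally have sx': "s (Suc n) x' = \<dots>" .
  have c': "(x', y') \<in> carrier (m2_cycles Y n)"
    using x' y' by simp
  have "m2_map s n (x', y') = (b \<otimes>\<^bsub>?X1\<^esub> b \<otimes>\<^bsub>?X1\<^esub> bd X (Suc n) (inv\<^bsub>?X2\<^esub> e), bd X n b)
      \<otimes>\<^bsub>m2_cycles X n\<^esub> c"
    using sx' y' by (simp add: m2_map_def xy)
  moreover have "(b \<otimes>\<^bsub>?X1\<^esub> b \<otimes>\<^bsub>?X1\<^esub> bd X (Suc n) (inv\<^bsub>?X2\<^esub> e), bd X n b) \<in> m2_bd X n"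
    unfolding m2_bd_def using ue y' by blast
  ultimately have "m2_class X n (m2_map s n (x', y')) = m2_class X n c"
    using r_coset_eq_iff [OF MX.is_group subgroup_m2_bd [OF X] _ c]
      hom_in_carrier [OF m2_map_hom [OF f] c'] by blast
  with c' show thesis by (rule that)
qed

section \<open>Words of the derived category act on homology mod 2\<close>

text \<open>
  A formal inverse acts by the inverse image of a coset, which is again a coset since quasi-isomorphisms are
  bijective on homology mod 2.
\<close>

fun m2_step :: "nat \<Rightarrow> 'b step \<Rightarrow> ('b \<times> 'b) set \<Rightarrow> ('b \<times> 'b) set" where
  "m2_step n (Fwd X Y f) K = m2_bd Y n <#>\<^bsub>m2_cycles Y n\<^esub> (m2_map f n ` K)"
| "m2_step n (Bwd X Y s) K = {d \<in> carrier (m2_cycles Y n). m2_map s n d \<in> K}"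

primrec m2_word :: "nat \<Rightarrow> 'b step list \<Rightarrow> ('b \<times> 'b) set \<Rightarrow> ('b \<times> 'b) set" where
  "m2_word n [] K = K"
| "m2_word n (\<sigma> # w) K = m2_word n w (m2_step n \<sigma> K)"

lemma m2_word_append: "m2_word n (u @ v) K = m2_word n v (m2_word n u K)"
  by (induction u arbitrary: K) auto

lemma m2_step_Fwd:
  assumes f: "chain_map X Y f" and c: "c \<in> carrier (m2_cycles X n)"
  shows "m2_step n (Fwd X Y f) (m2_class X n c) = m2_class Y n (m2_map f n c)"
  unfolding m2_step.simps
proof (rule image_r_coset)
  show "group (m2_cycles X n)" "group (m2_cycles Y n)"
    using m2_cycles_comm_group chain_mapD(1,2) [OF f] by (auto simp: comm_group_def)
qed (use f c m2_map_hom [OF f] m2_map_bd [OF f] in \<open>auto simp only: chain_mapD subgroup_m2_bd\<close>)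

lemma m2_step_Bwd:
  assumes s: "quasi_iso Y X s" and c: "c \<in> carrier (m2_cycles Y n)"
  shows "m2_step n (Bwd X Y s) (m2_class X n (m2_map s n c)) = m2_class Y n c"
proof -
  have f: "chain_map Y X s" using s by (simp add: quasi_iso_def)
  interpret MX: comm_group "m2_cycles X n" by (rule m2_cycles_comm_group [OF chain_mapD(2) [OF f]])
  interpret MY: comm_group "m2_cycles Y n" by (rule m2_cycles_comm_group [OF chain_mapD(1) [OF f]])
  interpret h: group_hom "m2_cycles Y n" "m2_cycles X n" "m2_map s n"
    by unfold_locales (rule m2_map_hom [OF f])
  interpret BX: subgroup "m2_bd X n" "m2_cycles X n" by (rule subgroup_m2_bd [OF chain_mapD(2) [OF f]])
  interpret BY: subgroup "m2_bd Y n" "m2_cycles Y n" by (rule subgroup_m2_bd [OF chain_mapD(1) [OF f]])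
  have "m2_map s n d \<in> m2_class X n (m2_map s n c) \<longleftrightarrow> d \<in> m2_class Y n c"
    if d: "d \<in> carrier (m2_cycles Y n)" for d
  proof -
    have dc: "d \<otimes>\<^bsub>m2_cycles Y n\<^esub> inv\<^bsub>m2_cycles Y n\<^esub> c \<in> carrier (m2_cycles Y n)"
      by (rule MY.m_closed [OF d MY.inv_closed [OF c]])
    have "m2_map s n d \<in> m2_class X n (m2_map s n c) \<longleftrightarrow>
        m2_map s n d \<otimes>\<^bsub>m2_cycles X n\<^esub> inv\<^bsub>m2_cycles X n\<^esub> m2_map s n c \<in> m2_bd X n"
      by (rule BX.rcos_module [OF MX.is_group h.hom_closed [OF c] h.hom_closed [OF d]])
    also have "\<dots> \<longleftrightarrow> m2_map s n (d \<otimes>\<^bsub>m2_cycles Y n\<^esub> inv\<^bsub>m2_cycles Y n\<^esub> c) \<in> m2_bd X n"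
      by (simp only: h.hom_mult [OF d MY.inv_closed [OF c]] h.hom_inv [OF c])
    also have "\<dots> \<longleftrightarrow> d \<otimes>\<^bsub>m2_cycles Y n\<^esub> inv\<^bsub>m2_cycles Y n\<^esub> c \<in> m2_bd Y n"
      using m2_inj [OF s dc] m2_map_bd [OF f] by blast
    also have "\<dots> \<longleftrightarrow> d \<in> m2_class Y n c"
      by (rule BY.rcos_module [OF MY.is_group c d, symmetric])
    finally show ?thesis .
  qed
  moreover have "m2_class Y n c \<subseteq> carrier (m2_cycles Y n)"
    by (rule MY.r_coset_subset_G [OF BY.subset c])
  ultimately show ?thesis by auto
qed

lemma m2_class_lift:
  assumes s: "quasi_iso Y X s" and K: "K \<in> carrier (m2_homology X n)"
  obtains c where "c \<in> carrier (m2_cycles Y n)" "K = m2_class X n (m2_map s n c)"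
  using K m2_surj [OF s] unfolding carrier_m2_homology by (metis imageE)

lemma m2_step_Fwd_hom:
  assumes f: "chain_map X Y f"
  shows "m2_step n (Fwd X Y f) \<in> hom (m2_homology X n) (m2_homology Y n)"
proof (rule homI)
  fix K assume "K \<in> carrier (m2_homology X n)"
  then obtain c where "c \<in> carrier (m2_cycles X n)" "K = m2_class X n c"
    unfolding carrier_m2_homology by blast
  then show "m2_step n (Fwd X Y f) K \<in> carrier (m2_homology Y n)"
    by (simp only: m2_step_Fwd [OF f] carrier_m2_homology imageI m2_map_carrier [OF f])
next
  fix K L assume "K \<in> carrier (m2_homology X n)" "L \<in> carrier (m2_homology X n)"
  then obtain c d where c: "c \<in> carrier (m2_cycles X n)" "K = m2_class X n c"
    and d: "d \<in> carrier (m2_cycles X n)" "L = m2_class X n d"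
    unfolding carrier_m2_homology by blast
  have cd: "c \<otimes>\<^bsub>m2_cycles X n\<^esub> d \<in> carrier (m2_cycles X n)"
    using m2_cycles_comm_group [OF chain_mapD(1) [OF f]] c d
    by (intro monoid.m_closed) (auto simp: comm_group_def group_def)
  show "m2_step n (Fwd X Y f) (K \<otimes>\<^bsub>m2_homology X n\<^esub> L) =
      m2_step n (Fwd X Y f) K \<otimes>\<^bsub>m2_homology Y n\<^esub> m2_step n (Fwd X Y f) L"
    by (simp only: c d m2_class_mult [OF chain_mapD(1) [OF f]] m2_class_mult [OF chain_mapD(2) [OF f]]
       m2_step_Fwd [OF f] cd m2_map_carrier [OF f] hom_mult [OF m2_map_hom [OF f]])
qed

lemma m2_step_Bwd_hom:
  assumes s: "quasi_iso Y X s"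
  shows "m2_step n (Bwd X Y s) \<in> hom (m2_homology X n) (m2_homology Y n)"
proof (rule homI)
  have f: "chain_map Y X s" using s by (simp add: quasi_iso_def)
  fix K assume "K \<in> carrier (m2_homology X n)"
  then obtain c where c: "c \<in> carrier (m2_cycles Y n)" "K = m2_class X n (m2_map s n c)"
    by (rule m2_class_lift [OF s])
  show "m2_step n (Bwd X Y s) K \<in> carrier (m2_homology Y n)"
    by (simp only: c m2_step_Bwd [OF s] carrier_m2_homology imageI)
  fix L assume "L \<in> carrier (m2_homology X n)"
  then obtain d where d: "d \<in> carrier (m2_cycles Y n)" "L = m2_class X n (m2_map s n d)"
    by (rule m2_class_lift [OF s])
  have cd: "c \<otimes>\<^bsub>m2_cycles Y n\<^esub> d \<in> carrier (m2_cycles Y n)"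
    using m2_cycles_comm_group [OF chain_mapD(1) [OF f]] c d
    by (intro monoid.m_closed) (auto simp: comm_group_def group_def)
  have "K \<otimes>\<^bsub>m2_homology X n\<^esub> L = m2_class X n (m2_map s n (c \<otimes>\<^bsub>m2_cycles Y n\<^esub> d))"
    by (simp only: c d m2_class_mult [OF chain_mapD(2) [OF f]] m2_map_carrier [OF f] 
       hom_mult [OF m2_map_hom [OF f]])
  then show "m2_step n (Bwd X Y s) (K \<otimes>\<^bsub>m2_homology X n\<^esub> L) =
      m2_step n (Bwd X Y s) K \<otimes>\<^bsub>m2_homology Y n\<^esub> m2_step n (Bwd X Y s) L"
    by (simp only: c d m2_step_Bwd [OF s] m2_class_mult [OF chain_mapD(1) [OF f]] cd)
qed

lemma D_mor_complexes:
  assumes "D_mor X w Y"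
  shows "chain_complex X \<and> chain_complex Y"
  using assms by induction (auto simp: quasi_iso_def chain_map_def)

lemma D_mor_append:
  assumes "D_mor X u Y" "D_mor Y v Z"
  shows "D_mor X (u @ v) Z"
  using assms by (induction) (auto intro: D_mor.intros)

lemma D_mor_append_cases:
  assumes "D_mor A (u @ v) Z"
  obtains B where "D_mor A u B" "D_mor B v Z"
  using assms
proof (induction u arbitrary: A thesis)
  case Nil
  then show ?case using D_mor_complexes [of A v Z] by (auto intro: D_mor.nil)
next
  case (Cons \<sigma> u)
  from Cons.prems(2) show ?case
  proof (cases rule: D_mor.cases)
    case (fwd Y f w)
    then show ?thesis using Cons by (metis D_mor.fwd append_Cons list.inject)
  next
    case (bwd Y s w)
    then show ?thesis using Cons by (metis D_mor.bwd append_Cons list.inject)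
  qed auto
qed

lemma D_mor_Fwd: "chain_map X Y f \<Longrightarrow> D_mor X [Fwd X Y f] Y"
  by (auto intro!: D_mor.intros dest: chain_mapD(2))

lemma D_mor_Bwd: "quasi_iso Y X s \<Longrightarrow> D_mor X [Bwd X Y s] Y"
  by (auto intro!: D_mor.intros simp: quasi_iso_def dest: chain_mapD(1))

lemma D_mor_FwdD:
  assumes "D_mor A (Fwd B C f # w) Z"
  shows "A = B" "chain_map A C f" "D_mor C w Z"
  using assms by (auto elim: D_mor.cases)

lemma D_mor_snoc_FwdD:
  assumes "D_mor A (u @ [Fwd B C f]) Z"
  shows "chain_map B C f" "D_mor A u B" "Z = C"
proof -
  obtain B' where B': "D_mor A u B'" "D_mor B' [Fwd B C f] Z" using assms by (rule D_mor_append_cases)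
  then show "chain_map B C f" "D_mor A u B" using D_mor_FwdD [OF B'(2)] by auto
  show "Z = C" using D_mor_FwdD(3) [OF B'(2)] by (auto elim: D_mor.cases)
qed

lemma D_eq_D_mor:
  assumes "D_eq X u v Y"
  shows "D_mor X u Y \<and> D_mor X v Y"
  using assms
proof induction
  case (ident X f)
  then show ?case by (auto intro: D_mor_Fwd D_mor.nil dest: chain_mapD(1))
next
  case (comp X Y f Z g h)
  then show ?case by (auto intro: D_mor.fwd D_mor_Fwd)
next
  case (inv_right X Y s)
  then have "chain_map X Y s" by (simp add: quasi_iso_def)
  then show ?case using D_mor.fwd D_mor_Bwd D_mor.nil chain_mapD(1) inv_right by metis
next
  case (inv_left X Y s)
  then have "chain_map X Y s" by (simp add: quasi_iso_def)
  then show ?case using D_mor.bwd D_mor_Fwd D_mor.nil chain_mapD(2) inv_left by metis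
qed (auto intro: D_mor_append)

lemma m2_word_hom:
  assumes "D_mor X w Y"
  shows "m2_word n w \<in> hom (m2_homology X n) (m2_homology Y n)"
  using assms
proof induction
  case (nil X)
  then show ?case by (simp add: hom_def)
next
  case (fwd X Y f w Z)
  have "m2_word n w \<circ> m2_step n (Fwd X Y f) \<in> hom (m2_homology X n) (m2_homology Z n)"
    by (rule hom_compose [OF m2_step_Fwd_hom [OF fwd(1)] fwd.IH])
  then show ?case by (simp add: o_def)
next
  case (bwd Y X s w Z)
  have "m2_word n w \<circ> m2_step n (Bwd X Y s) \<in> hom (m2_homology X n) (m2_homology Z n)"
    by (rule hom_compose [OF m2_step_Bwd_hom [OF bwd(1)] bwd.IH])
  then show ?case by (simp add: o_def)
qed

text \<open>
  The universal property of the localization for the functor \<open>H(-; Z/2)\<close>: each relation between words holds for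
  the induced maps.
\<close>

theorem m2_word_cong:
  assumes "D_eq X u v Y" "K \<in> carrier (m2_homology X n)"
  shows "m2_word n u K = m2_word n v K"
  using assms
proof (induction arbitrary: K)
  case (cong X u u' Y v v' Z)
  have "m2_word n u K \<in> carrier (m2_homology Y n)"
    using m2_word_hom D_eq_D_mor [OF cong(1)] cong.prems hom_in_carrier by metis
  then show ?case
    using cong by (simp add: m2_word_append)
next
  case (ident X f)
  then obtain c where c: "c \<in> carrier (m2_cycles X n)" "K = m2_class X n c"
    unfolding carrier_m2_homology by blast
  have "m2_map f n c = c"
    using c ident subgroup.subset [OF subgroup_cycles [OF chain_mapD(1) [OF ident(1)]], of n]
    by (auto simp: m2_map_def subset_iff prod_eq_iff)
  then show ?case
    by (simp only: m2_word.simps c m2_step_Fwd [OF ident(1)])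
next
  case (comp X Y f Z g h)
  then obtain c where c: "c \<in> carrier (m2_cycles X n)" "K = m2_class X n c"
    unfolding carrier_m2_homology by blast
  have "m2_map g n (m2_map f n c) = m2_map h n c"
    using c comp(4) subgroup.subset [OF subgroup_cycles [OF chain_mapD(1) [OF comp(1)]], of n]
    by (auto simp: m2_map_def subset_iff prod_eq_iff)
  then show ?case
    by (simp only: m2_word.simps c m2_step_Fwd [OF comp(1)] m2_step_Fwd [OF comp(2)]
        m2_step_Fwd [OF comp(3)] m2_map_carrier [OF comp(1)])
next
  case (inv_right X Y s)
  then obtain c where c: "c \<in> carrier (m2_cycles X n)" "K = m2_class X n c"
    unfolding carrier_m2_homology by blast
  have "chain_map X Y s" using inv_right by (simp add: quasi_iso_def)
  then show ?case
    by (simp only: m2_word.simps c m2_step_Fwd m2_step_Bwd [OF inv_right(1)])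
next
  case (inv_left X Y s)
  then obtain c where c: "c \<in> carrier (m2_cycles X n)" "K = m2_class Y n (m2_map s n c)"
    by (rule m2_class_lift)
  have "chain_map X Y s" using inv_left by (simp add: quasi_iso_def)
  then show ?case
    by (simp only: m2_word.simps c m2_step_Fwd m2_step_Bwd [OF inv_left(1)])
qed auto

lemma m2_word_carrier:
  assumes w: "D_mor A w B" and c: "c \<in> carrier (m2_cycles A n)"
  obtains d where "d \<in> carrier (m2_cycles B n)" "m2_word n w (m2_class A n c) = m2_class B n d"
proof -
  have "m2_class A n c \<in> carrier (m2_homology A n)"
    unfolding carrier_m2_homology using c by (rule imageI)
  then have "m2_word n w (m2_class A n c) \<in> carrier (m2_homology B n)"
    by (rule hom_in_carrier [OF m2_word_hom [OF w]])
  then show thesis using that unfolding carrier_m2_homology by blast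
qed

lemma m2_word_mult:
  assumes w: "D_mor A w B" and c: "c \<in> carrier (m2_cycles A n)" "c' \<in> carrier (m2_cycles A n)"
    and d: "d \<in> carrier (m2_cycles B n)" "d' \<in> carrier (m2_cycles B n)"
    and "m2_word n w (m2_class A n c) = m2_class B n d" "m2_word n w (m2_class A n c') = m2_class B n d'"
  shows "m2_word n w (m2_class A n (c \<otimes>\<^bsub>m2_cycles A n\<^esub> c')) = m2_class B n (d \<otimes>\<^bsub>m2_cycles B n\<^esub> d')"
proof -
  have AB: "chain_complex A" "chain_complex B" using D_mor_complexes [OF w] by auto
  have K: "m2_class A n c \<in> carrier (m2_homology A n)" "m2_class A n c' \<in> carrier (m2_homology A n)"
    unfolding carrier_m2_homology using c by (auto simp only: imageI)
  show ?thesis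
    unfolding m2_class_mult [OF AB(1) c, symmetric] m2_class_mult [OF AB(2) d, symmetric]
      hom_mult [OF m2_word_hom [OF w] K] assms(6,7) ..
qed

text \<open>
  A commutative square in the derived category, evaluated at a class.  That \<open>f\<close> and \<open>g\<close> are chain maps is a
  consequence, since only well-formed words are related; so the derived functors of a hypothetical splitting
  come with their functoriality.
\<close>

lemma m2_word_natural:
  assumes nat: "D_eq A (w @ [Fwd B B' g]) (Fwd A A' f # w') B'"
    and c: "c \<in> carrier (m2_cycles A n)" and h: "h \<in> carrier (m2_cycles B n)"
    and w: "m2_word n w (m2_class A n c) = m2_class B n h"
  shows "chain_map A A' f" "chain_map B B' g"
    and "m2_word n w' (m2_class A' n (m2_map f n c)) = m2_class B' n (m2_map g n h)"
proof -
  have D: "D_mor A (w @ [Fwd B B' g]) B'" "D_mor A (Fwd A A' f # w') B'"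
    using D_eq_D_mor [OF nat] by auto
  show f: "chain_map A A' f" using D_mor_FwdD [OF D(2)] by simp
  show g: "chain_map B B' g" using D_mor_snoc_FwdD [OF D(1)] by simp
  have "m2_class A n c \<in> carrier (m2_homology A n)"
    unfolding carrier_m2_homology using c by (rule imageI)
  from m2_word_cong [OF nat this]
  show "m2_word n w' (m2_class A' n (m2_map f n c)) = m2_class B' n (m2_map g n h)"
    by (simp only: m2_word_append m2_word.simps m2_step_Fwd [OF f c] w m2_step_Fwd [OF g h])
qed

section \<open>Integer valued functionals on groups given by generators and relations\<close>

definition frag_eval :: "('g \<Rightarrow> int) \<Rightarrow> ('g \<Rightarrow>\<^sub>0 int) \<Rightarrow> int" where
  "frag_eval \<tau> x = poly_mapping.lookup (frag_extend (\<lambda>g. frag_cmul (\<tau> g) (frag_of ())) x) ()"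

lemma frag_eval_simps [simp]:
  "frag_eval \<tau> 0 = 0"
  "frag_eval \<tau> (frag_of g) = \<tau> g"
  "frag_eval \<tau> (x + y) = frag_eval \<tau> x + frag_eval \<tau> y"
  "frag_eval \<tau> (x - y) = frag_eval \<tau> x - frag_eval \<tau> y"
  "frag_eval \<tau> (- x) = - frag_eval \<tau> x"
  "frag_eval \<tau> (frag_cmul k x) = k * frag_eval \<tau> x"
  by (simp_all add: frag_eval_def frag_extend_add frag_extend_diff frag_extend_minus frag_extend_cmul
      lookup_add lookup_minus)

lemma frag_eval_frag_extend:
  "frag_eval \<tau> (frag_extend \<phi> x) = frag_eval (\<lambda>g. frag_eval \<tau> (\<phi> g)) x"
  using subset_UNIV by (induction x rule: frag_induction) (simp_all add: frag_extend_diff)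

lemma frag_eval_cong:
  assumes "\<And>g. g \<in> Poly_Mapping.keys x \<Longrightarrow> \<tau> g = \<tau>' g"
  shows "frag_eval \<tau> x = frag_eval \<tau>' x"
  unfolding frag_eval_def by (subst frag_extend_eq [where h = "\<lambda>g. frag_cmul (\<tau>' g) (frag_of ())"])
    (simp_all add: assms)

lemma frag_eval_add_fun:
  "frag_eval (\<lambda>g. \<tau> g + \<tau>' g) x = frag_eval \<tau> x + frag_eval \<tau>' x"
  using subset_UNIV by (induction x rule: frag_induction) simp_all

lemma frag_eval_cmul_fun:
  "frag_eval (\<lambda>g. k * \<tau> g) x = k * frag_eval \<tau> x"
  using subset_UNIV by (induction x rule: frag_induction) (simp_all add: algebra_simps)

lemma frag_cmul_2: "frag_cmul 2 x = x + x"
  using frag_cmul_distrib [of 1 1 x] by simp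

lemma keys_add_subset:
  "Poly_Mapping.keys x \<subseteq> S \<Longrightarrow> Poly_Mapping.keys y \<subseteq> S \<Longrightarrow> Poly_Mapping.keys (x + y) \<subseteq> S"
  using keys_add [of x y] by blast

lemma keys_diff_subset:
  "Poly_Mapping.keys x \<subseteq> S \<Longrightarrow> Poly_Mapping.keys y \<subseteq> S \<Longrightarrow> Poly_Mapping.keys (x - y) \<subseteq> S"
  using keys_diff [of x y] by blast

lemma keys_free_subset:
  "R \<subseteq> carrier (free_Abelian_group S) \<Longrightarrow> r \<in> R \<Longrightarrow> Poly_Mapping.keys r \<subseteq> S"
  by (drule (1) subsetD) simp

abbreviation rel_class :: "'g set \<Rightarrow> ('g \<Rightarrow>\<^sub>0 int) set \<Rightarrow> ('g \<Rightarrow>\<^sub>0 int) \<Rightarrow> ('g \<Rightarrow>\<^sub>0 int) set" where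
  "rel_class S R x \<equiv> rel_subgroup S R #>\<^bsub>free_Abelian_group S\<^esub> x"

lemma subgroup_rel_subgroup:
  assumes "R \<subseteq> carrier (free_Abelian_group S)"
  shows "subgroup (rel_subgroup S R) (free_Abelian_group S)"
  unfolding rel_subgroup_def
  by (rule group.generate_is_subgroup [OF group_free_Abelian_group assms])

lemma rel_subgroup_incl: "r \<in> R \<Longrightarrow> r \<in> rel_subgroup S R"
  unfolding rel_subgroup_def by (rule generate.incl)

lemma rel_subgroup_add: "r \<in> rel_subgroup S R \<Longrightarrow> r' \<in> rel_subgroup S R \<Longrightarrow> r + r' \<in> rel_subgroup S R"
  unfolding rel_subgroup_def using generate.eng [of r "free_Abelian_group S" R r'] by simp

lemma rel_subgroup_zero: "0 \<in> rel_subgroup S R"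
  unfolding rel_subgroup_def using generate.one [of "free_Abelian_group S" R] by simp

lemma rel_subgroup_minus:
  assumes "R \<subseteq> carrier (free_Abelian_group S)" "r \<in> rel_subgroup S R"
  shows "- r \<in> rel_subgroup S R"
proof -
  interpret H: subgroup "rel_subgroup S R" "free_Abelian_group S"
    by (rule subgroup_rel_subgroup [OF assms(1)])
  have "Poly_Mapping.keys r \<subseteq> S" using keys_free_subset [OF H.subset assms(2)] .
  then show ?thesis using H.m_inv_closed [OF assms(2)] by simp
qed

lemma rel_subgroup_diff:
  assumes "R \<subseteq> carrier (free_Abelian_group S)" "r \<in> rel_subgroup S R" "r' \<in> rel_subgroup S R"
  shows "r - r' \<in> rel_subgroup S R"
  using rel_subgroup_add [OF assms(2) rel_subgroup_minus [OF assms(1,3)]] by simp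

lemma frag_extend_rel_subgroup:
  assumes R: "R \<subseteq> carrier (free_Abelian_group S)" and R': "R' \<subseteq> carrier (free_Abelian_group S')"
    and \<phi>: "\<And>r. r \<in> R \<Longrightarrow> frag_extend \<phi> r \<in> rel_subgroup S' R'"
    and r: "r \<in> rel_subgroup S R"
  shows "frag_extend \<phi> r \<in> rel_subgroup S' R'"
  using r unfolding rel_subgroup_def [of S R]
proof induction
  case (inv h)
  then have "Poly_Mapping.keys h \<subseteq> S" using keys_free_subset [OF R] by blast
  then show ?case using rel_subgroup_minus [OF R' \<phi>] inv by (simp add: frag_extend_minus)
qed (auto simp: rel_subgroup_zero \<phi> frag_extend_add rel_subgroup_add)

lemma r_coset_free: "N #>\<^bsub>free_Abelian_group S\<^esub> x = {r + x | r. r \<in> N}"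
  by (auto simp: r_coset_def)

lemma rel_class_eqI:
  assumes R: "R \<subseteq> carrier (free_Abelian_group S)" and "x - y \<in> rel_subgroup S R"
    and "Poly_Mapping.keys x \<subseteq> S" "Poly_Mapping.keys y \<subseteq> S"
  shows "rel_class S R x = rel_class S R y"
  using assms r_coset_eq_iff [OF group_free_Abelian_group subgroup_rel_subgroup [OF R], of x y]
  by (metis carrier_free_Abelian_group_iff diff_add_cancel mult_free_Abelian_group)

lemma rel_class_self: "x \<in> rel_class S R x"
  unfolding r_coset_free using rel_subgroup_zero by force

lemma carrier_presented: "carrier (presented S R) = rel_class S R ` carrier (free_Abelian_group S)"
  by (simp add: presented_def carrier_FactGroup)

lemma mult_presented: "X \<otimes>\<^bsub>presented S R\<^esub> Y = {x + y | x y. x \<in> X \<and> y \<in> Y}"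
  by (auto simp: presented_def set_mult_def)

lemma one_presented: "\<one>\<^bsub>presented S R\<^esub> = rel_class S R 0"
  by (simp add: presented_def r_coset_free)

lemma rel_class_in_presented:
  "Poly_Mapping.keys x \<subseteq> S \<Longrightarrow> rel_class S R x \<in> carrier (presented S R)"
  by (auto simp: carrier_presented)

lemma comm_group_presented:
  assumes "R \<subseteq> carrier (free_Abelian_group S)"
  shows "comm_group (presented S R)"
  unfolding presented_def
  by (rule comm_group.abelian_FactGroup [OF abelian_free_Abelian_group subgroup_rel_subgroup [OF assms]])

lemma rel_class_mult:
  assumes "R \<subseteq> carrier (free_Abelian_group S)" "Poly_Mapping.keys x \<subseteq> S" "Poly_Mapping.keys y \<subseteq> S"
  shows "rel_class S R x \<otimes>\<^bsub>presented S R\<^esub> rel_class S R y = rel_class S R (x + y)"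
proof -
  have "rel_subgroup S R \<lhd> free_Abelian_group S"
    using comm_group.subgroup_imp_normal [OF abelian_free_Abelian_group] subgroup_rel_subgroup [OF assms(1)] by blast
  then show ?thesis
    using assms by (simp add: presented_def normal.rcos_sum)
qed

lemma rel_class_unique:
  assumes R: "R \<subseteq> carrier (free_Abelian_group S)" and X: "X \<in> carrier (presented S R)" and x: "x \<in> X"
  shows "X = rel_class S R x"
proof -
  obtain y where "Poly_Mapping.keys y \<subseteq> S" "X = rel_class S R y"
    using X by (auto simp: carrier_presented)
  then show ?thesis
    using x group.repr_independence [OF group_free_Abelian_group _ _ subgroup_rel_subgroup [OF R], of x y]
    by simp
qed

lemma presented_keys:
  assumes R: "R \<subseteq> carrier (free_Abelian_group S)" and X: "X \<in> carrier (presented S R)" and x: "x \<in> X"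
  shows "Poly_Mapping.keys x \<subseteq> S"
proof -
  obtain y where "Poly_Mapping.keys y \<subseteq> S" "X = rel_class S R y"
    using X by (auto simp: carrier_presented)
  then obtain r where "r \<in> rel_subgroup S R" "x = r + y"
    using x by (auto simp: r_coset_free)
  then show ?thesis
    using \<open>Poly_Mapping.keys y \<subseteq> S\<close> keys_free_subset [OF subgroup.subset [OF subgroup_rel_subgroup [OF R]], of r]
      keys_add [of r y] by fastforce
qed

lemma presented_map_class:
  assumes "R \<subseteq> carrier (free_Abelian_group S)" "R' \<subseteq> carrier (free_Abelian_group S')"
    and "\<And>g. g \<in> S \<Longrightarrow> Poly_Mapping.keys (\<phi> g) \<subseteq> S'"
    and "\<And>r. r \<in> R \<Longrightarrow> frag_extend \<phi> r \<in> rel_subgroup S' R'"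
    and "Poly_Mapping.keys x \<subseteq> S"
  shows "presented_map S' R' \<phi> (rel_class S R x) = rel_class S' R' (frag_extend \<phi> x)"
  unfolding presented_map_def
proof (rule image_r_coset)
  show "frag_extend \<phi> \<in> hom (free_Abelian_group S) (free_Abelian_group S')"
    using assms(3) by (intro homI) (auto simp: frag_extend_add dest!: keys_frag_extend [THEN subsetD])
  show "x \<in> carrier (free_Abelian_group S)" using assms(5) by simp
qed (use assms(1-4) in \<open>auto simp: subgroup_rel_subgroup frag_extend_rel_subgroup\<close>)

lemma presented_map_mem:
  "x \<in> X \<Longrightarrow> frag_extend \<phi> x \<in> presented_map S R \<phi> X"
  unfolding presented_map_def set_mult_def using rel_subgroup_zero [of S R] by force

text \<open>
  A coset is determined by any of its elements.  This computes maps that are known to be well defined because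
  they belong to a chain map, without returning to the relations.
\<close>

lemma presented_map_class':
  assumes "R' \<subseteq> carrier (free_Abelian_group S')" "x \<in> X"
    and "presented_map S' R' \<phi> X \<in> carrier (presented S' R')"
  shows "presented_map S' R' \<phi> X = rel_class S' R' (frag_extend \<phi> x)"
  using rel_class_unique [OF assms(1,3) presented_map_mem [OF assms(2)]] .

text \<open>
  A functional on a presented group is a function on the generators; its value at a coset makes sense modulo
  \<open>m\<close> as soon as it is constant modulo \<open>m\<close> on that coset.  Functionals with values in \<open>Z\<close> are the case \<open>m = 0\<close>.
\<close>

definition kills :: "int \<Rightarrow> ('g \<Rightarrow> int) \<Rightarrow> ('g \<Rightarrow>\<^sub>0 int) set \<Rightarrow> bool" where
  "kills m \<tau> R \<longleftrightarrow> (\<forall>r\<in>R. m dvd frag_eval \<tau> r)"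

definition has_val :: "int \<Rightarrow> ('g \<Rightarrow> int) \<Rightarrow> ('g \<Rightarrow>\<^sub>0 int) set \<Rightarrow> int \<Rightarrow> bool" where
  "has_val m \<tau> X v \<longleftrightarrow> X \<noteq> {} \<and> (\<forall>x\<in>X. m dvd frag_eval \<tau> x - v)"

lemma kills_rel_subgroup:
  assumes R: "R \<subseteq> carrier (free_Abelian_group S)" and "kills m \<tau> R"
  shows "kills m \<tau> (rel_subgroup S R)"
proof -
  have "m dvd frag_eval \<tau> r" if "r \<in> rel_subgroup S R" for r
    using that unfolding rel_subgroup_def
  proof induction
    case (inv h)
    then have "Poly_Mapping.keys h \<subseteq> S" using keys_free_subset [OF R] by blast
    then show ?case using inv assms by (simp add: kills_def)
  qed (use assms in \<open>auto simp: kills_def\<close>)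
  then show ?thesis by (simp add: kills_def)
qed

lemma has_val_rel_class:
  assumes R: "R \<subseteq> carrier (free_Abelian_group S)" and "kills m \<tau> R"
  shows "has_val m \<tau> (rel_class S R x) (frag_eval \<tau> x)"
  using kills_rel_subgroup [OF assms] by (auto simp: has_val_def r_coset_free kills_def rel_subgroup_zero)
     (use rel_subgroup_zero in blast)

lemma has_val_exists:
  assumes R: "R \<subseteq> carrier (free_Abelian_group S)" and "kills m \<tau> R" and "X \<in> carrier (presented S R)"
  obtains v where "has_val m \<tau> X v"
  using has_val_rel_class [OF assms(1,2)] assms(3) by (auto simp: carrier_presented)

lemma has_val_unique:
  assumes "has_val m \<tau> X v" "has_val m \<tau> X w"
  shows "m dvd v - w"
proof -
  obtain x where "x \<in> X" "m dvd frag_eval \<tau> x - v" "m dvd frag_eval \<tau> x - w"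
    using assms by (auto simp: has_val_def)
  then have "m dvd (frag_eval \<tau> x - w) - (frag_eval \<tau> x - v)" using dvd_diff by blast
  then show ?thesis by simp
qed

lemma has_val_cong_val:
  assumes "has_val m \<tau> X v" "m dvd v - w"
  shows "has_val m \<tau> X w"
  unfolding has_val_def
proof (intro conjI ballI)
  show "X \<noteq> {}" using assms by (auto simp: has_val_def)
  fix x assume "x \<in> X"
  then have "m dvd (frag_eval \<tau> x - v) + (v - w)" using assms by (intro dvd_add) (auto simp: has_val_def)
  then show "m dvd frag_eval \<tau> x - w" by simp
qed

lemma has_val_mult:
  assumes "has_val m \<tau> X v" "has_val m \<tau> Y w"
  shows "has_val m \<tau> (X \<otimes>\<^bsub>presented S R\<^esub> Y) (v + w)"
  unfolding has_val_def mult_presented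
proof (intro conjI ballI)
  show "{x + y |x y. x \<in> X \<and> y \<in> Y} \<noteq> {}" using assms by (auto simp: has_val_def)
  fix z assume "z \<in> {x + y |x y. x \<in> X \<and> y \<in> Y}"
  then obtain x y where "z = x + y" "m dvd frag_eval \<tau> x - v" "m dvd frag_eval \<tau> y - w"
    using assms by (auto simp: has_val_def)
  then show "m dvd frag_eval \<tau> z - (v + w)"
    using dvd_add [of m "frag_eval \<tau> x - v" "frag_eval \<tau> y - w"] by (simp add: algebra_simps)
qed

lemma has_val_one:
  assumes "R \<subseteq> carrier (free_Abelian_group S)" "kills m \<tau> R"
  shows "has_val m \<tau> \<one>\<^bsub>presented S R\<^esub> 0"
  unfolding one_presented using has_val_rel_class [OF assms, of 0] by simp

lemma has_val_inv:
  assumes R: "R \<subseteq> carrier (free_Abelian_group S)" and \<tau>: "kills m \<tau> R"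
    and X: "X \<in> carrier (presented S R)" and v: "has_val m \<tau> X v"
  shows "has_val m \<tau> (inv\<^bsub>presented S R\<^esub> X) (- v)"
proof -
  interpret G: comm_group "presented S R" by (rule comm_group_presented [OF R])
  obtain w where w: "has_val m \<tau> (inv\<^bsub>presented S R\<^esub> X) w"
    using has_val_exists [OF R \<tau> G.inv_closed [OF X]] by blast
  have "has_val m \<tau> \<one>\<^bsub>presented S R\<^esub> (w + v)"
    using has_val_mult [OF w v, of S R] G.l_inv [OF X] by simp
  then have "m dvd (w + v) - 0"
    using has_val_one [OF R \<tau>] by (rule has_val_unique)
  with w show ?thesis by (simp add: has_val_cong_val [OF w])
qed

lemma has_val_presented_map:
  assumes R: "R \<subseteq> carrier (free_Abelian_group S)" and "kills m \<tau> R"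
    and X: "has_val m (\<lambda>g. frag_eval \<tau> (\<phi> g)) X v"
  shows "has_val m \<tau> (presented_map S R \<phi> X) v"
  unfolding has_val_def
proof (intro conjI ballI)
  show "presented_map S R \<phi> X \<noteq> {}"
    using X presented_map_mem by (fastforce simp: has_val_def)
  fix z assume "z \<in> presented_map S R \<phi> X"
  then obtain r x where "r \<in> rel_subgroup S R" "x \<in> X" "z = r + frag_extend \<phi> x"
    by (auto simp: presented_map_def set_mult_def)
  moreover from this have "m dvd frag_eval \<tau> r" "m dvd frag_eval \<tau> (frag_extend \<phi> x) - v"
    using kills_rel_subgroup [OF R assms(2)] X by (auto simp: kills_def has_val_def frag_eval_frag_extend)
  ultimately show "m dvd frag_eval \<tau> z - v"
    using dvd_add [of m "frag_eval \<tau> r" "frag_eval \<tau> (frag_extend \<phi> x) - v"] by (simp add: algebra_simps)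
qed

lemma has_val_add:
  assumes "has_val m \<tau> X v" "has_val m \<tau>' X w"
  shows "has_val m (\<lambda>g. \<tau> g + \<tau>' g) X (v + w)"
  unfolding has_val_def
proof (intro conjI ballI)
  show "X \<noteq> {}" using assms by (auto simp: has_val_def)
  fix x assume "x \<in> X"
  then have "m dvd frag_eval \<tau> x - v" "m dvd frag_eval \<tau>' x - w"
    using assms by (auto simp: has_val_def)
  then show "m dvd frag_eval (\<lambda>g. \<tau> g + \<tau>' g) x - (v + w)"
    using dvd_add [of m "frag_eval \<tau> x - v" "frag_eval \<tau>' x - w"] by (simp add: algebra_simps frag_eval_add_fun)
qed

lemma has_val_cmul:
  assumes "has_val m \<tau> X v"
  shows "has_val m (\<lambda>g. k * \<tau> g) X (k * v)"
  using assms by (auto simp: has_val_def frag_eval_cmul_fun simp flip: right_diff_distrib)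

lemma has_val_sum:
  assumes "finite I" "X \<noteq> {}" "\<And>i. i \<in> I \<Longrightarrow> has_val m (\<tau> i) X (v i)"
  shows "has_val m (\<lambda>g. \<Sum>i\<in>I. \<tau> i g) X (\<Sum>i\<in>I. v i)"
  using assms(1,3)
proof (induction I rule: finite_induct)
  case empty
  have "frag_eval (\<lambda>g. 0) x = 0" for x :: "'b \<Rightarrow>\<^sub>0 int"
    using frag_eval_cmul_fun [of 0 "\<lambda>g. 0" x] by simp
  then show ?case using assms(2) by (simp add: has_val_def)
next
  case (insert i I)
  then show ?case using has_val_add [of m "\<tau> i" X "v i"] by simp
qed

lemma has_val_zero: "X \<noteq> {} \<Longrightarrow> has_val m (\<lambda>g. 0) X 0"
  using has_val_sum [of "{}" X m "\<lambda>i g. 0"] by simp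

lemma presented_nonempty: "X \<in> carrier (presented S R) \<Longrightarrow> X \<noteq> {}"
  using rel_class_self by (fastforce simp: carrier_presented)

lemma has_val_mod:
  assumes "has_val 0 \<tau> X v"
  shows "has_val m \<tau> X v"
  using assms by (auto simp: has_val_def)

lemma has_val_cong:
  assumes R: "R \<subseteq> carrier (free_Abelian_group S)" and X: "X \<in> carrier (presented S R)"
    and "\<And>g. g \<in> S \<Longrightarrow> \<tau> g = \<tau>' g" and "has_val m \<tau> X v"
  shows "has_val m \<tau>' X v"
proof -
  have "frag_eval \<tau> x = frag_eval \<tau>' x" if "x \<in> X" for x
    using presented_keys [OF R X that] assms(3) by (intro frag_eval_cong) auto
  then show ?thesis using assms(4) by (simp add: has_val_def)
qed

lemma has_val_cong_mod:
  assumes R: "R \<subseteq> carrier (free_Abelian_group S)" and X: "X \<in> carrier (presented S R)"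
    and eq: "\<And>g. g \<in> S \<Longrightarrow> m dvd \<tau> g - \<tau>' g" and v: "has_val m \<tau> X v"
  shows "has_val m \<tau>' X v"
proof -
  have "has_val m (\<lambda>g. m * ((\<tau>' g - \<tau> g) div m)) X 0"
    using v by (auto simp: has_val_def frag_eval_cmul_fun)
  from has_val_add [OF v this]
  have "has_val m (\<lambda>g. \<tau> g + m * ((\<tau>' g - \<tau> g) div m)) X v" by simp
  moreover have "\<tau> g + m * ((\<tau>' g - \<tau> g) div m) = \<tau>' g" if "g \<in> S" for g
    using eq [OF that] by (subst dvd_mult_div_cancel) (auto simp: dvd_diff_commute)
  ultimately show ?thesis by (rule has_val_cong [OF R X, rotated])
qed

text \<open>
  On the normalized complex the differential \<open>d\<^sub>0\<close> is the alternating sum of all faces, so a functional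
  is evaluated on a boundary by means of its alternating coboundary.
\<close>

lemma has_val_normalized_bd:
  assumes R: "R \<subseteq> carrier (free_Abelian_group S)" and R': "R' \<subseteq> carrier (free_Abelian_group S')"
    and X: "X \<in> carrier (presented S R)" and \<tau>: "kills m \<tau> R'"
    and \<tau>\<phi>: "\<And>i. i \<le> n \<Longrightarrow> kills m (\<lambda>g. frag_eval \<tau> (\<phi> i g)) R"
    and norm: "\<And>i. i \<in> {1..n} \<Longrightarrow> presented_map S' R' (\<phi> i) X = \<one>\<^bsub>presented S' R'\<^esub>"
    and \<mu>: "\<And>g. g \<in> S \<Longrightarrow> \<mu> g = (\<Sum>i\<le>n. (-1) ^ i * frag_eval \<tau> (\<phi> i g))"
    and v: "has_val m \<mu> X v"
  shows "has_val m \<tau> (presented_map S' R' (\<phi> 0) X) v"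
proof -
  have "\<exists>w. has_val m (\<lambda>g. frag_eval \<tau> (\<phi> i g)) X w" if "i \<le> n" for i
    using has_val_exists [OF R \<tau>\<phi> [OF that] X] by blast
  then obtain w where w: "\<And>i. i \<le> n \<Longrightarrow> has_val m (\<lambda>g. frag_eval \<tau> (\<phi> i g)) X (w i)" by metis
  have X0: "X \<noteq> {}" using v by (simp add: has_val_def)
  have "has_val m (\<lambda>g. \<Sum>i\<le>n. (-1) ^ i * frag_eval \<tau> (\<phi> i g)) X (\<Sum>i\<le>n. (-1) ^ i * w i)"
    using X0 by (intro has_val_sum has_val_cmul w) auto
  then have "has_val m \<mu> X (\<Sum>i\<le>n. (-1) ^ i * w i)"
    by (rule has_val_cong [OF R X, rotated]) (simp add: \<mu>)
  then have "m dvd (\<Sum>i\<le>n. (-1) ^ i * w i) - v" using v by (rule has_val_unique)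
  moreover have "m dvd w i" if "i \<in> {1..n}" for i
  proof -
    have "has_val m \<tau> \<one>\<^bsub>presented S' R'\<^esub> (w i)"
      using has_val_presented_map [OF R' \<tau> w, of i] norm [OF that] that by simp
    from has_val_unique [OF this has_val_one [OF R' \<tau>]] show ?thesis by simp
  qed
  then have "m dvd (\<Sum>i\<in>{1..n}. (-1) ^ i * w i)" by (intro dvd_sum) simp
  moreover have "(\<Sum>i\<le>n. (-1) ^ i * w i) = w 0 + (\<Sum>i\<in>{1..n}. (-1) ^ i * w i)"
    by (simp add: atMost_atLeast0 sum.atLeast_Suc_atMost)
  ultimately have "m dvd w 0 - v"
    using dvd_diff [of m "(\<Sum>i\<le>n. (-1) ^ i * w i) - v" "(\<Sum>i\<in>{1..n}. (-1) ^ i * w i)"] by (simp add: algebra_simps)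
  then show ?thesis
    by (rule has_val_cong_val [OF has_val_presented_map [OF R' \<tau> w], rotated]) simp
qed

text \<open>
  A functional on cycles mod 2 that vanishes on boundaries is a homology invariant modulo 2, because the
  first component of a boundary mod 2 is twice a chain plus a boundary.
\<close>

lemma m2_class_val:
  assumes Z: "chain_complex Z" and sub: "carrier (grp Z 2) \<subseteq> carrier (presented S R)"
    and mult: "(\<otimes>\<^bsub>grp Z 2\<^esub>) = (\<otimes>\<^bsub>presented S R\<^esub>)"
    and R: "R \<subseteq> carrier (free_Abelian_group S)" and \<tau>: "kills 2 \<tau> R"
    and bd: "\<And>a. a \<in> carrier (grp Z 3) \<Longrightarrow> has_val 0 \<tau> (bd Z 2 a) 0"
    and cd: "c \<in> carrier (m2_cycles Z 1)" "d \<in> carrier (m2_cycles Z 1)" "m2_class Z 1 c = m2_class Z 1 d"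
    and v: "has_val 2 \<tau> (fst c) v" and w: "has_val 2 \<tau> (fst d) w"
  shows "2 dvd v - w"
proof -
  obtain e where "e \<in> m2_bd Z 1" "c = e \<otimes>\<^bsub>m2_cycles Z 1\<^esub> d"
    using m2_class_eq_iff [OF Z cd(1,2)] cd(3) by blast
  then obtain a b where ab: "a \<in> carrier (grp Z 3)" "b \<in> carrier (grp Z 2)"
      "fst c = b \<otimes>\<^bsub>grp Z 2\<^esub> b \<otimes>\<^bsub>grp Z 2\<^esub> bd Z 2 a \<otimes>\<^bsub>grp Z 2\<^esub> fst d"
    unfolding m2_bd_def by (auto simp: numeral_3_eq_3 numeral_2_eq_2)
  obtain u where u: "has_val 2 \<tau> b u"
    using has_val_exists [OF R \<tau>] ab(2) sub by blast
  have "has_val 2 \<tau> (fst c) (u + u + 0 + w)"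
    unfolding ab(3) mult using has_val_mod [OF bd [OF ab(1)]] by (intro has_val_mult u w)
  from has_val_unique [OF v this] have "2 dvd v - w - 2 * u" by (simp add: algebra_simps)
  then show ?thesis by presburger
qed

section \<open>Quadratic functionals on \<open>S\<^sup>2\<close> and \<open>\<Gamma>\<^sub>2\<close>\<close>

text \<open>
  For additive \<open>p\<close> and \<open>q\<close> the quadratic form \<open>a \<mapsto> p a * q a\<close> extends to \<open>\<Gamma>\<^sub>2\<close>, with its polarization as
  the value at a product; on \<open>S\<^sup>2\<close> the polarization remains.
\<close>

fun quad :: "('a \<Rightarrow> int) \<Rightarrow> ('a \<Rightarrow> int) \<Rightarrow> ('a, 'b) gen \<Rightarrow> int" where
  "quad p q (Prod a b) = p a * q b + p b * q a"
| "quad p q (Divsq a) = p a * q a"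
| "quad p q (Tens b t) = 0"

fun tens_val :: "('b \<Rightarrow> int) \<Rightarrow> ('a, 'b) gen \<Rightarrow> int" where
  "tens_val p (Tens a t) = p a * t"
| "tens_val p _ = 0"

lemma prod_rels_closed:
  assumes "monoid A"
  shows "prod_rels A \<subseteq> carrier (free_Abelian_group (prod_gens A))"
  unfolding prod_rels_def using monoid.m_closed [OF assms]
  by (auto simp: prod_gens_def dest!: keys_diff [THEN subsetD])

lemma G2_rels_closed:
  assumes "group A"
  shows "G2_rels A \<subseteq> carrier (free_Abelian_group (G2_gens A))"
proof -
  interpret group A by fact
  have "prod_rels A \<subseteq> carrier (free_Abelian_group (G2_gens A))"
    using keys_free_subset [OF prod_rels_closed [OF is_monoid]] by (fastforce simp: G2_gens_def)
  then show ?thesis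
    unfolding G2_rels_def
    by (auto simp: G2_gens_def prod_gens_def dest!: keys_diff [THEN subsetD] split: if_splits)
qed

lemma tens_rels_closed:
  assumes "monoid A" "monoid B"
  shows "tens_rels A B \<subseteq> carrier (free_Abelian_group (tens_gens A B))"
  unfolding tens_rels_def using monoid.m_closed [OF assms(1)] monoid.m_closed [OF assms(2)]
  by (auto simp: tens_gens_def dest!: keys_diff [THEN subsetD])

lemma quad_kills_prod_rels:
  assumes "p \<in> hom A integer_group" "q \<in> hom A integer_group"
  shows "kills m (quad p q) (prod_rels A)"
  using assms by (auto simp: kills_def prod_rels_def hom_mult) (simp_all add: algebra_simps)

lemma quad_kills_G2_rels:
  fixes A :: "'a monoid"
  assumes A: "group A" and p: "p \<in> hom A integer_group" and q: "q \<in> hom A integer_group"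
  shows "kills m (quad p q) (G2_rels A :: (('a, 'b) gen \<Rightarrow>\<^sub>0 int) set)"
proof -
  have "p (a [^]\<^bsub>A\<^esub> k) = k * p a" "q (a [^]\<^bsub>A\<^esub> k) = k * q a" if "a \<in> carrier A" for a and k :: int
    using hom_int_pow [OF p that A group_integer_group] hom_int_pow [OF q that A group_integer_group] by simp_all
  moreover have "kills m (quad p q) (prod_rels A :: (('a, 'b) gen \<Rightarrow>\<^sub>0 int) set)"
    by (rule quad_kills_prod_rels [OF p q])
  ultimately show ?thesis
    using p q
    by (auto simp: kills_def G2_rels_def hom_mult) (simp_all add: algebra_simps power2_eq_square)
qed

lemma tens_val_kills:
  assumes "p \<in> hom A integer_group"
  shows "kills 2 (tens_val p) (tens_rels A Z2)"
proof -
  have "2 dvd p a * ((t + t') mod 2) - p a * t - p a * t'" for a t t'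
  proof -
    have "p a * ((t + t') mod 2) - p a * t - p a * t' = p a * ((t + t') mod 2 - (t + t'))"
      by (simp add: algebra_simps)
    moreover have "2 dvd (t + t') mod 2 - (t + t')" by presburger
    ultimately show ?thesis by simp
  qed
  then show ?thesis
    using assms by (auto simp: kills_def tens_rels_def hom_mult distrib_right)
qed

section \<open>Functoriality of \<open>S\<^sup>2\<close>, \<open>\<Gamma>\<^sub>2\<close> and \<open>- \<otimes> Z/2\<close>\<close>

abbreviation G2_class :: "'a monoid \<Rightarrow> (('a, 'b) gen \<Rightarrow>\<^sub>0 int) \<Rightarrow> ('a, 'b) gens" where
  "G2_class A \<equiv> rel_class (G2_gens A) (G2_rels A)"

abbreviation S2_class :: "'a monoid \<Rightarrow> (('a, 'b) gen \<Rightarrow>\<^sub>0 int) \<Rightarrow> ('a, 'b) gens" where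
  "S2_class A \<equiv> rel_class (prod_gens A) (prod_rels A)"

fun G2_fun :: "('a \<Rightarrow> 'c) \<Rightarrow> ('a, 'b) gen \<Rightarrow> ('c, 'b) gen \<Rightarrow>\<^sub>0 int" where
  "G2_fun f (Prod a b) = frag_of (Prod (f a) (f b))"
| "G2_fun f (Divsq a) = frag_of (Divsq (f a))"
| "G2_fun f (Tens b t) = 0"

fun S2_fun :: "('a \<Rightarrow> 'c) \<Rightarrow> ('a, 'b) gen \<Rightarrow> ('c, 'b) gen \<Rightarrow>\<^sub>0 int" where
  "S2_fun f (Prod a b) = frag_of (Prod (f a) (f b))"
| "S2_fun f _ = 0"

fun tens_fun :: "('b \<Rightarrow> 'c) \<Rightarrow> ('a, 'b) gen \<Rightarrow> ('a, 'c) gen \<Rightarrow>\<^sub>0 int" where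
  "tens_fun f (Tens b t) = frag_of (Tens (f b) t)"
| "tens_fun f _ = 0"

lemma G2_map_eq: "G2_map A f = presented_map (G2_gens A) (G2_rels A) (G2_fun f)"
  unfolding G2_map_def by (rule arg_cong [where f = "presented_map _ _"]) (auto split: gen.split)

lemma S2_map_eq: "S2_map A f = presented_map (prod_gens A) (prod_rels A) (S2_fun f)"
  unfolding S2_map_def by (rule arg_cong [where f = "presented_map _ _"]) (auto split: gen.split)

lemma tensZ2_map_eq: "tensZ2_map A f = presented_map (tens_gens A Z2) (tens_rels A Z2) (tens_fun f)"
  unfolding tensZ2_map_def by (rule arg_cong [where f = "presented_map _ _"]) (auto split: gen.split)

lemma prod_relsI:
  "\<lbrakk>a \<in> carrier A; a' \<in> carrier A; b \<in> carrier A\<rbrakk> \<Longrightarrow>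
     frag_of (Prod (a \<otimes>\<^bsub>A\<^esub> a') b) - frag_of (Prod a b) - frag_of (Prod a' b) \<in> prod_rels A"
  "\<lbrakk>a \<in> carrier A; b \<in> carrier A\<rbrakk> \<Longrightarrow> frag_of (Prod a b) - frag_of (Prod b a) \<in> prod_rels A"
  unfolding prod_rels_def by blast+

lemma G2_relsI:
  "r \<in> prod_rels A \<Longrightarrow> r \<in> G2_rels A"
  "\<lbrakk>a \<in> carrier A; b \<in> carrier A\<rbrakk> \<Longrightarrow>
     frag_of (Divsq (a \<otimes>\<^bsub>A\<^esub> b)) - frag_of (Divsq a) - frag_of (Prod a b) - frag_of (Divsq b) \<in> G2_rels A"
  "a \<in> carrier A \<Longrightarrow> frag_of (Divsq (a [^]\<^bsub>A\<^esub> (k :: int))) - frag_cmul (k\<^sup>2) (frag_of (Divsq a)) \<in> G2_rels A"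
  "a \<in> carrier A \<Longrightarrow> frag_of (Prod a a) - frag_cmul 2 (frag_of (Divsq a)) \<in> G2_rels A"
  unfolding G2_rels_def by blast+

lemma tens_relsI:
  "\<lbrakk>a \<in> carrier A; a' \<in> carrier A; t \<in> carrier B\<rbrakk> \<Longrightarrow>
     frag_of (Tens (a \<otimes>\<^bsub>A\<^esub> a') t) - frag_of (Tens a t) - frag_of (Tens a' t) \<in> tens_rels A B"
  "\<lbrakk>a \<in> carrier A; t \<in> carrier B; t' \<in> carrier B\<rbrakk> \<Longrightarrow>
     frag_of (Tens a (t \<otimes>\<^bsub>B\<^esub> t')) - frag_of (Tens a t) - frag_of (Tens a t') \<in> tens_rels A B"
  unfolding tens_rels_def by blast+

lemma S2_fun_rels:
  assumes f: "f \<in> hom A A'" and r: "r \<in> prod_rels A"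
  shows "frag_extend (S2_fun f) r \<in> prod_rels A'" "frag_extend (G2_fun f) r \<in> prod_rels A'"
  using r hom_in_carrier [OF f] unfolding prod_rels_def [of A]
  by (auto simp: frag_extend_diff hom_mult [OF f] prod_relsI)

lemma G2_fun_rels:
  fixes r :: "('a, 'b) gen \<Rightarrow>\<^sub>0 int"
  assumes A: "group A" "group A'" and f: "f \<in> hom A A'" and r: "r \<in> G2_rels A"
  shows "frag_extend (G2_fun f) r \<in> G2_rels A'"
  using r hom_in_carrier [OF f] S2_fun_rels(2) [OF f, of r] unfolding G2_rels_def [of A]
  by (auto simp: frag_extend_diff frag_extend_cmul hom_mult [OF f] hom_int_pow [OF f _ A] G2_relsI)

lemma tens_fun_rels:
  assumes f: "f \<in> hom A A'" and r: "r \<in> tens_rels A B"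
  shows "frag_extend (tens_fun f) r \<in> tens_rels A' B"
  using r hom_in_carrier [OF f] unfolding tens_rels_def [of A]
  by (auto simp: frag_extend_diff hom_mult [OF f] tens_relsI)

lemma G2_map_class:
  assumes "group A" "group A'" "f \<in> hom A A'" "Poly_Mapping.keys x \<subseteq> G2_gens A"
  shows "G2_map A' f (G2_class A x) = G2_class A' (frag_extend (G2_fun f) x)"
  unfolding G2_map_eq
proof (rule presented_map_class)
  fix r :: "('a, 'c) gen \<Rightarrow>\<^sub>0 int" assume "r \<in> G2_rels A"
  then show "frag_extend (G2_fun f) r \<in> rel_subgroup (G2_gens A') (G2_rels A')"
    by (intro rel_subgroup_incl G2_fun_rels [OF assms(1-3)])
qed (use assms hom_in_carrier [OF assms(3)] G2_rels_closed [OF assms(1)] G2_rels_closed [OF assms(2)] in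
   \<open>auto simp: G2_gens_def prod_gens_def simp del: carrier_free_Abelian_group_iff\<close>)

lemma S2_map_class:
  assumes "group A" "group A'" "f \<in> hom A A'" "Poly_Mapping.keys x \<subseteq> prod_gens A"
  shows "S2_map A' f (S2_class A x) = S2_class A' (frag_extend (S2_fun f) x)"
  unfolding S2_map_eq
proof (rule presented_map_class)
  fix r :: "('a, 'c) gen \<Rightarrow>\<^sub>0 int" assume "r \<in> prod_rels A"
  then show "frag_extend (S2_fun f) r \<in> rel_subgroup (prod_gens A') (prod_rels A')"
    by (intro rel_subgroup_incl S2_fun_rels [OF assms(3)])
qed (use assms hom_in_carrier [OF assms(3)] prod_rels_closed [OF group.is_monoid [OF assms(1)]]
    prod_rels_closed [OF group.is_monoid [OF assms(2)]] in
   \<open>auto simp: prod_gens_def simp del: carrier_free_Abelian_group_iff\<close>)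

lemma quad_G2_fun: "frag_eval (quad p q) (G2_fun f g) = quad (\<lambda>c. p (f c)) (\<lambda>c. q (f c)) g"
  by (cases g) auto

lemma quad_S2_fun:
  assumes "g \<in> prod_gens A"
  shows "frag_eval (quad p q) (S2_fun f g) = quad (\<lambda>c. p (f c)) (\<lambda>c. q (f c)) g"
  using assms by (auto simp: prod_gens_def)

lemma S2_to_G2_val:
  assumes A: "group A" and p: "p \<in> hom A integer_group" and q: "q \<in> hom A integer_group"
    and x: "x \<in> carrier (S2 A)" and v: "has_val m (quad p q) x v"
  shows "has_val m (quad p q) (S2_to_G2 A x) v"
  unfolding S2_to_G2_def
proof (rule has_val_presented_map [OF G2_rels_closed [OF A] quad_kills_G2_rels [OF A p q]],
    rule has_val_cong [OF prod_rels_closed [OF group.is_monoid [OF A]] _ _ v])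
  show "quad p q g = frag_eval (quad p q) (case g of
      Prod a b \<Rightarrow> frag_of (Divsq (a \<otimes>\<^bsub>A\<^esub> b)) - frag_of (Divsq a) - frag_of (Divsq b) | _ \<Rightarrow> 0)"
    if "g \<in> prod_gens A" for g
    using that by (auto simp: prod_gens_def hom_mult [OF p] hom_mult [OF q] algebra_simps)
qed (use x in \<open>simp add: S2_def\<close>)

lemma prod_rels_consequences:
  assumes A: "group A" and R: "prod_rels A \<subseteq> R" "R \<subseteq> carrier (free_Abelian_group S)"
    and a: "a \<in> carrier A" "b \<in> carrier A"
  shows prod_one_left: "frag_of (Prod \<one>\<^bsub>A\<^esub> b) \<in> rel_subgroup S R"
    and prod_one_right: "frag_of (Prod a \<one>\<^bsub>A\<^esub>) \<in> rel_subgroup S R"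
    and prod_inv_inv: "frag_of (Prod (inv\<^bsub>A\<^esub> a) (inv\<^bsub>A\<^esub> b)) - frag_of (Prod a b) \<in> rel_subgroup S R"
proof -
  interpret A: group A by fact
  note incl = rel_subgroup_incl [OF subsetD [OF R(1)]]
  note minus = rel_subgroup_minus [OF R(2)] and diff = rel_subgroup_diff [OF R(2)]
  have one: "frag_of (Prod \<one>\<^bsub>A\<^esub> b) \<in> rel_subgroup S R" if "b \<in> carrier A" for b
    using minus [OF incl [OF prod_relsI(1) [of "\<one>\<^bsub>A\<^esub>" A "\<one>\<^bsub>A\<^esub>" b]]] that by simp
  then show "frag_of (Prod \<one>\<^bsub>A\<^esub> b) \<in> rel_subgroup S R" using a by simp
  have sym: "frag_of (Prod a b) - frag_of (Prod b a) \<in> rel_subgroup S R" if "a \<in> carrier A" "b \<in> carrier A" for a b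
    using incl [OF prod_relsI(2)] that by blast
  show "frag_of (Prod a \<one>\<^bsub>A\<^esub>) \<in> rel_subgroup S R"
    using rel_subgroup_add [OF sym [of a "\<one>\<^bsub>A\<^esub>"] one [of a]] a by simp
  have l: "frag_of (Prod (inv\<^bsub>A\<^esub> a) b) + frag_of (Prod a b) \<in> rel_subgroup S R"
    if "a \<in> carrier A" "b \<in> carrier A" for a b
  proof -
    have "frag_of (Prod (inv\<^bsub>A\<^esub> a \<otimes>\<^bsub>A\<^esub> a) b) - frag_of (Prod (inv\<^bsub>A\<^esub> a) b) - frag_of (Prod a b) \<in> rel_subgroup S R"
      using incl [OF prod_relsI(1)] that by blast
    from diff [OF one [OF that(2)] this] show ?thesis using that by (simp add: algebra_simps)
  qed
  \<comment> \<open>\<open>(-a)(-b) + a(-b)\<close>, \<open>a(-b) - (-b)a\<close>, \<open>(-b)a + ba\<close> and \<open>ba - ab\<close> lie in the subgroup of relations.\<close>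
  have "(frag_of (Prod (inv\<^bsub>A\<^esub> a) (inv\<^bsub>A\<^esub> b)) + frag_of (Prod a (inv\<^bsub>A\<^esub> b))) - (frag_of (Prod a (inv\<^bsub>A\<^esub> b)) - frag_of (Prod (inv\<^bsub>A\<^esub> b) a))
      - ((frag_of (Prod (inv\<^bsub>A\<^esub> b) a) + frag_of (Prod b a)) - (frag_of (Prod b a) - frag_of (Prod a b))) \<in> rel_subgroup S R"
    using a by (intro diff l sym) auto
  then show "frag_of (Prod (inv\<^bsub>A\<^esub> a) (inv\<^bsub>A\<^esub> b)) - frag_of (Prod a b) \<in> rel_subgroup S R"
    by (simp add: algebra_simps)
qed

section \<open>The Dold-Kan functor on a shifted complex\<close>

lemma chain_complex_shift:
  assumes R: "chain_complex R"
  shows "chain_complex (shift R)"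
  unfolding chain_complex_def
proof (intro conjI allI ballI)
  fix n
  show "comm_group (grp (shift R) n)"
    using comm_group.comm_group_subgroup [OF chain_complexD(1) [OF R] group.triv_subgroup] chain_complexD(1) [OF R]
    by (auto simp: shift_def comm_group_def split: nat.split)
  show "bd (shift R) n \<in> hom (grp (shift R) (Suc n)) (grp (shift R) n)"
  proof (cases n)
    case 0
    interpret comm_group "grp R 0" by (rule chain_complexD [OF R])
    show ?thesis using 0 by (auto simp: shift_def hom_def)
  next
    case (Suc m)
    interpret comm_group "grp R m" by (rule chain_complexD [OF R])
    interpret group_hom "grp R (Suc m)" "grp R m" "bd R m" by (rule bd_group_hom [OF R])
    show ?thesis using Suc by (auto simp: shift_def hom_def inv_mult)
  qed
  fix x assume x: "x \<in> carrier (grp (shift R) (Suc (Suc n)))"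
  show "bd (shift R) n (bd (shift R) (Suc n) x) = \<one>\<^bsub>grp (shift R) n\<^esub>"
  proof (cases n)
    case 0
    then show ?thesis by (simp add: shift_def)
  next
    case (Suc m)
    interpret h: group_hom "grp R (Suc m)" "grp R m" "bd R m" by (rule bd_group_hom [OF R])
    interpret h': group_hom "grp R (Suc (Suc m))" "grp R (Suc m)" "bd R (Suc m)" by (rule bd_group_hom [OF R])
    show ?thesis using Suc x chain_complexD(3) [OF R, of x m] by (simp add: shift_def)
  qed
qed

lemma facesD:
  assumes "\<sigma> \<in> faces n"
  shows "finite \<sigma>" "\<sigma> \<subseteq> {..n}" "\<sigma> \<noteq> {}"
  using assms finite_subset [of \<sigma> "{..n}"] by (auto simp: faces_def)

lemma face_remove:
  assumes "\<sigma> \<in> faces n" "2 \<le> card \<sigma>" "v \<in> \<sigma>"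
  shows "\<sigma> - {v} \<in> faces n" "card (\<sigma> - {v}) - 1 = card \<sigma> - 2"
proof -
  have c: "card (\<sigma> - {v}) = card \<sigma> - 1" using facesD [OF assms(1)] assms by simp
  then have "\<sigma> - {v} \<noteq> {}" using assms(2) by fastforce
  then show "\<sigma> - {v} \<in> faces n" using assms by (auto simp: faces_def)
  show "card (\<sigma> - {v}) - 1 = card \<sigma> - 2" using c by simp
qed

lemma card_2_faceE:
  assumes "\<sigma> \<in> faces n" "card \<sigma> = 2"
  obtains i j where "i < j" "j \<le> n" "\<sigma> = {i, j}"
proof -
  obtain x y where "\<sigma> = {x, y}" "x \<noteq> y" "x \<le> n" "y \<le> n"
    using assms by (auto simp: card_2_iff faces_def)
  then show thesis
    using that by (metis insert_commute linorder_neqE_nat)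
qed

lemma card_3_faceE:
  assumes "\<sigma> \<in> faces n" "card \<sigma> = 3"
  obtains i j k where "i < j" "j < k" "k \<le> n" "\<sigma> = {i, j, k}"
proof -
  obtain x y z where "\<sigma> = {x, y, z}" "x \<noteq> y" "x \<noteq> z" "y \<noteq> z" "x \<le> n" "y \<le> n" "z \<le> n"
    using assms by (auto simp: card_3_iff faces_def)
  then show thesis
    using that by (metis insert_commute linorder_neqE_nat)
qed

definition bd_faces :: "'a cplx \<Rightarrow> nat set \<Rightarrow> (nat set \<Rightarrow> 'a) \<Rightarrow> 'a" where
  "bd_faces C \<sigma> c = finprod (grp C (card \<sigma> - 2))
     (\<lambda>v. c (\<sigma> - {v}) [^]\<^bsub>grp C (card \<sigma> - 2)\<^esub> ((-1) ^ card {u \<in> \<sigma>. u < v} :: int)) \<sigma>"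

lemma DK_grp_simps:
  "c \<in> carrier (DK_grp C n) \<longleftrightarrow> c \<in> (\<Pi>\<^sub>E \<sigma>\<in>faces n. carrier (grp C (card \<sigma> - 1))) \<and>
     (\<forall>\<sigma>\<in>faces n. 2 \<le> card \<sigma> \<longrightarrow> bd C (card \<sigma> - 2) (c \<sigma>) = bd_faces C \<sigma> c)"
  "c \<otimes>\<^bsub>DK_grp C n\<^esub> d = (\<lambda>\<sigma>\<in>faces n. c \<sigma> \<otimes>\<^bsub>grp C (card \<sigma> - 1)\<^esub> d \<sigma>)"
  "\<one>\<^bsub>DK_grp C n\<^esub> = (\<lambda>\<sigma>\<in>faces n. \<one>\<^bsub>grp C (card \<sigma> - 1)\<^esub>)"
  by (auto simp: DK_grp_def bd_faces_def)

lemma product_comm_group: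
  assumes "\<And>i. i \<in> I \<Longrightarrow> comm_group (G i)"
  shows "comm_group (product_group I G)"
proof (rule group.group_comm_groupI)
  show "group (product_group I G)"
    using assms by (simp add: comm_group_def)
  fix x y assume "x \<in> carrier (product_group I G)" "y \<in> carrier (product_group I G)"
  then show "x \<otimes>\<^bsub>product_group I G\<^esub> y = y \<otimes>\<^bsub>product_group I G\<^esub> x"
    using comm_monoid.m_comm [OF comm_group.axioms(1) [OF assms]] by (auto simp: PiE_iff intro!: restrict_ext)
qed

text \<open>
  Both sides of the condition on a simplex are homomorphisms on the product, so the condition defines a
  subgroup.
\<close>

lemma comm_group_DK_grp:
  assumes C: "chain_complex C"
  shows "comm_group (DK_grp C n)"
proof -
  let ?P = "product_group (faces n) (\<lambda>\<sigma>. grp C (card \<sigma> - 1))"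
  interpret P: comm_group ?P
    by (rule product_comm_group) (rule chain_complexD [OF C])
  have ev: "(\<lambda>c. c \<sigma>) \<in> hom ?P (grp C (card \<sigma> - 1))" if "\<sigma> \<in> faces n" for \<sigma>
    using that by (intro homI) auto
  have l: "group_hom ?P (grp C (card \<sigma> - 2)) (\<lambda>c. bd C (card \<sigma> - 2) (c \<sigma>))"
    and r: "group_hom ?P (grp C (card \<sigma> - 2)) (bd_faces C \<sigma>)"
    if \<sigma>: "\<sigma> \<in> faces n" "2 \<le> card \<sigma>" for \<sigma>
  proof -
    let ?G = "grp C (card \<sigma> - 2)" and ?s = "\<lambda>v. (-1) ^ card {u \<in> \<sigma>. u < v} :: int"
    interpret G: comm_group "?G" by (rule chain_complexD [OF C])
    have [simp]: "Suc (card \<sigma> - 2) = card \<sigma> - 1" using \<sigma> by simp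
    have "(\<lambda>c. bd C (card \<sigma> - 2) (c \<sigma>)) \<in> hom ?P ?G"
      using hom_compose [OF ev [OF \<sigma>(1)], of "bd C (card \<sigma> - 2)"] chain_complexD(2) [OF C, of "card \<sigma> - 2"]
      by (simp add: o_def)
    then show "group_hom ?P ?G (\<lambda>c. bd C (card \<sigma> - 2) (c \<sigma>))"
      by unfold_locales
    have cv: "c (\<sigma> - {v}) \<in> carrier ?G" if "c \<in> carrier ?P" "v \<in> \<sigma>" for c v
      using hom_in_carrier [OF ev that(1)] face_remove [OF \<sigma> that(2)] by fastforce
    have "bd_faces C \<sigma> \<in> hom ?P ?G"
    proof (rule homI)
      fix c assume "c \<in> carrier ?P"
      then show "bd_faces C \<sigma> c \<in> carrier ?G"
        unfolding bd_faces_def by (intro G.finprod_closed) (auto simp del: carrier_product_group intro!: G.int_pow_closed cv)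
      fix d assume "d \<in> carrier ?P"
      have "bd_faces C \<sigma> (c \<otimes>\<^bsub>?P\<^esub> d) = finprod ?G
        (\<lambda>v. c (\<sigma> - {v}) [^]\<^bsub>?G\<^esub> ?s v \<otimes>\<^bsub>?G\<^esub>
          d (\<sigma> - {v}) [^]\<^bsub>?G\<^esub> ?s v) \<sigma>"
        unfolding bd_faces_def
      proof (rule G.finprod_cong')
        fix v assume "v \<in> \<sigma>"
        then show "(c \<otimes>\<^bsub>?P\<^esub> d) (\<sigma> - {v}) [^]\<^bsub>?G\<^esub> ?s v =
          c (\<sigma> - {v}) [^]\<^bsub>?G\<^esub> ?s v \<otimes>\<^bsub>?G\<^esub>
          d (\<sigma> - {v}) [^]\<^bsub>?G\<^esub> ?s v"
          using face_remove [OF \<sigma>] cv [OF \<open>c \<in> carrier ?P\<close>] cv [OF \<open>d \<in> carrier ?P\<close>] G.int_pow_distrib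
          by simp
      qed (use cv [OF \<open>c \<in> carrier ?P\<close>] cv [OF \<open>d \<in> carrier ?P\<close>] in auto)
      also have "\<dots> = bd_faces C \<sigma> c \<otimes>\<^bsub>?G\<^esub> bd_faces C \<sigma> d"
        unfolding bd_faces_def
        by (rule G.finprod_multf) (use cv [OF \<open>c \<in> carrier ?P\<close>] cv [OF \<open>d \<in> carrier ?P\<close>] in auto)
      finally show "bd_faces C \<sigma> (c \<otimes>\<^bsub>?P\<^esub> d) = bd_faces C \<sigma> c \<otimes>\<^bsub>?G\<^esub> bd_faces C \<sigma> d" .
    qed
    then show "group_hom ?P (grp C (card \<sigma> - 2)) (bd_faces C \<sigma>)"
      by unfold_locales
  qed
  have "subgroup {c \<in> carrier ?P. \<forall>\<sigma>\<in>faces n. 2 \<le> card \<sigma> \<longrightarrow> bd C (card \<sigma> - 2) (c \<sigma>) = bd_faces C \<sigma> c} ?P"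
    (is "subgroup ?E ?P")
  proof (rule P.subgroupI)
    have "\<one>\<^bsub>?P\<^esub> \<in> ?E"
      using group_hom.hom_one [OF l] group_hom.hom_one [OF r] P.one_closed by auto
    then show "?E \<noteq> {}" by blast
    fix c assume c: "c \<in> ?E"
    then show "inv\<^bsub>?P\<^esub> c \<in> ?E"
      using group_hom.hom_inv [OF l, of _ c] group_hom.hom_inv [OF r, of _ c] P.inv_closed [of c] by auto
    fix d assume d: "d \<in> ?E"
    then show "c \<otimes>\<^bsub>?P\<^esub> d \<in> ?E"
      using c group_hom.hom_mult [OF l, of _ c d] group_hom.hom_mult [OF r, of _ c d] P.m_closed [of c d] by auto
  qed auto
  from P.comm_group_subgroup [OF this] show ?thesis
    by (simp add: DK_grp_def bd_faces_def)
qed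

lemma edge_hom:
  assumes t: "t \<in> hom (grp R 0) integer_group" and e: "{i, j} \<in> faces n" "i \<noteq> j"
  shows "(\<lambda>c. t (c {i, j})) \<in> hom (DK_grp (shift R) n) integer_group"
proof -
  have "card {i, j} = 2" using e by simp
  then show ?thesis
    using e t by (intro homI) (force simp: DK_grp_simps shift_def PiE_iff hom_mult)+
qed

lemma bd_faces_triangle:
  assumes R: "chain_complex R" and ijk: "i < j" "j < k"
    and c: "c {i, j} \<in> carrier (grp R 0)" "c {j, k} \<in> carrier (grp R 0)" "c {i, k} \<in> carrier (grp R 0)"
  shows "bd_faces (shift R) {i, j, k} c = c {j, k} \<otimes>\<^bsub>grp R 0\<^esub> (inv\<^bsub>grp R 0\<^esub> c {i, k} \<otimes>\<^bsub>grp R 0\<^esub> c {i, j})"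
proof -
  interpret G: comm_group "grp R 0" by (rule chain_complexD [OF R])
  let ?\<sigma> = "{i, j, k}"
  let ?f = "\<lambda>v. c (?\<sigma> - {v}) [^]\<^bsub>grp R 0\<^esub> ((-1) ^ card {u \<in> ?\<sigma>. u < v} :: int)"
  have rem: "?\<sigma> - {i} = {j, k}" "?\<sigma> - {j} = {i, k}" "?\<sigma> - {k} = {i, j}" using ijk by auto
  have below: "{u \<in> ?\<sigma>. u < i} = {}" "{u \<in> ?\<sigma>. u < j} = {i}" "{u \<in> ?\<sigma>. u < k} = {i, j}"
    using ijk by auto
  have sign: "card {u \<in> ?\<sigma>. u < i} = 0" "card {u \<in> ?\<sigma>. u < j} = 1" "card {u \<in> ?\<sigma>. u < k} = 2"
    unfolding below using ijk by auto
  have f: "?f i = c {j, k}" "?f j = inv\<^bsub>grp R 0\<^esub> c {i, k}" "?f k = c {i, j}"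
    unfolding rem sign using c by (simp_all add: G.int_pow_neg)
  have "card ?\<sigma> = 3" using ijk by auto
  then have "bd_faces (shift R) ?\<sigma> c = finprod (grp R 0) ?f ?\<sigma>"
    by (simp only: bd_faces_def) (simp add: shift_def)
  moreover have "finprod (grp R 0) g ?\<sigma> = g i \<otimes>\<^bsub>grp R 0\<^esub> (g j \<otimes>\<^bsub>grp R 0\<^esub> g k)"
    if "g i \<in> carrier (grp R 0)" "g j \<in> carrier (grp R 0)" "g k \<in> carrier (grp R 0)" for g
    using that ijk by (simp add: G.finprod_insert)
  ultimately show ?thesis using f c by simp
qed

text \<open>
  A functional on \<open>R\<^sub>0\<close> that kills boundaries is a 1-cocycle on \<open>K(R[1])\<close>: the alternating sum over the edges
  of a triangle is a boundary.
\<close>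

lemma edge_cocycle:
  assumes R: "chain_complex R" and t: "t \<in> hom (grp R 0) integer_group"
    and tb: "\<And>x. x \<in> carrier (grp R 1) \<Longrightarrow> t (bd R 0 x) = 0"
    and c: "c \<in> carrier (DK_grp (shift R) n)" and ijk: "i < j" "j < k" "k \<le> n"
  shows "t (c {i, k}) = t (c {i, j}) + t (c {j, k})"
proof -
  interpret G: comm_group "grp R 0" by (rule chain_complexD [OF R])
  interpret d: group_hom "grp R (Suc 0)" "grp R 0" "bd R 0" by (rule bd_group_hom [OF R])
  interpret t: group_hom "grp R 0" integer_group t
    by (simp add: group_hom_def group_hom_axioms_def t G.is_group)
  let ?\<sigma> = "{i, j, k}"
  have \<sigma>: "?\<sigma> \<in> faces n" "card ?\<sigma> = 3" using ijk by (auto simp: faces_def)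
  have ed: "c {a, b} \<in> carrier (grp R 0)" if "a < b" "b \<le> n" for a b
  proof -
    have "{a, b} \<in> faces n" "card {a, b} = 2" using that by (auto simp: faces_def)
    then show ?thesis using c by (force simp: DK_grp_simps shift_def PiE_iff)
  qed
  note eds = ed [OF ijk(1) order.trans [OF less_imp_le [OF ijk(2)] ijk(3)]] ed [OF ijk(2,3)] ed [OF less_trans [OF ijk(1,2)] ijk(3)]
  have c\<sigma>: "c ?\<sigma> \<in> carrier (grp R 1)"
    using c \<sigma> by (force simp: DK_grp_simps shift_def PiE_iff)
  have "inv\<^bsub>grp R 0\<^esub> bd R 0 (c ?\<sigma>) = bd_faces (shift R) ?\<sigma> c"
    using c \<sigma> by (force simp: DK_grp_simps shift_def)
  also have "\<dots> = c {j, k} \<otimes>\<^bsub>grp R 0\<^esub> (inv\<^bsub>grp R 0\<^esub> c {i, k} \<otimes>\<^bsub>grp R 0\<^esub> c {i, j})"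
    by (rule bd_faces_triangle [OF R ijk(1,2) eds])
  finally have "inv\<^bsub>grp R 0\<^esub> bd R 0 (c ?\<sigma>) = c {j, k} \<otimes>\<^bsub>grp R 0\<^esub> (inv\<^bsub>grp R 0\<^esub> c {i, k} \<otimes>\<^bsub>grp R 0\<^esub> c {i, j})" .
  then have "t (inv\<^bsub>grp R 0\<^esub> bd R 0 (c ?\<sigma>)) = t (c {j, k} \<otimes>\<^bsub>grp R 0\<^esub> (inv\<^bsub>grp R 0\<^esub> c {i, k} \<otimes>\<^bsub>grp R 0\<^esub> c {i, j}))"
    by simp
  then show ?thesis
    using eds c\<sigma> tb by simp
qed

text \<open>
  The elements of \<open>K(R[1])\<close> used below are the coboundaries of functions \<open>v\<close> on the vertices with values in
  \<open>R\<^sub>0\<close>, so that the edge from \<open>i\<close> to \<open>j\<close> goes to \<open>v j - v i\<close>.  In bar notation \<open>[a | b]\<close> is \<open>v = (0, a, a + b)\<close>.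
\<close>

definition vbar :: "'a cplx \<Rightarrow> nat \<Rightarrow> (nat \<Rightarrow> 'a) \<Rightarrow> nat set \<Rightarrow> 'a" where
  "vbar R n v = (\<lambda>\<sigma>\<in>faces n. if card \<sigma> = 2 then v (Max \<sigma>) \<otimes>\<^bsub>grp R 0\<^esub> inv\<^bsub>grp R 0\<^esub> v (Min \<sigma>)
     else \<one>\<^bsub>grp (shift R) (card \<sigma> - 1)\<^esub>)"

lemma vbar_edge:
  assumes "i < j" "j \<le> n"
  shows "vbar R n v {i, j} = v j \<otimes>\<^bsub>grp R 0\<^esub> inv\<^bsub>grp R 0\<^esub> v i"
  using assms by (auto simp: vbar_def faces_def)

lemma vbar_closed:
  assumes R: "chain_complex R" and v: "\<And>i. i \<le> n \<Longrightarrow> v i \<in> carrier (grp R 0)"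
  shows "vbar R n v \<in> carrier (DK_grp (shift R) n)"
  unfolding DK_grp_simps
proof (intro conjI ballI impI)
  note S = chain_complex_shift [OF R]
  interpret G: comm_group "grp R 0" by (rule chain_complexD [OF R])
  show "vbar R n v \<in> (\<Pi>\<^sub>E \<sigma>\<in>faces n. carrier (grp (shift R) (card \<sigma> - 1)))"
  proof (rule PiE_I)
    fix \<sigma> assume \<sigma>: "\<sigma> \<in> faces n"
    show "vbar R n v \<sigma> \<in> carrier (grp (shift R) (card \<sigma> - 1))"
    proof (cases "card \<sigma> = 2")
      case True
      then obtain i j where ij: "i < j" "j \<le> n" "\<sigma> = {i, j}" using card_2_faceE [OF \<sigma>] by blast
      then show ?thesis using v by (simp add: vbar_edge) (simp add: shift_def)
    next
      case False
      then show ?thesis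
        using \<sigma> chain_complexD(1) [OF S, of "card \<sigma> - 1"]
        by (simp add: vbar_def comm_group_def comm_monoid_def monoid.one_closed)
    qed
  qed (simp add: vbar_def)
  fix \<sigma> assume \<sigma>: "\<sigma> \<in> faces n" "2 \<le> card \<sigma>"
  interpret H: comm_group "grp (shift R) (card \<sigma> - 2)" by (rule chain_complexD [OF S])
  interpret d: group_hom "grp (shift R) (Suc (card \<sigma> - 2))" "grp (shift R) (card \<sigma> - 2)" "bd (shift R) (card \<sigma> - 2)"
    by (rule bd_group_hom [OF S])
  consider "card \<sigma> = 2" | "card \<sigma> = 3" | "4 \<le> card \<sigma>" using \<sigma>(2) by linarith
  then show "bd (shift R) (card \<sigma> - 2) (vbar R n v \<sigma>) = bd_faces (shift R) \<sigma> (vbar R n v)"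
  proof cases
    case 1
    have "vbar R n v (\<sigma> - {u}) = \<one>\<^bsub>grp (shift R) (card \<sigma> - 2)\<^esub>" if "u \<in> \<sigma>" for u
      using face_remove [OF \<sigma> that] facesD [OF \<sigma>(1)] that 1 by (simp add: vbar_def)
    then have "bd_faces (shift R) \<sigma> (vbar R n v) = \<one>\<^bsub>grp (shift R) (card \<sigma> - 2)\<^esub>"
      unfolding bd_faces_def by (intro H.finprod_one_eqI) simp
    then show ?thesis using 1 by (simp add: shift_def)
  next
    case 2
    then obtain i j k where ijk: "i < j" "j < k" "k \<le> n" "\<sigma> = {i, j, k}" using card_3_faceE [OF \<sigma>(1)] by blast
    have vs: "v i \<in> carrier (grp R 0)" "v j \<in> carrier (grp R 0)" "v k \<in> carrier (grp R 0)"
      using v ijk by auto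
    have "bd_faces (shift R) \<sigma> (vbar R n v) = (v k \<otimes>\<^bsub>grp R 0\<^esub> inv\<^bsub>grp R 0\<^esub> v j) \<otimes>\<^bsub>grp R 0\<^esub> (inv\<^bsub>grp R 0\<^esub> (v k \<otimes>\<^bsub>grp R 0\<^esub> inv\<^bsub>grp R 0\<^esub> v i) \<otimes>\<^bsub>grp R 0\<^esub> (v j \<otimes>\<^bsub>grp R 0\<^esub> inv\<^bsub>grp R 0\<^esub> v i))"
      unfolding ijk(4) using ijk vs by (subst bd_faces_triangle [OF R ijk(1,2)]) (simp_all add: vbar_edge)
    also have "\<dots> = \<one>\<^bsub>grp R 0\<^esub>"
      using vs by (intro G.telescope_one)
    finally show ?thesis
      using \<sigma> 2 d.hom_one by (simp add: vbar_def) (simp add: shift_def)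
  next
    case 3
    have "vbar R n v (\<sigma> - {u}) = \<one>\<^bsub>grp (shift R) (card \<sigma> - 2)\<^esub>" if "u \<in> \<sigma>" for u
    proof -
      have "card (\<sigma> - {u}) \<noteq> 2" using facesD [OF \<sigma>(1)] that 3 by simp
      then show ?thesis using face_remove [OF \<sigma> that] by (simp add: vbar_def)
    qed
    then have "bd_faces (shift R) \<sigma> (vbar R n v) = \<one>\<^bsub>grp (shift R) (card \<sigma> - 2)\<^esub>"
      unfolding bd_faces_def by (intro H.finprod_one_eqI) simp
    moreover have "Suc (card \<sigma> - 2) = card \<sigma> - 1" using 3 by simp
    ultimately show ?thesis using 3 \<sigma> d.hom_one by (simp add: vbar_def)
  qed
qed

lemma vbar_mult:
  assumes R: "chain_complex R" and v: "\<And>i. i \<le> n \<Longrightarrow> v i \<in> carrier (grp R 0)"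
    and w: "\<And>i. i \<le> n \<Longrightarrow> w i \<in> carrier (grp R 0)"
  shows "vbar R n v \<otimes>\<^bsub>DK_grp (shift R) n\<^esub> vbar R n w = vbar R n (\<lambda>i. v i \<otimes>\<^bsub>grp R 0\<^esub> w i)"
proof (unfold DK_grp_simps, rule ext)
  interpret G: comm_group "grp R 0" by (rule chain_complexD [OF R])
  fix \<sigma>
  show "(\<lambda>\<sigma>\<in>faces n. vbar R n v \<sigma> \<otimes>\<^bsub>grp (shift R) (card \<sigma> - 1)\<^esub> vbar R n w \<sigma>) \<sigma> =
      vbar R n (\<lambda>i. v i \<otimes>\<^bsub>grp R 0\<^esub> w i) \<sigma>"
  proof (cases "\<sigma> \<in> faces n \<and> card \<sigma> = 2")
    case True
    then obtain i j where ij: "i < j" "j \<le> n" "\<sigma> = {i, j}" using card_2_faceE by blast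
    have vs: "v i \<in> carrier (grp R 0)" "v j \<in> carrier (grp R 0)" "w i \<in> carrier (grp R 0)" "w j \<in> carrier (grp R 0)"
      using v w ij by auto
    have "grp (shift R) (card \<sigma> - 1) = grp R 0" using True by (simp add: shift_def)
    then show ?thesis using True vs ij by (simp add: vbar_edge G.inv_mult_group G.m_ac)
  next
    case False
    interpret H: comm_group "grp (shift R) (card \<sigma> - 1)" by (rule chain_complexD [OF chain_complex_shift [OF R]])
    show ?thesis using False by (auto simp: vbar_def simp del: One_nat_def)
  qed
qed

lemma vbar_const:
  assumes "chain_complex R" "\<And>i. i \<le> n \<Longrightarrow> v i = a" "a \<in> carrier (grp R 0)"
  shows "vbar R n v = \<one>\<^bsub>DK_grp (shift R) n\<^esub>"
proof (unfold DK_grp_simps, rule ext)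
  interpret G: comm_group "grp R 0" by (rule chain_complexD [OF assms(1)])
  fix \<sigma>
  show "vbar R n v \<sigma> = (\<lambda>\<sigma>\<in>faces n. \<one>\<^bsub>grp (shift R) (card \<sigma> - 1)\<^esub>) \<sigma>"
  proof (cases "\<sigma> \<in> faces n \<and> card \<sigma> = 2")
    case True
    then obtain i j where ij: "i < j" "j \<le> n" "\<sigma> = {i, j}" using card_2_faceE by blast
    then show ?thesis using True assms(2,3) by (simp add: vbar_edge) (simp add: shift_def)
  qed (auto simp: vbar_def)
qed

lemma DK_act_vbar:
  assumes "strict_mono_on {..m} \<alpha>" "\<alpha> ` {..m} \<subseteq> {..n}"
  shows "DK_act (shift R) m n \<alpha> (vbar R n v) = vbar R m (v \<circ> \<alpha>)"
proof
  fix \<tau>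
  show "DK_act (shift R) m n \<alpha> (vbar R n v) \<tau> = vbar R m (v \<circ> \<alpha>) \<tau>"
  proof (cases "\<tau> \<in> faces m")
    case True
    have inj: "inj_on \<alpha> \<tau>"
      using strict_mono_on_imp_inj_on [OF assms(1)] facesD [OF True] by (auto intro: inj_on_subset)
    have \<alpha>\<tau>: "\<alpha> ` \<tau> \<in> faces n" using True assms(2) by (auto simp: faces_def)
    show ?thesis
    proof (cases "card \<tau> = 2")
      case c: True
      then obtain i j where ij: "i < j" "j \<le> m" "\<tau> = {i, j}" using card_2_faceE [OF True] by blast
      then have "\<alpha> i < \<alpha> j" "\<alpha> j \<le> n" using assms by (auto simp: strict_mono_on_def)
      then show ?thesis using ij True inj by (simp add: DK_act_def vbar_edge)
    next
      case False
      then show ?thesis using True inj \<alpha>\<tau> card_image [OF inj] by (simp add: DK_act_def vbar_def)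
    qed
  qed (simp add: DK_act_def vbar_def)
qed

lemma coface_strict_mono: "strict_mono_on {..m} (coface i)" "coface i ` {..m} \<subseteq> {..Suc m}"
  by (auto simp: coface_def strict_mono_on_def)

lemmas DK_act_coface = DK_act_vbar [OF coface_strict_mono]

lemma DK_act_edge:
  assumes "i < j" "j \<le> m"
  shows "DK_act C m n (coface k) c {i, j} = c {coface k i, coface k j}"
  using assms by (auto simp: DK_act_def faces_def coface_def inj_on_def)

lemma DK_map_vbar:
  assumes f: "chain_map R R' f" and v: "\<And>i. i \<le> n \<Longrightarrow> v i \<in> carrier (grp R 0)"
  shows "DK_map (shift_map f) n (vbar R n v) = vbar R' n (f 0 \<circ> v)"
proof
  fix \<sigma>
  show "DK_map (shift_map f) n (vbar R n v) \<sigma> = vbar R' n (f 0 \<circ> v) \<sigma>"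
  proof (cases "\<sigma> \<in> faces n \<and> card \<sigma> = 2")
    case True
    interpret f: group_hom "grp R 0" "grp R' 0" "f 0" by (rule chain_map_group_hom [OF f])
    obtain i j where ij: "i < j" "j \<le> n" "\<sigma> = {i, j}" using True card_2_faceE by blast
    then have "v i \<in> carrier (grp R 0)" "v j \<in> carrier (grp R 0)" using v by auto
    then show ?thesis using ij True by (simp add: DK_map_def vbar_edge shift_map_def)
  next
    case False
    have "f (k - 1) \<one>\<^bsub>grp (shift R) k\<^esub> = \<one>\<^bsub>grp (shift R') k\<^esub>" for k
      using group_hom.hom_one [OF chain_map_group_hom [OF f]] by (cases k) (simp_all add: shift_def)
    from this [of "card \<sigma> - 1"]
    show ?thesis
      using False by (auto simp: DK_map_def vbar_def shift_map_def numeral_2_eq_2)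
  qed
qed

text \<open>
  In degrees at most 1 the group \<open>K(R[1])\<close> is the full product, since \<open>R[1]\<close> is trivial in degree 0; so no
  condition on simplices has to be verified for the faces with these targets.
\<close>

lemma coface_hom:
  assumes R: "chain_complex R" and m: "m \<le> 1"
  shows "DK_act (shift R) m (Suc m) (coface i) \<in> hom (DK_grp (shift R) (Suc m)) (DK_grp (shift R) m)"
proof (rule homI)
  note S = chain_complex_shift [OF R]
  have \<alpha>: "inj_on (coface i) \<tau>" "coface i ` \<tau> \<in> faces (Suc m)" "card (coface i ` \<tau>) = card \<tau>" if "\<tau> \<in> faces m" for \<tau>
  proof -
    show inj: "inj_on (coface i) \<tau>" by (auto simp: coface_def inj_on_def)
    show "coface i ` \<tau> \<in> faces (Suc m)" using that coface_strict_mono(2) [of i m] by (fastforce simp: faces_def)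
    show "card (coface i ` \<tau>) = card \<tau>" using inj by (rule card_image)
  qed
  fix c assume c: "c \<in> carrier (DK_grp (shift R) (Suc m))"
  have Pi: "DK_act (shift R) m (Suc m) (coface i) c \<in> (\<Pi>\<^sub>E \<sigma>\<in>faces m. carrier (grp (shift R) (card \<sigma> - 1)))"
    using c \<alpha> by (fastforce simp: DK_act_def DK_grp_simps PiE_iff)
  show "DK_act (shift R) m (Suc m) (coface i) c \<in> carrier (DK_grp (shift R) m)"
    unfolding DK_grp_simps
  proof (intro conjI ballI impI Pi)
    fix \<sigma> assume \<sigma>: "\<sigma> \<in> faces m" "2 \<le> card \<sigma>"
    have "card \<sigma> \<le> card {..m}" using facesD [OF \<sigma>(1)] by (intro card_mono) auto
    then have 2: "card \<sigma> = 2" using \<sigma> m by simp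
    interpret H: comm_group "grp (shift R) 0" by (rule chain_complexD [OF S])
    have "bd_faces (shift R) \<sigma> c' \<in> carrier (grp (shift R) 0)"
      if "c' \<in> (\<Pi>\<^sub>E \<sigma>\<in>faces m. carrier (grp (shift R) (card \<sigma> - 1)))" for c'
    proof -
      have "c' (\<sigma> - {v}) \<in> carrier (grp (shift R) 0)" if "v \<in> \<sigma>" for v
        using PiE_mem [OF \<open>c' \<in> _\<close> face_remove(1) [OF \<sigma> that]] face_remove(2) [OF \<sigma> that] 2 by simp
      then show ?thesis unfolding bd_faces_def 2 by (simp add: Pi_iff)
    qed
    from this [OF Pi] show "bd (shift R) (card \<sigma> - 2) (DK_act (shift R) m (Suc m) (coface i) c \<sigma>) =
        bd_faces (shift R) \<sigma> (DK_act (shift R) m (Suc m) (coface i) c)"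
      using 2 by (simp add: shift_def)
  qed
  fix d assume d: "d \<in> carrier (DK_grp (shift R) (Suc m))"
  show "DK_act (shift R) m (Suc m) (coface i) (c \<otimes>\<^bsub>DK_grp (shift R) (Suc m)\<^esub> d) =
    DK_act (shift R) m (Suc m) (coface i) c \<otimes>\<^bsub>DK_grp (shift R) m\<^esub> DK_act (shift R) m (Suc m) (coface i) d"
    unfolding DK_act_def DK_grp_simps(2) using \<alpha> by (auto intro!: restrict_ext)
qed

section \<open>Cup products as cocycles on the two derived functors\<close>

lemma LG2_simps:
  "carrier (grp (obj LG2_shift R) n) = {X \<in> carrier (G2 (DK_grp (shift R) n)). \<forall>i\<in>{1..n}.
     G2_map (DK_grp (shift R) (n - 1)) (DK_act (shift R) (n - 1) n (coface i)) X = \<one>\<^bsub>G2 (DK_grp (shift R) (n - 1))\<^esub>}"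
  "(\<otimes>\<^bsub>grp (obj LG2_shift R) n\<^esub>) = (\<otimes>\<^bsub>G2 (DK_grp (shift R) n)\<^esub>)"
  "\<one>\<^bsub>grp (obj LG2_shift R) n\<^esub> = \<one>\<^bsub>G2 (DK_grp (shift R) n)\<^esub>"
  "bd (obj LG2_shift R) n = G2_map (DK_grp (shift R) n) (DK_act (shift R) n (Suc n) (coface 0))"
  "arr LG2_shift R f n = G2_map (DK_grp (shift R) n) (DK_map (shift_map f) n)"
  by (simp_all add: LG2_shift_def normalized_def degreewise_def DK_def)

lemma LS2_simps:
  "carrier (grp (obj LS2_shift R) n) = {X \<in> carrier (S2 (DK_grp (shift R) n)). \<forall>i\<in>{1..n}.
     S2_map (DK_grp (shift R) (n - 1)) (DK_act (shift R) (n - 1) n (coface i)) X = \<one>\<^bsub>S2 (DK_grp (shift R) (n - 1))\<^esub>}"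
  "(\<otimes>\<^bsub>grp (obj LS2_shift R) n\<^esub>) = (\<otimes>\<^bsub>S2 (DK_grp (shift R) n)\<^esub>)"
  "\<one>\<^bsub>grp (obj LS2_shift R) n\<^esub> = \<one>\<^bsub>S2 (DK_grp (shift R) n)\<^esub>"
  "bd (obj LS2_shift R) n = S2_map (DK_grp (shift R) n) (DK_act (shift R) n (Suc n) (coface 0))"
  "arr LS2_shift R f n = S2_map (DK_grp (shift R) n) (DK_map (shift_map f) n)"
  by (simp_all add: LS2_shift_def normalized_def degreewise_def DK_def)

lemma tensZ2_shift_simps:
  "grp (obj tensZ2_shift R) (Suc n) = tensZ2 (grp R n)"
  "bd (obj tensZ2_shift R) (Suc n) x = inv\<^bsub>tensZ2 (grp R n)\<^esub> tensZ2_map (grp R n) (bd R n) x"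
  "bd (obj tensZ2_shift R) 0 x = \<one>\<^bsub>grp (obj tensZ2_shift R) 0\<^esub>"
  "arr tensZ2_shift R f (Suc n) = tensZ2_map (grp R n) (f n)"
  by (simp_all add: tensZ2_shift_def tensZ2_cplx_def shift_def shift_map_def)

lemma Suc_2: "Suc 2 = 3" by simp

text \<open>
  \<open>cup p q\<close> is the cup product of the 1-cocycles given by \<open>p\<close> and \<open>q\<close>, evaluated on the front edge and the back
  edge of a 2-simplex, and \<open>edge_sq p\<close> is the square of the function \<open>p\<close> on 1-simplices.
\<close>

definition cup :: "('a \<Rightarrow> int) \<Rightarrow> ('a \<Rightarrow> int) \<Rightarrow> (nat set \<Rightarrow> 'a, 'b) gen \<Rightarrow> int" where
  "cup p q = quad (\<lambda>c. p (c {0, 1})) (\<lambda>c. q (c {1, 2}))"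

definition edge_sq :: "('a \<Rightarrow> int) \<Rightarrow> (nat set \<Rightarrow> 'a, 'b) gen \<Rightarrow> int" where
  "edge_sq p = quad (\<lambda>c. p (c {0, 1})) (\<lambda>c. p (c {0, 1}))"

text \<open>
  For \<open>R\<close> a resolution of a free abelian group of rank two, this is a basis of \<open>H\<^sub>0(R)\<close>, lifted to \<open>R\<^sub>0\<close>,
  with its dual basis.
\<close>

locale dual_pair =
  fixes R :: "'a cplx" and t1 t2 :: "'a \<Rightarrow> int" and u1 u2 :: 'a
  assumes R: "chain_complex R"
    and t1: "t1 \<in> hom (grp R 0) integer_group" and t2: "t2 \<in> hom (grp R 0) integer_group"
    and t1_bd: "\<And>x. x \<in> carrier (grp R 1) \<Longrightarrow> t1 (bd R 0 x) = 0"
    and t2_bd: "\<And>x. x \<in> carrier (grp R 1) \<Longrightarrow> t2 (bd R 0 x) = 0"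
    and u1: "u1 \<in> carrier (grp R 0)" and u2: "u2 \<in> carrier (grp R 0)"
    and dual [simp]: "t1 u1 = 1" "t2 u1 = 0" "t1 u2 = 0" "t2 u2 = 1"
begin

abbreviation A :: "'a monoid" where "A \<equiv> grp R 0"

abbreviation K :: "nat \<Rightarrow> (nat set \<Rightarrow> 'a) monoid" where "K n \<equiv> DK_grp (shift R) n"

abbreviation Y :: "'a univ cplx" where "Y \<equiv> obj LG2_shift R"

abbreviation X :: "'a univ cplx" where "X \<equiv> obj LS2_shift R"

abbreviation T :: "'a univ cplx" where "T \<equiv> obj tensZ2_shift R"

abbreviation face1 :: "nat \<Rightarrow> (nat set \<Rightarrow> 'a) \<Rightarrow> nat set \<Rightarrow> 'a" where
  "face1 i \<equiv> DK_act (shift R) 1 2 (coface i)"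

abbreviation face2 :: "nat \<Rightarrow> (nat set \<Rightarrow> 'a) \<Rightarrow> nat set \<Rightarrow> 'a" where
  "face2 i \<equiv> DK_act (shift R) 2 3 (coface i)"

sublocale R0: comm_group "A" by (rule chain_complexD [OF R])

lemma K_comm_group: "comm_group (K n)"
  by (rule comm_group_DK_grp [OF chain_complex_shift [OF R]])

lemma K_group: "group (K n)"
  using K_comm_group by (simp add: comm_group_def)

lemma G2_closed: "G2_rels (K n) \<subseteq> carrier (free_Abelian_group (G2_gens (K n)))"
  by (rule G2_rels_closed [OF K_group])

lemma S2_closed: "prod_rels (K n) \<subseteq> carrier (free_Abelian_group (prod_gens (K n)))"
  by (rule prod_rels_closed [OF group.is_monoid [OF K_group]])

definition H0_functional :: "('a \<Rightarrow> int) \<Rightarrow> bool" where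
  "H0_functional p \<longleftrightarrow> p \<in> hom A integer_group \<and> (\<forall>x \<in> carrier (grp R 1). p (bd R 0 x) = 0)"

lemma H0_functional_t [simp]: "H0_functional t1" "H0_functional t2"
  using t1 t2 t1_bd t2_bd by (auto simp: H0_functional_def)

lemma edge_hom_K:
  assumes "H0_functional p" "i < j" "j \<le> n"
  shows "(\<lambda>c. p (c {i, j})) \<in> hom (K n) integer_group"
  using assms by (intro edge_hom) (auto simp: H0_functional_def faces_def)

lemma edge_add:
  assumes "H0_functional p" "c \<in> carrier (K n)" "i < j" "j < k" "k \<le> n"
  shows "p (c {i, k}) = p (c {i, j}) + p (c {j, k})"
  using assms edge_cocycle [OF R, of p c n i j k] by (auto simp: H0_functional_def)

lemma coface_edge_hom:
  assumes "H0_functional p" "i < j" "j \<le> n"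
  shows "(\<lambda>c. p (DK_act (shift R) n (Suc n) (coface k) c {i, j})) \<in> hom (K (Suc n)) integer_group"
  using edge_hom_K [OF assms(1), of "coface k i" "coface k j" "Suc n"] assms
  by (simp add: DK_act_edge) (auto simp: coface_def)

lemma cup_kills:
  assumes "H0_functional p" "H0_functional q"
  shows "kills m (cup p q) (G2_rels (K 2))" "kills m (cup p q) (prod_rels (K 2))"
  unfolding cup_def using assms
  by (auto intro!: quad_kills_G2_rels quad_kills_prod_rels edge_hom_K K_group)

lemma edge_sq_kills:
  assumes "H0_functional p"
  shows "kills m (edge_sq p) (G2_rels (K 1))" "kills m (edge_sq p) (prod_rels (K 1))"
  unfolding edge_sq_def using assms
  by (auto intro!: quad_kills_G2_rels quad_kills_prod_rels edge_hom_K K_group)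

text \<open>
  The Leibniz rule: the cup product of two cocycles is a cocycle.
\<close>

lemma cup_cocycle:
  assumes "H0_functional p" "H0_functional q" "g \<in> G2_gens (K 3)"
  shows "(\<Sum>i\<le>3. (-1) ^ i * frag_eval (cup p q) (G2_fun (face2 i) g)) = 0"
proof -
  have add: "p (c {0, 2}) = p (c {0, 1}) + p (c {1, 2})" "q (c {1, 3}) = q (c {1, 2}) + q (c {2, 3})"
    if "c \<in> carrier (K 3)" for c
    using edge_add [OF assms(1) that] edge_add [OF assms(2) that] by simp_all
  show ?thesis
    using assms(3) unfolding cup_def quad_G2_fun
    by (auto simp: numeral_3_eq_3 numeral_2_eq_2 DK_act_edge coface_def G2_gens_def prod_gens_def
        add [unfolded numeral_3_eq_3 numeral_2_eq_2 One_nat_def] algebra_simps)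
qed

text \<open>
  As \<open>p\<close> is additive along edges, \<open>p(0,1)\<^sup>2 + p(1,2)\<^sup>2 - p(0,2)\<^sup>2 = -2 p(0,1) p(1,2)\<close>.
\<close>

lemma edge_sq_coboundary:
  assumes "H0_functional p" "g \<in> G2_gens (K 2)"
  shows "-2 * cup p p g = (\<Sum>i\<le>2. (-1) ^ i * frag_eval (edge_sq p) (G2_fun (face1 i) g))"
proof -
  have add: "p (c {0, 2}) = p (c {0, 1}) + p (c {1, 2})" if "c \<in> carrier (K 2)" for c
    using edge_add [OF assms(1) that] by simp
  show ?thesis
    using assms(2) unfolding cup_def edge_sq_def quad_G2_fun
    by (auto simp: numeral_2_eq_2 DK_act_edge coface_def G2_gens_def prod_gens_def
        add [unfolded numeral_2_eq_2 One_nat_def] algebra_simps)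
qed

lemma coface_kills:
  assumes "H0_functional p" "H0_functional q" "i < j" "j \<le> n" "i' < j'" "j' \<le> n"
  shows "kills m (\<lambda>g. frag_eval (quad (\<lambda>c. p (c {i, j})) (\<lambda>c. q (c {i', j'})))
      (G2_fun (DK_act (shift R) n (Suc n) (coface k)) g)) (G2_rels (K (Suc n)))"
  unfolding quad_G2_fun using assms by (intro quad_kills_G2_rels K_group coface_edge_hom)

lemma cup_bd_G2:
  assumes "H0_functional p" "H0_functional q" "x \<in> carrier (grp Y 3)"
  shows "has_val 0 (cup p q) (bd Y 2 x) 0"
proof -
  have x: "x \<in> carrier (presented (G2_gens (K 3)) (G2_rels (K 3)))"
    and norm: "\<And>i. i \<in> {1..3} \<Longrightarrow> presented_map (G2_gens (K 2)) (G2_rels (K 2))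
      (G2_fun (face2 i)) x = \<one>\<^bsub>presented (G2_gens (K 2)) (G2_rels (K 2))\<^esub>"
    using assms(3) by (auto simp: LG2_simps G2_def G2_map_eq)
  have "has_val 0 (cup p q) (presented_map (G2_gens (K 2)) (G2_rels (K 2)) (G2_fun (face2 0)) x) 0"
  proof (rule has_val_normalized_bd [OF G2_closed G2_closed x cup_kills(1) [OF assms(1,2)] _ norm])
    show "kills 0 (\<lambda>g. frag_eval (cup p q) (G2_fun (face2 i) g)) (G2_rels (K 3))" for i
      using coface_kills [OF assms(1,2), of 0 1 2 1 2 0 i, unfolded Suc_2] by (simp add: cup_def)
    show "0 = (\<Sum>i\<le>3. (-1) ^ i * frag_eval (cup p q) (G2_fun (face2 i) g))"
      if "g \<in> G2_gens (K 3)" for g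
      using cup_cocycle [OF assms(1,2) that] by simp
    show "has_val 0 (\<lambda>g. 0) x 0"
      by (rule has_val_zero [OF presented_nonempty [OF x]])
  qed
  then show ?thesis by (simp add: LG2_simps G2_map_eq Suc_2)
qed

lemma edge_sq_bd_G2:
  assumes "H0_functional p" "x \<in> carrier (grp Y 2)" "has_val 0 (cup p p) x v"
  shows "has_val 0 (edge_sq p) (bd Y 1 x) (-2 * v)"
proof -
  have x: "x \<in> carrier (presented (G2_gens (K 2)) (G2_rels (K 2)))"
    and norm: "\<And>i. i \<in> {1..2} \<Longrightarrow> presented_map (G2_gens (K 1)) (G2_rels (K 1))
      (G2_fun (face1 i)) x = \<one>\<^bsub>presented (G2_gens (K 1)) (G2_rels (K 1))\<^esub>"
    using assms(2) by (auto simp: LG2_simps G2_def G2_map_eq )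
  have "has_val 0 (edge_sq p) (presented_map (G2_gens (K 1)) (G2_rels (K 1)) (G2_fun (face1 0)) x) (-2 * v)"
  proof (rule has_val_normalized_bd [OF G2_closed G2_closed x edge_sq_kills(1) [OF assms(1)] _ norm])
    show "kills 0 (\<lambda>g. frag_eval (edge_sq p) (G2_fun (face1 i) g)) (G2_rels (K 2))" for i
      using coface_kills [OF assms(1,1), of 0 1 1 0 1 0 i, unfolded Suc_1] by (simp add: edge_sq_def)
    show "has_val 0 (\<lambda>g. -2 * cup p p g) x (-2 * v)"
      by (rule has_val_cmul [OF assms(3)])
  qed (use edge_sq_coboundary [OF assms(1)] in auto)
  then show ?thesis by (simp add: LG2_simps G2_map_eq numeral_2_eq_2)
qed

lemma cup_class_G2:
  assumes "chain_complex Y" "H0_functional p" "H0_functional q" "c \<in> carrier (m2_cycles Y 1)" "d \<in> carrier (m2_cycles Y 1)"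
    "m2_class Y 1 c = m2_class Y 1 d" "has_val 2 (cup p q) (fst c) v" "has_val 2 (cup p q) (fst d) w"
  shows "2 dvd v - w"
  using assms(2,3)
  by (intro m2_class_val [OF assms(1) _ _ G2_closed cup_kills(1) cup_bd_G2 assms(4-8)])
     (auto simp: LG2_simps G2_def)

text \<open>
  At a cycle mod 2, that is \<open>d x = 2 y\<close>, the coboundary formula can be divided by 2: the values satisfy
  \<open>2 edge_sq(y) = edge_sq(d x) = -2 cup(x)\<close>.
\<close>

lemma cup_edge_sq_G2:
  assumes c: "c \<in> carrier (m2_cycles Y 1)"
  obtains v where "has_val 0 (cup t1 t1) (fst c) v" "has_val 0 (edge_sq t1) (snd c) (- v)"
proof -
  have c': "fst c \<in> carrier (grp Y 2)" "snd c \<in> carrier (grp Y 1)" "bd Y 1 (fst c) = snd c \<otimes>\<^bsub>grp Y 1\<^esub> snd c"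
    using c unfolding m2_cycles_1 cycles_1 by auto
  have p: "fst c \<in> carrier (presented (G2_gens (K 2)) (G2_rels (K 2)))"
    "snd c \<in> carrier (presented (G2_gens (K 1)) (G2_rels (K 1)))"
    using c' by (auto simp: LG2_simps G2_def)
  obtain v where v: "has_val 0 (cup t1 t1) (fst c) v"
    by (rule has_val_exists [OF G2_closed cup_kills(1) [OF H0_functional_t(1) H0_functional_t(1)] p(1)])
  obtain k where k: "has_val 0 (edge_sq t1) (snd c) k"
    by (rule has_val_exists [OF G2_closed edge_sq_kills(1) [OF H0_functional_t(1)] p(2)])
  have "has_val 0 (edge_sq t1) (bd Y 1 (fst c)) (k + k)"
    unfolding c'(3) unfolding LG2_simps G2_def by (rule has_val_mult [OF k k])
  from has_val_unique [OF this edge_sq_bd_G2 [OF _ c'(1) v]] have "k = - v" by simp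
  with v k show thesis by (auto intro: that)
qed

section \<open>Endomorphisms of rank one\<close>

text \<open>
  The endomorphism \<open>a \<mapsto> t1(a) w\<close>, extended by zero to the complex; it commutes with the differential because
  \<open>t1\<close> kills boundaries.
\<close>

definition scale :: "'a \<Rightarrow> nat \<Rightarrow> 'a \<Rightarrow> 'a" where
  "scale w n a = (if n = 0 then w [^]\<^bsub>A\<^esub> t1 a else \<one>\<^bsub>grp R n\<^esub>)"

lemma scale_chain_map:
  assumes w: "w \<in> carrier A"
  shows "chain_map R R (scale w)"
  unfolding chain_map_def
proof (intro conjI allI ballI R)
  fix n
  interpret G: comm_group "grp R n" by (rule chain_complexD [OF R])
  interpret G': comm_group "grp R (Suc n)" by (rule chain_complexD [OF R])
  interpret d: group_hom "grp R (Suc n)" "grp R n" "bd R n" by (rule bd_group_hom [OF R])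
  show "scale w n \<in> hom (grp R n) (grp R n)"
    using w hom_mult [OF t1] by (intro homI) (auto simp: scale_def R0.int_pow_mult)
  show "scale w n (bd R n x) = bd R n (scale w (Suc n) x)" if "x \<in> carrier (grp R (Suc n))" for x
  proof -
    have "w [^]\<^bsub>A\<^esub> t1 (bd R 0 x) = \<one>\<^bsub>A\<^esub>" if "n = 0"
      using t1_bd [of x] \<open>x \<in> _\<close> that by simp
    then show ?thesis using d.hom_one by (simp add: scale_def)
  qed
qed

lemma t_scale:
  assumes "w \<in> carrier A"
  shows "t1 (scale w 0 a) = t1 w * t1 a" "t2 (scale w 0 a) = t2 w * t1 a"
  using hom_int_pow [OF t1 assms R0.is_group group_integer_group, of "t1 a"]
    hom_int_pow [OF t2 assms R0.is_group group_integer_group, of "t1 a"] by (simp_all add: scale_def)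

lemma cup_scale:
  assumes "w \<in> carrier A"
  shows "quad (\<lambda>c. t1 (DK_map (shift_map (scale w)) 2 c {0, 1})) (\<lambda>c. t2 (DK_map (shift_map (scale w)) 2 c {1, 2})) g
    = t1 w * t2 w * cup t1 t1 g"
proof -
  have "DK_map (shift_map (scale w)) 2 c {0, 1} = scale w 0 (c {0, 1})"
    "DK_map (shift_map (scale w)) 2 c {1, 2} = scale w 0 (c {1, 2})" for c
    by (auto simp: DK_map_def faces_def shift_map_def)
  then show ?thesis by (cases g) (simp_all add: t_scale [OF assms] cup_def algebra_simps)
qed

lemma has_val_scale_G2:
  assumes "w \<in> carrier A" "has_val m (cup t1 t1) x v"
  shows "has_val m (cup t1 t2) (arr LG2_shift R (scale w) 2 x) (t1 w * t2 w * v)"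
  unfolding LG2_simps G2_map_eq
proof (rule has_val_presented_map [OF G2_closed cup_kills(1) [OF H0_functional_t]])
  show "has_val m (\<lambda>g. frag_eval (cup t1 t2) (G2_fun (DK_map (shift_map (scale w)) 2) g)) x (t1 w * t2 w * v)"
    using has_val_cmul [OF assms(2)] unfolding cup_def [of t1 t2] quad_G2_fun cup_scale [OF assms(1)] .
qed

lemma has_val_scale_S2:
  assumes "w \<in> carrier A" "has_val m (cup t1 t1) x v" "x \<in> carrier (grp X 2)"
  shows "has_val m (cup t1 t2) (arr LS2_shift R (scale w) 2 x) (t1 w * t2 w * v)"
  unfolding LS2_simps S2_map_eq
proof (rule has_val_presented_map [OF S2_closed cup_kills(2) [OF H0_functional_t]])
  have x: "x \<in> carrier (presented (prod_gens (K 2)) (prod_rels (K 2)))"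
    using assms(3) by (simp add: LS2_simps S2_def)
  show "has_val m (\<lambda>g. frag_eval (cup t1 t2) (S2_fun (DK_map (shift_map (scale w)) 2) g)) x (t1 w * t2 w * v)"
  proof (rule has_val_cong [OF S2_closed x _ has_val_cmul [OF assms(2)]])
    show "t1 w * t2 w * cup t1 t1 g = frag_eval (cup t1 t2) (S2_fun (DK_map (shift_map (scale w)) 2) g)"
      if "g \<in> prod_gens (K 2)" for g
      unfolding cup_def [of t1 t2] quad_S2_fun [OF that] cup_scale [OF assms(1)] ..
  qed
qed

section \<open>There is no functorial section\<close>

text \<open>
  The pair \<open>(0, w \<otimes> 1)\<close> is a cycle mod 2 since \<open>2 (w \<otimes> 1) = 0\<close>; it represents an element of
  \<open>H\<^sub>2((R \<otimes> Z/2)[1]; Z/2)\<close> that the Bockstein map sends to the class of \<open>w \<otimes> 1\<close>.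
\<close>

abbreviation TG :: "(nat set \<Rightarrow> 'a, 'a) gen set" where "TG \<equiv> tens_gens A Z2"

abbreviation TR :: "((nat set \<Rightarrow> 'a, 'a) gen \<Rightarrow>\<^sub>0 int) set" where "TR \<equiv> tens_rels A Z2"

abbreviation tens_class :: "((nat set \<Rightarrow> 'a, 'a) gen \<Rightarrow>\<^sub>0 int) \<Rightarrow> 'a univ" where
  "tens_class \<equiv> rel_class TG TR"

definition tor_cycle :: "'a \<Rightarrow> 'a univ \<times> 'a univ" where
  "tor_cycle w = (\<one>\<^bsub>grp T 2\<^esub>, tens_class (frag_of (Tens w 1)))"

lemma tens_closed: "TR \<subseteq> carrier (free_Abelian_group TG)"
  by (rule tens_rels_closed) (auto intro: group.is_monoid R0.is_group)

lemma Z2_carrier [simp]: "0 \<in> carrier Z2" "1 \<in> carrier Z2"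
  by (auto simp: carrier_integer_mod_group)

lemma grp_T_1: "grp T 1 = presented TG TR"
  using tensZ2_shift_simps(1) [of R 0] by (simp add: tensZ2_def)

lemma Tens_twice:
  assumes w: "w \<in> carrier A"
  shows "frag_of (Tens w 1) + frag_of (Tens w 1) \<in> rel_subgroup TG TR"
proof -
  have r: "frag_of (Tens w (t \<otimes>\<^bsub>Z2\<^esub> t')) - frag_of (Tens w t) - frag_of (Tens w t') \<in> TR"
    if "t \<in> carrier Z2" "t' \<in> carrier Z2" for t t'
    using w that by (intro tens_relsI)
  note r1 = rel_subgroup_incl [OF r [of 1 1]] and r2 = rel_subgroup_incl [OF r [of 0 0]]
  show ?thesis
    using rel_subgroup_minus [OF tens_closed rel_subgroup_add [OF r1 r2]] by (simp add: algebra_simps)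
qed

lemma tor_cycle_carrier:
  assumes T: "chain_complex T" and w: "w \<in> carrier A"
  shows "tor_cycle w \<in> carrier (m2_cycles T 1)"
proof -
  interpret T2: comm_group "grp T 2" by (rule chain_complexD [OF T])
  interpret d: group_hom "grp T (Suc 1)" "grp T 1" "bd T 1" by (rule bd_group_hom [OF T])
  have k: "Poly_Mapping.keys (frag_of (Tens w 1)) \<subseteq> TG"
    using w by (auto simp: tens_gens_def)
  have "tens_class (frag_of (Tens w 1)) \<otimes>\<^bsub>grp T 1\<^esub> tens_class (frag_of (Tens w 1)) =
      tens_class (frag_of (Tens w 1) + frag_of (Tens w 1))"
    unfolding grp_T_1 by (rule rel_class_mult [OF tens_closed k k])
  also have "\<dots> = \<one>\<^bsub>grp T 1\<^esub>"
    unfolding grp_T_1 one_presented using Tens_twice [OF w] k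
    by (intro rel_class_eqI [OF tens_closed]) (auto dest!: keys_add [THEN subsetD])
  finally have "tens_class (frag_of (Tens w 1)) \<otimes>\<^bsub>grp T 1\<^esub> tens_class (frag_of (Tens w 1)) = \<one>\<^bsub>grp T 1\<^esub>" .
  moreover have "tens_class (frag_of (Tens w 1)) \<in> carrier (grp T 1)"
    unfolding grp_T_1 using k by (rule rel_class_in_presented)
  moreover have "bd T 1 \<one>\<^bsub>grp T 2\<^esub> = \<one>\<^bsub>grp T 1\<^esub>"
    using d.hom_one by (simp add: numeral_2_eq_2)
  ultimately show ?thesis
    unfolding m2_cycles_1 cycles_1 tor_cycle_def by (simp add: tensZ2_shift_simps)
qed

lemma tor_cycle_scale:
  assumes f: "chain_map T T (arr tensZ2_shift R (scale w))" and w: "w \<in> carrier A"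
  shows "m2_map (arr tensZ2_shift R (scale w)) 1 (tor_cycle u1) = tor_cycle w"
proof -
  interpret h: group_hom "grp T 2" "grp T 2" "arr tensZ2_shift R (scale w) 2" by (rule chain_map_group_hom [OF f])
  have k: "Poly_Mapping.keys (frag_of (Tens u1 1)) \<subseteq> TG"
    using u1 by (auto simp: tens_gens_def)
  let ?\<phi> = "tens_fun (scale w 0) :: (nat set \<Rightarrow> 'a, 'a) gen \<Rightarrow> _"
  have arr1: "arr tensZ2_shift R (scale w) 1 = presented_map TG TR ?\<phi>"
    using tensZ2_shift_simps(4) [of R "scale w" 0] by (simp add: tensZ2_map_eq)
  have "arr tensZ2_shift R (scale w) 1 (tens_class (frag_of (Tens u1 1))) \<in> carrier (grp T 1)"
    using k unfolding grp_T_1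
    by (intro hom_in_carrier [OF chain_mapD(3) [OF f, of 1, unfolded grp_T_1]] rel_class_in_presented)
  from presented_map_class' [OF tens_closed rel_class_self this [unfolded arr1 grp_T_1]]
  have "arr tensZ2_shift R (scale w) 1 (tens_class (frag_of (Tens u1 1))) = tens_class (frag_of (Tens w 1))"
    unfolding arr1 using w by (simp add: scale_def)
  moreover have "Suc 1 = 2" by simp
  ultimately show ?thesis
    unfolding m2_map_def tor_cycle_def using h.hom_one by (simp only: fst_conv snd_conv)
qed

lemma tor_cycle_mult:
  assumes T: "chain_complex T" and w: "w \<in> carrier A" and w': "w' \<in> carrier A"
  shows "tor_cycle w \<otimes>\<^bsub>m2_cycles T 1\<^esub> tor_cycle w' = tor_cycle (w \<otimes>\<^bsub>A\<^esub> w')"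
proof -
  interpret T2: comm_group "grp T 2" by (rule chain_complexD [OF T])
  have k: "Poly_Mapping.keys (frag_of (Tens v 1)) \<subseteq> TG" if "v \<in> carrier A" for v
    using that by (auto simp: tens_gens_def)
  have "frag_of (Tens (w \<otimes>\<^bsub>A\<^esub> w') 1) - frag_of (Tens w 1) - frag_of (Tens w' 1) \<in> TR"
    using w w' by (intro tens_relsI) auto
  then have "frag_of (Tens (w \<otimes>\<^bsub>A\<^esub> w') 1) - (frag_of (Tens w 1) + frag_of (Tens w' 1))
      \<in> rel_subgroup TG TR"
    using rel_subgroup_incl by (simp add: algebra_simps)
  then have "tens_class (frag_of (Tens (w \<otimes>\<^bsub>A\<^esub> w') 1)) = tens_class (frag_of (Tens w 1) + frag_of (Tens w' 1))"
    using k [OF w] k [OF w'] k [OF R0.m_closed [OF w w']]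
    by (intro rel_class_eqI [OF tens_closed]) (auto dest!: keys_add [THEN subsetD])
  also have "\<dots> = tens_class (frag_of (Tens w 1)) \<otimes>\<^bsub>grp T 1\<^esub> tens_class (frag_of (Tens w' 1))"
    unfolding grp_T_1 by (rule rel_class_mult [OF tens_closed k [OF w] k [OF w'], symmetric])
  finally show ?thesis
    using T2.l_one [OF T2.one_closed] by (simp add: tor_cycle_def numeral_2_eq_2)
qed

text \<open>
  The projection to \<open>R\<^sub>0 \<otimes> Z/2\<close> is read off modulo 2 by \<open>edge_sq\<close>, because an integer is congruent to its
  square.
\<close>

lemma LG2_to_tensZ2_val:
  assumes y: "y \<in> carrier (grp Y 1)" and v: "has_val 2 (edge_sq t1) y v"
  shows "has_val 2 (tens_val t1) (LG2_to_tensZ2 R 1 y) v"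
proof -
  have e: "{..1::nat} = {0, 1}" by auto
  define x where "x = (G2_to_tensZ2 (K 1) y :: (nat set \<Rightarrow> 'a, nat set \<Rightarrow> 'a) gens)"
  have yp: "y \<in> carrier (presented (G2_gens (K 1)) (G2_rels (K 1)))"
    using y by (simp add: LG2_simps G2_def)
  have kill: "kills 2 (tens_val (\<lambda>c. t1 (c {0, 1}))) (tens_rels (K 1) Z2)"
    by (intro tens_val_kills edge_hom_K) auto
  have cl: "tens_rels (K 1) Z2 \<subseteq> carrier (free_Abelian_group (tens_gens (K 1) Z2))"
    by (rule tens_rels_closed) (auto intro: group.is_monoid K_group)
  have "has_val 2 (tens_val (\<lambda>c. t1 (c {0, 1}))) x v"
    unfolding x_def G2_to_tensZ2_def
  proof (rule has_val_presented_map [OF cl kill], rule has_val_cong_mod [OF G2_closed yp _ v])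
    have "2 dvd i * i - i" for i :: int by simp
    then show "2 dvd edge_sq t1 g - frag_eval (tens_val (\<lambda>c. t1 (c {0, 1})))
        (case g of Divsq a \<Rightarrow> frag_of (Tens a 1) | _ \<Rightarrow> 0)" for g :: "(nat set \<Rightarrow> 'a, 'a) gen"
      by (cases g) (simp_all add: edge_sq_def)
  qed
  moreover have "(\<lambda>g. frag_eval (tens_val t1) (tens_fun (\<lambda>c. c {..1}) g)) =
      (tens_val (\<lambda>c. t1 (c {0, 1})) :: (nat set \<Rightarrow> 'a, nat set \<Rightarrow> 'a) gen \<Rightarrow> int)"
  proof
    show "frag_eval (tens_val t1) (tens_fun (\<lambda>c. c {..1}) g) = tens_val (\<lambda>c. t1 (c {0, 1})) g"
      for g :: "(nat set \<Rightarrow> 'a, nat set \<Rightarrow> 'a) gen"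
      unfolding e by (cases g) simp_all
  qed
  ultimately have "has_val 2 (\<lambda>g. frag_eval (tens_val t1) (tens_fun (\<lambda>c. c {..1}) g)) x v" by simp
  then have "has_val 2 (tens_val t1) (tensZ2_map A (\<lambda>c. c {..1}) x) v"
    unfolding tensZ2_map_eq by (rule has_val_presented_map [OF tens_closed tens_val_kills [OF t1]])
  then show ?thesis by (simp add: LG2_to_tensZ2_def x_def)
qed

lemma tens_bd_val:
  assumes b: "b \<in> carrier (grp T 2)"
  shows "has_val 2 (tens_val t1) (bd T 1 b) 0"
proof -
  let ?\<phi> = "tens_fun (bd R 0) :: (nat set \<Rightarrow> 'a, 'a) gen \<Rightarrow> _"
  note tk = tens_val_kills [OF t1]
  have bdT: "bd T 1 b = inv\<^bsub>presented TG TR\<^esub>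
      presented_map TG TR ?\<phi> b"
    using tensZ2_shift_simps(2) [of R 0 b] by (simp add: tensZ2_map_eq tensZ2_def)
  have bp: "b \<in> carrier (presented (tens_gens (grp R 1) Z2) (tens_rels (grp R 1) Z2))"
    using b tensZ2_shift_simps(1) [of R 1] by (simp add: tensZ2_def numeral_2_eq_2)
  have cl1: "tens_rels (grp R 1) Z2 \<subseteq> carrier (free_Abelian_group (tens_gens (grp R 1) Z2))"
    using chain_complexD(1) [OF R, of 1] by (intro tens_rels_closed) (auto simp: comm_group_def intro: group.is_monoid)
  have d: "bd R 0 \<in> hom (grp R 1) A" using chain_complexD(2) [OF R, of 0] by simp
  let ?m = "presented_map TG TR ?\<phi> b"
  have "has_val 2 (\<lambda>g. frag_eval (tens_val t1) (?\<phi> g)) b 0"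
  proof (rule has_val_cong [OF cl1 bp])
    show "has_val 2 (\<lambda>g. 0) b 0"
      by (rule has_val_zero [OF presented_nonempty [OF bp]])
  qed (auto simp: tens_gens_def t1_bd)
  then have v: "has_val 2 (tens_val t1) ?m 0"
    by (rule has_val_presented_map [OF tens_closed tk])
  have "?m \<in> carrier (presented TG TR)"
  proof -
    obtain x where x: "Poly_Mapping.keys x \<subseteq> tens_gens (grp R 1) Z2" "b = rel_class (tens_gens (grp R 1) Z2) (tens_rels (grp R 1) Z2) x"
      using bp by (auto simp: carrier_presented)
    have \<phi>: "Poly_Mapping.keys (?\<phi> g) \<subseteq> TG" if "g \<in> tens_gens (grp R 1) Z2" for g
      using that hom_in_carrier [OF d] by (auto simp: tens_gens_def)
    have "?m = tens_class (frag_extend ?\<phi> x)"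
      unfolding x(2)
    proof (rule presented_map_class [OF cl1 tens_closed \<phi> _ x(1)])
      show "frag_extend ?\<phi> r \<in> rel_subgroup TG TR"
        if "r \<in> tens_rels (grp R 1) Z2" for r
        using that by (intro rel_subgroup_incl tens_fun_rels [OF d])
    qed auto
    moreover have "Poly_Mapping.keys (frag_extend ?\<phi> x) \<subseteq> TG"
      using keys_frag_extend [of ?\<phi> x] x(1) \<phi> by blast
    ultimately show ?thesis using rel_class_in_presented by metis
  qed
  from has_val_inv [OF tens_closed tk this v] show ?thesis unfolding bdT by simp
qed

text \<open>
  Let \<open>h\<close> be the image of the class of \<open>u1\<close> under a section.  By naturality the image of the class of \<open>w\<close>
  is \<open>scale w h\<close>, where \<open>t1 \<union> t2\<close> takes the value \<open>t1(w) t2(w) v\<close> if \<open>v\<close> is the value of \<open>t1 \<union> t1\<close> at \<open>h\<close>.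
  This is quadratic in \<open>w\<close>, but must be additive at \<open>u1 + u2\<close>, so \<open>v\<close> is even.  On the other hand \<open>v\<close> is
  congruent to the value of \<open>t1\<close> at the projection of \<open>h\<close>, which is \<open>t1(u1) = 1\<close>.
\<close>

theorem no_section:
  assumes s: "D_mor T s Y"
    and nat: "\<And>w. w \<in> carrier A \<Longrightarrow>
      D_eq T (s @ [Fwd Y Y (arr LG2_shift R (scale w))]) (Fwd T T (arr tensZ2_shift R (scale w)) # s) Y"
    and split: "D_eq T (s @ [Fwd Y T (LG2_to_tensZ2 R)]) [] T"
  shows False
proof -
  have T: "chain_complex T" and Y: "chain_complex Y" using D_mor_complexes [OF s] by auto
  note tc = tor_cycle_carrier [OF T]
  obtain h where h: "h \<in> carrier (m2_cycles Y 1)" "m2_word 1 s (m2_class T 1 (tor_cycle u1)) = m2_class Y 1 h"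
    using m2_word_carrier [OF s tc [OF u1]] by blast
  define hw where "hw w = m2_map (arr LG2_shift R (scale w)) 1 h" for w
  note n = m2_word_natural [OF nat tc [OF u1] h]
  have hw: "hw w \<in> carrier (m2_cycles Y 1)" "m2_word 1 s (m2_class T 1 (tor_cycle w)) = m2_class Y 1 (hw w)"
    if "w \<in> carrier A" for w
    using n(3) [OF that] m2_map_carrier [OF n(2) [OF that] h(1)] tor_cycle_scale [OF n(1) [OF that] that]
    by (simp_all only: hw_def)
  define u where "u = u1 \<otimes>\<^bsub>A\<^esub> u2"
  have uc: "u \<in> carrier A" unfolding u_def using u1 u2 by simp
  have tu: "t1 u = 1" "t2 u = 1" using hom_mult [OF t1 u1 u2] hom_mult [OF t2 u1 u2] by (simp_all add: u_def)
  have "m2_word 1 s (m2_class T 1 (tor_cycle u)) = m2_class Y 1 (hw u1 \<otimes>\<^bsub>m2_cycles Y 1\<^esub> hw u2)"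
    unfolding u_def tor_cycle_mult [OF T u1 u2, symmetric]
    by (rule m2_word_mult [OF s tc [OF u1] tc [OF u2] hw(1) [OF u1] hw(1) [OF u2] hw(2) [OF u1] hw(2) [OF u2]])
  then have eq: "m2_class Y 1 (hw u) = m2_class Y 1 (hw u1 \<otimes>\<^bsub>m2_cycles Y 1\<^esub> hw u2)"
    using hw(2) [OF uc] by simp
  obtain v where v: "has_val 0 (cup t1 t1) (fst h) v" "has_val 0 (edge_sq t1) (snd h) (- v)"
    using cup_edge_sq_G2 [OF h(1)] by blast
  have val: "has_val 2 (cup t1 t2) (fst (hw w)) (t1 w * t2 w * v)" if "w \<in> carrier A" for w
    using has_val_scale_G2 [OF that has_val_mod [OF v(1)]] by (simp add: hw_def m2_map_def numeral_2_eq_2)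
  have "has_val 2 (cup t1 t2) (fst (hw u1 \<otimes>\<^bsub>m2_cycles Y 1\<^esub> hw u2)) (t1 u1 * t2 u1 * v + t1 u2 * t2 u2 * v)"
    using has_val_mult [OF val [OF u1] val [OF u2], of "G2_gens (K 2)" "G2_rels (K 2)"]
    by (simp add: LG2_simps G2_def numeral_2_eq_2)
  moreover have "hw u1 \<otimes>\<^bsub>m2_cycles Y 1\<^esub> hw u2 \<in> carrier (m2_cycles Y 1)"
    using m2_cycles_comm_group [OF Y] hw(1) [OF u1] hw(1) [OF u2]
    by (intro monoid.m_closed) (auto simp only: comm_group_def group_def)
  ultimately have "2 dvd t1 u * t2 u * v - (t1 u1 * t2 u1 * v + t1 u2 * t2 u2 * v)"
    using cup_class_G2 [OF Y _ _ hw(1) [OF uc] _ eq val [OF uc]] by simp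
  then have even: "2 dvd v" by (simp add: tu)
  have p: "chain_map Y T (LG2_to_tensZ2 R)"
    using D_eq_D_mor [OF split] D_mor_snoc_FwdD(1) by blast
  have ph: "m2_map (LG2_to_tensZ2 R) 1 h \<in> carrier (m2_cycles T 1)"
    by (rule m2_map_carrier [OF p h(1)])
  have "m2_class T 1 (tor_cycle u1) \<in> carrier (m2_homology T 1)"
    unfolding carrier_m2_homology using tc [OF u1] by (rule imageI)
  from m2_word_cong [OF split this]
  have "m2_class T 1 (m2_map (LG2_to_tensZ2 R) 1 h) = m2_class T 1 (tor_cycle u1)"
    by (simp only: m2_word_append m2_word.simps h(2) m2_step_Fwd [OF p h(1)])
  then obtain e where "e \<in> m2_bd T 1" "m2_map (LG2_to_tensZ2 R) 1 h = e \<otimes>\<^bsub>m2_cycles T 1\<^esub> tor_cycle u1"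
    using m2_class_eq_iff [OF T ph tc [OF u1]] by blast
  then obtain b where b: "b \<in> carrier (grp T 2)"
      "LG2_to_tensZ2 R 1 (snd h) = bd T 1 b \<otimes>\<^bsub>grp T 1\<^esub> tens_class (frag_of (Tens u1 1))"
    unfolding m2_bd_def m2_map_def tor_cycle_def by (auto simp: numeral_2_eq_2)
  have "has_val 2 (tens_val t1) (tens_class (frag_of (Tens u1 1))) 1"
    using has_val_rel_class [OF tens_closed tens_val_kills [OF t1], of "frag_of (Tens u1 1)"] by simp
  from has_val_mult [OF tens_bd_val [OF b(1)] this, of "TG" "TR"]
  have "has_val 2 (tens_val t1) (LG2_to_tensZ2 R 1 (snd h)) 1"
    unfolding b(2) grp_T_1 by simp
  moreover have "has_val 2 (tens_val t1) (LG2_to_tensZ2 R 1 (snd h)) (- v)"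
    using h(1) unfolding m2_cycles_1 cycles_1 by (intro LG2_to_tensZ2_val has_val_mod [OF v(2)]) auto
  ultimately have "2 dvd 1 - (- v)" by (rule has_val_unique)
  with even show False by presburger
qed

section \<open>There is no functorial retraction\<close>

text \<open>
  In bar notation \<open>bar1 w\<close> is \<open>[w]\<close>, and in degree 2 \<open>vfst w\<close> gives \<open>[w | -w]\<close> and \<open>vsnd w\<close> gives \<open>[0 | -w]\<close>.  The product
  \<open>shuffle w w' = [w | -w] [0 | -w']\<close> is normalized, since \<open>d\<^sub>1\<close> kills its first factor and \<open>d\<^sub>2\<close> its second,
  and it is a chain with boundary \<open>d\<^sub>0 = (-w) (-w') = w w'\<close>.
\<close>

definition vfst :: "'a \<Rightarrow> nat \<Rightarrow> 'a" where
  "vfst w i = (if i = 1 then w else \<one>\<^bsub>A\<^esub>)"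

definition vsnd :: "'a \<Rightarrow> nat \<Rightarrow> 'a" where
  "vsnd w i = (if i = 2 then inv\<^bsub>A\<^esub> w else \<one>\<^bsub>A\<^esub>)"

definition bar1 :: "'a \<Rightarrow> nat set \<Rightarrow> 'a" where "bar1 w = vbar R 1 (vfst w)"

definition shuffle :: "'a \<Rightarrow> 'a \<Rightarrow> (nat set \<Rightarrow> 'a, 'a) gen \<Rightarrow>\<^sub>0 int" where
  "shuffle w w' = frag_of (Prod (vbar R 2 (vfst w)) (vbar R 2 (vsnd w')))"

abbreviation wedge :: "'a \<Rightarrow> 'a \<Rightarrow> (nat set \<Rightarrow> 'a, 'a) gen \<Rightarrow>\<^sub>0 int" where
  "wedge w w' \<equiv> shuffle w' w - shuffle w w'"

abbreviation shuffle_face :: "nat \<Rightarrow> 'a \<Rightarrow> 'a \<Rightarrow> (nat set \<Rightarrow> 'a, 'a) gen \<Rightarrow>\<^sub>0 int" where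
  "shuffle_face i w w' \<equiv> frag_of (Prod (face1 i (vbar R 2 (vfst w))) (face1 i (vbar R 2 (vsnd w'))))"

lemma vfst_closed: "w \<in> carrier A \<Longrightarrow> vfst w i \<in> carrier A"
  by (simp add: vfst_def)

lemma vsnd_closed: "w \<in> carrier A \<Longrightarrow> vsnd w i \<in> carrier A"
  by (simp add: vsnd_def)

lemma vbar_vfst: "w \<in> carrier A \<Longrightarrow> vbar R n (vfst w) \<in> carrier (K n)"
  by (intro vbar_closed R vfst_closed)

lemma vbar_vsnd: "w \<in> carrier A \<Longrightarrow> vbar R n (vsnd w) \<in> carrier (K n)"
  by (intro vbar_closed R vsnd_closed)

lemma bar1_closed: "w \<in> carrier A \<Longrightarrow> bar1 w \<in> carrier (K 1)"
  unfolding bar1_def by (rule vbar_vfst)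

lemma vfst_mult:
  assumes "w \<in> carrier A" "w' \<in> carrier A"
  shows "vbar R n (vfst (w \<otimes>\<^bsub>A\<^esub> w')) = vbar R n (vfst w) \<otimes>\<^bsub>K n\<^esub> vbar R n (vfst w')"
proof -
  have "vfst (w \<otimes>\<^bsub>A\<^esub> w') = (\<lambda>i. vfst w i \<otimes>\<^bsub>A\<^esub> vfst w' i)"
    using assms by (auto simp: vfst_def)
  then show ?thesis using vbar_mult [OF R vfst_closed vfst_closed] assms by simp
qed

lemma vsnd_mult:
  assumes "w \<in> carrier A" "w' \<in> carrier A"
  shows "vbar R n (vsnd (w \<otimes>\<^bsub>A\<^esub> w')) = vbar R n (vsnd w) \<otimes>\<^bsub>K n\<^esub> vbar R n (vsnd w')"
proof -
  have "vsnd (w \<otimes>\<^bsub>A\<^esub> w') = (\<lambda>i. vsnd w i \<otimes>\<^bsub>A\<^esub> vsnd w' i)"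
    using assms by (auto simp: vsnd_def R0.inv_mult)
  then show ?thesis using vbar_mult [OF R vsnd_closed vsnd_closed] assms by simp
qed

lemma coface_shuffle:
  assumes w: "w \<in> carrier A"
  shows "face1 1 (vbar R 2 (vfst w)) = \<one>\<^bsub>K 1\<^esub>"
    and "face1 2 (vbar R 2 (vsnd w)) = \<one>\<^bsub>K 1\<^esub>"
    and "face1 0 (vbar R 2 (vfst w)) = inv\<^bsub>K 1\<^esub> bar1 w"
    and "face1 0 (vbar R 2 (vsnd w)) = inv\<^bsub>K 1\<^esub> bar1 w"
proof -
  interpret K1: comm_group "K 1" by (rule K_comm_group)
  have act: "face1 i (vbar R 2 v) = vbar R 1 (v \<circ> coface i)" for i v
    using DK_act_coface [of R 1 i v] by (simp add: numeral_2_eq_2)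
  have le: "i = 0 \<or> i = 1" if "i \<le> 1" for i :: nat using that by auto
  show "face1 1 (vbar R 2 (vfst w)) = \<one>\<^bsub>K 1\<^esub>"
    unfolding act by (rule vbar_const [OF R, of _ _ "\<one>\<^bsub>A\<^esub>"]) (auto simp: vfst_def coface_def dest!: le)
  show "face1 2 (vbar R 2 (vsnd w)) = \<one>\<^bsub>K 1\<^esub>"
    unfolding act by (rule vbar_const [OF R, of _ _ "\<one>\<^bsub>A\<^esub>"]) (auto simp: vsnd_def coface_def dest!: le)
  have v: "(vfst w \<circ> coface 0) i \<in> carrier A" "(vsnd w \<circ> coface 0) i \<in> carrier A" for i
    using w by (simp_all add: vfst_closed vsnd_closed)
  have "vbar R 1 (vfst w \<circ> coface 0) \<otimes>\<^bsub>K 1\<^esub> bar1 w = \<one>\<^bsub>K 1\<^esub>"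
    unfolding bar1_def vbar_mult [OF R v(1) vfst_closed [OF w]]
    by (rule vbar_const [OF R _ w]) (use w in \<open>auto simp: vfst_def coface_def dest!: le\<close>)
  then show "face1 0 (vbar R 2 (vfst w)) = inv\<^bsub>K 1\<^esub> bar1 w"
    unfolding act by (rule K1.inv_equality [OF _ bar1_closed [OF w] vbar_closed [OF R v(1)], symmetric])
  have "vbar R 1 (vsnd w \<circ> coface 0) \<otimes>\<^bsub>K 1\<^esub> bar1 w = \<one>\<^bsub>K 1\<^esub>"
    unfolding bar1_def vbar_mult [OF R v(2) vfst_closed [OF w]]
    by (rule vbar_const [OF R, of _ _ "\<one>\<^bsub>A\<^esub>"]) (use w in \<open>auto simp: vfst_def vsnd_def coface_def dest!: le\<close>)
  then show "face1 0 (vbar R 2 (vsnd w)) = inv\<^bsub>K 1\<^esub> bar1 w"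
    unfolding act by (rule K1.inv_equality [OF _ bar1_closed [OF w] vbar_closed [OF R v(2)], symmetric])
qed

lemma coface_hom_1: "face1 i \<in> hom (K 2) (K 1)"
  using coface_hom [OF R, of 1 i] by (simp add: numeral_2_eq_2)

lemma shuffle_keys:
  assumes "w \<in> carrier A" "w' \<in> carrier A"
  shows "Poly_Mapping.keys (shuffle w w') \<subseteq> prod_gens (K 2)" "Poly_Mapping.keys (shuffle w w') \<subseteq> G2_gens (K 2)"
  using vbar_vfst [OF assms(1), of 2] vbar_vsnd [OF assms(2), of 2] by (auto simp: shuffle_def prod_gens_def G2_gens_def)

lemma prod_bar1_keys:
  assumes "w \<in> carrier A" "w' \<in> carrier A"
  shows "Poly_Mapping.keys (frag_of (Prod (bar1 w) (bar1 w'))) \<subseteq> prod_gens (K 1)"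
    "Poly_Mapping.keys (frag_of (Prod (bar1 w) (bar1 w'))) \<subseteq> G2_gens (K 1)"
  using bar1_closed assms by (auto simp: prod_gens_def G2_gens_def)

text \<open>
  The relations are left open because the same computation of faces is used in \<open>\<Gamma>\<^sub>2\<close> and in \<open>S\<^sup>2\<close>.
\<close>

lemma shuffle_faces:
  fixes S :: "(nat set \<Rightarrow> 'a, 'a) gen set"
  assumes R': "prod_rels (K 1) \<subseteq> Q" "Q \<subseteq> carrier (free_Abelian_group S)"
    and w: "w \<in> carrier A" "w' \<in> carrier A"
  shows "i \<in> {1..2} \<Longrightarrow> shuffle_face i w w' \<in> rel_subgroup S Q"
    and "shuffle_face 0 w w' - frag_of (Prod (bar1 w) (bar1 w')) \<in> rel_subgroup S Q"
proof -
  assume "i \<in> {1..2}"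
  then consider "i = 1" | "i = 2" by fastforce
  then show "shuffle_face i w w' \<in> rel_subgroup S Q"
  proof cases
    case 1
    show ?thesis unfolding 1 coface_shuffle(1) [OF w(1)]
      by (rule prod_one_left [OF K_group R' _ hom_in_carrier [OF coface_hom_1 vbar_vsnd [OF w(2)]]])
        (rule bar1_closed [OF w(1)])
  next
    case 2
    show ?thesis unfolding 2 coface_shuffle(2) [OF w(2)]
      by (rule prod_one_right [OF K_group R' hom_in_carrier [OF coface_hom_1 vbar_vfst [OF w(1)]]])
        (rule bar1_closed [OF w(1)])
  qed
next
  show "shuffle_face 0 w w' - frag_of (Prod (bar1 w) (bar1 w')) \<in> rel_subgroup S Q"
    unfolding coface_shuffle(3) [OF w(1)] coface_shuffle(4) [OF w(2)]
    by (rule prod_inv_inv [OF K_group R' bar1_closed [OF w(1)] bar1_closed [OF w(2)]])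
qed

lemma prod_gens_subset: "prod_gens (K n) \<subseteq> G2_gens (K n)"
  by (auto simp: G2_gens_def)

lemma prod_rels_G2: "prod_rels (K n) \<subseteq> G2_rels (K n)"
  by (auto intro: G2_relsI)

lemma G2_map_coface_shuffle:
  assumes w: "w \<in> carrier A" "w' \<in> carrier A"
  shows "G2_map (K 1) (face1 i) (G2_class (K 2) (shuffle w w')) =
    G2_class (K 1) (shuffle_face i w w')"
  unfolding G2_map_class [OF K_group K_group coface_hom_1 shuffle_keys(2) [OF w]] by (simp add: shuffle_def)

lemma coface_prod_keys:
  assumes "w \<in> carrier A" "w' \<in> carrier A"
  shows "Poly_Mapping.keys (shuffle_face i w w') \<subseteq> prod_gens (K 1)"
  using hom_in_carrier [OF coface_hom_1 vbar_vfst [OF assms(1)]] hom_in_carrier [OF coface_hom_1 vbar_vsnd [OF assms(2)]]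
  by (simp add: prod_gens_def)

lemma G2_shuffle:
  assumes w: "w \<in> carrier A" "w' \<in> carrier A"
  shows "G2_class (K 2) (shuffle w w') \<in> carrier (grp Y 2)"
    and "bd Y 1 (G2_class (K 2) (shuffle w w')) = G2_class (K 1) (frag_of (Prod (bar1 w) (bar1 w')))"
proof -
  have "G2_map (K 1) (face1 i) (G2_class (K 2) (shuffle w w')) = \<one>\<^bsub>G2 (K 1)\<^esub>"
    if "i \<in> {1..2}" for i
    unfolding G2_map_coface_shuffle [OF w] G2_def one_presented
    using shuffle_faces(1) [OF prod_rels_G2 G2_closed w that] coface_prod_keys [OF w] prod_gens_subset
    by (intro rel_class_eqI [OF G2_closed]) auto
  then show "G2_class (K 2) (shuffle w w') \<in> carrier (grp Y 2)"
    unfolding LG2_simps using rel_class_in_presented [OF shuffle_keys(2) [OF w]] by (simp add: G2_def)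
  have "G2_map (K 1) (face1 0) (G2_class (K 2) (shuffle w w')) =
      G2_class (K 1) (frag_of (Prod (bar1 w) (bar1 w')))"
    unfolding G2_map_coface_shuffle [OF w]
    using shuffle_faces(2) [OF prod_rels_G2 G2_closed w] coface_prod_keys [OF w] prod_bar1_keys [OF w] prod_gens_subset
    by (intro rel_class_eqI [OF G2_closed]) blast+
  then show "bd Y 1 (G2_class (K 2) (shuffle w w')) = G2_class (K 1) (frag_of (Prod (bar1 w) (bar1 w')))"
    by (simp add: LG2_simps numeral_2_eq_2)
qed

definition gamma2 :: "'a \<Rightarrow> 'a univ" where
  "gamma2 w = G2_class (K 1) (frag_of (Divsq (bar1 w)))"

lemma gamma2_cycle:
  assumes w: "w \<in> carrier A"
  shows "gamma2 w \<in> cycles Y 1"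
proof -
  interpret K0: comm_group "K 0" by (rule K_comm_group)
  have act: "DK_act (shift R) 0 1 (coface i) (bar1 w) = \<one>\<^bsub>K 0\<^esub>" for i
  proof -
    have "DK_act (shift R) 0 1 (coface i) (bar1 w) = vbar R 0 (vfst w \<circ> coface i)"
      using DK_act_coface [of R 0 i "vfst w"] by (simp add: bar1_def)
    also have "\<dots> = \<one>\<^bsub>K 0\<^esub>"
      by (rule vbar_const [OF R, of _ _ "(vfst w \<circ> coface i) 0"]) (use w in \<open>auto simp: vfst_closed\<close>)
    finally show ?thesis .
  qed
  have k: "Poly_Mapping.keys (frag_of (Divsq (bar1 w))) \<subseteq> G2_gens (K 1)"
    using bar1_closed [OF w] by (simp add: G2_gens_def)
  have h: "DK_act (shift R) 0 1 (coface i) \<in> hom (K 1) (K 0)" for i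
    using coface_hom [OF R, of 0 i] by simp
  have "frag_of (Divsq (\<one>\<^bsub>K 0\<^esub>)) \<in> rel_subgroup (G2_gens (K 0)) (G2_rels (K 0))"
    using rel_subgroup_incl [OF G2_relsI(3) [OF K0.one_closed, of 0]] by simp
  then have "G2_class (K 0) (frag_of (Divsq (\<one>\<^bsub>K 0\<^esub>))) = G2_class (K 0) 0"
    by (intro rel_class_eqI [OF G2_closed]) (auto simp: G2_gens_def)
  then have one: "G2_map (K 0) (DK_act (shift R) 0 1 (coface i)) (gamma2 w) = \<one>\<^bsub>G2 (K 0)\<^esub>" for i
    unfolding gamma2_def G2_map_class [OF K_group K_group h k] by (simp add: act [unfolded One_nat_def] G2_def one_presented)
  then show ?thesis
    unfolding cycles_1 LG2_simps using rel_class_in_presented [OF k] by (simp add: G2_def gamma2_def)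
qed

text \<open>
  The pair \<open>(shuffle w w, \<gamma>\<^sub>2(w))\<close> is a cycle mod 2 in \<open>L\<Gamma>\<^sub>2(R[1])\<close> because \<open>w w = 2 \<gamma>\<^sub>2(w)\<close>, and the
  difference of two shuffles is an integral cycle in \<open>LS\<^sup>2(R[1])\<close> because \<open>w' w = w w'\<close>; up to sign it represents
  the element \<open>w \<and> w'\<close> of \<open>\<Lambda>\<^sup>2 = \<pi>\<^sub>2 LS\<^sup>2(R[1])\<close>.
\<close>

definition div_cycle :: "'a \<Rightarrow> 'a univ \<times> 'a univ" where
  "div_cycle w = (G2_class (K 2) (shuffle w w), gamma2 w)"

definition ext_cycle :: "'a \<Rightarrow> 'a \<Rightarrow> 'a univ \<times> 'a univ" where
  "ext_cycle w w' = (S2_class (K 2) (wedge w w'), \<one>\<^bsub>S2 (K 1)\<^esub>)"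

lemma div_cycle_carrier:
  assumes w: "w \<in> carrier A"
  shows "div_cycle w \<in> carrier (m2_cycles Y 1)"
proof -
  have k: "Poly_Mapping.keys (frag_of (Divsq (bar1 w))) \<subseteq> G2_gens (K 1)"
    using bar1_closed [OF w] by (simp add: G2_gens_def)
  have "gamma2 w \<otimes>\<^bsub>grp Y 1\<^esub> gamma2 w = G2_class (K 1) (frag_of (Divsq (bar1 w)) + frag_of (Divsq (bar1 w)))"
    unfolding LG2_simps G2_def gamma2_def by (rule rel_class_mult [OF G2_closed k k])
  also have "\<dots> = G2_class (K 1) (frag_of (Prod (bar1 w) (bar1 w)))"
  proof (rule rel_class_eqI [OF G2_closed, symmetric])
    show "frag_of (Prod (bar1 w) (bar1 w)) - (frag_of (Divsq (bar1 w)) + frag_of (Divsq (bar1 w)))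
        \<in> rel_subgroup (G2_gens (K 1)) (G2_rels (K 1))"
      using rel_subgroup_incl [OF G2_relsI(4) [OF bar1_closed [OF w]]] by (simp add: frag_cmul_2)
  qed (intro keys_add_subset prod_bar1_keys w k)+
  finally show ?thesis
    unfolding m2_cycles_1 div_cycle_def using G2_shuffle [OF w w] gamma2_cycle [OF w] by simp
qed

lemma S2_map_coface_shuffle:
  assumes w: "w \<in> carrier A" "w' \<in> carrier A"
  shows "S2_map (K 1) (face1 i) (S2_class (K 2) (wedge w w')) =
    S2_class (K 1) (shuffle_face i w' w - shuffle_face i w w')"
proof -
  have k: "Poly_Mapping.keys (wedge w w') \<subseteq> prod_gens (K 2)"
    by (intro keys_diff_subset shuffle_keys w)
  show ?thesis
    unfolding S2_map_class [OF K_group K_group coface_hom_1 k] by (simp add: shuffle_def frag_extend_diff)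
qed

lemma ext_cycle_carrier:
  assumes X: "chain_complex X" and w: "w \<in> carrier A" "w' \<in> carrier A"
  shows "ext_cycle w w' \<in> carrier (m2_cycles X 1)"
proof -
  interpret X1: comm_group "grp X 1" by (rule chain_complexD [OF X])
  let ?D = "\<lambda>i w w'. shuffle_face i w w' :: (nat set \<Rightarrow> 'a, 'a) gen \<Rightarrow>\<^sub>0 int"
  have k: "Poly_Mapping.keys (wedge w w') \<subseteq> prod_gens (K 2)"
    by (intro keys_diff_subset shuffle_keys w)
  have kD: "Poly_Mapping.keys (?D i w' w - ?D i w w') \<subseteq> prod_gens (K 1)" for i
    by (intro keys_diff_subset coface_prod_keys w)
  have zero: "S2_map (K 1) (face1 i) (S2_class (K 2) (wedge w w')) = \<one>\<^bsub>S2 (K 1)\<^esub>"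
    if "?D i w' w - ?D i w w' \<in> rel_subgroup (prod_gens (K 1)) (prod_rels (K 1))" for i
    unfolding S2_map_coface_shuffle [OF w] S2_def one_presented
    using that kD by (intro rel_class_eqI [OF S2_closed]) auto
  have 12: "S2_map (K 1) (face1 i) (S2_class (K 2) (wedge w w')) = \<one>\<^bsub>S2 (K 1)\<^esub>"
    if "i \<in> {1..2}" for i
    by (intro zero rel_subgroup_diff [OF S2_closed] shuffle_faces(1) [OF order_refl S2_closed] that w)
  have "(?D 0 w' w - frag_of (Prod (bar1 w') (bar1 w))) - (?D 0 w w' - frag_of (Prod (bar1 w) (bar1 w')))
      + (frag_of (Prod (bar1 w') (bar1 w)) - frag_of (Prod (bar1 w) (bar1 w')))
      \<in> rel_subgroup (prod_gens (K 1)) (prod_rels (K 1))"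
    by (intro rel_subgroup_add rel_subgroup_diff [OF S2_closed] shuffle_faces(2) [OF order_refl S2_closed] w
        rel_subgroup_incl prod_relsI(2) bar1_closed)
  then have 0: "S2_map (K 1) (face1 0) (S2_class (K 2) (wedge w w')) = \<one>\<^bsub>S2 (K 1)\<^esub>"
    by (intro zero) (simp add: algebra_simps)
  have "S2_class (K 2) (wedge w w') \<in> carrier (grp X 2)"
    unfolding LS2_simps using 12 rel_class_in_presented [OF k] by (simp add: S2_def)
  moreover have "bd X 1 (S2_class (K 2) (wedge w w')) = \<one>\<^bsub>grp X 1\<^esub>"
    using 0 by (simp add: LS2_simps numeral_2_eq_2)
  moreover have "\<one>\<^bsub>grp X 1\<^esub> \<in> cycles X 1"
    using subgroup.one_closed [OF subgroup_cycles [OF X]] .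
  moreover have "\<one>\<^bsub>grp X 1\<^esub> \<otimes>\<^bsub>grp X 1\<^esub> \<one>\<^bsub>grp X 1\<^esub> = \<one>\<^bsub>grp X 1\<^esub>"
    by (rule X1.l_one [OF X1.one_closed])
  ultimately show ?thesis
    unfolding m2_cycles_1 ext_cycle_def by (simp add: LS2_simps(3))
qed

lemma scale_vfst:
  assumes w: "w \<in> carrier A"
  shows "DK_map (shift_map (scale w)) n (vbar R n (vfst u1)) = vbar R n (vfst w)"
    "DK_map (shift_map (scale w)) n (vbar R n (vsnd u1)) = vbar R n (vsnd w)"
proof -
  note f = scale_chain_map [OF w]
  interpret f: group_hom "A" "A" "scale w 0" by (rule chain_map_group_hom [OF f])
  have s: "scale w 0 u1 = w" using w by (simp add: scale_def)
  have "scale w 0 \<circ> vfst u1 = vfst w" "scale w 0 \<circ> vsnd u1 = vsnd w"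
    using s f.hom_one f.hom_inv [OF u1] by (auto simp: vfst_def vsnd_def)
  then show "DK_map (shift_map (scale w)) n (vbar R n (vfst u1)) = vbar R n (vfst w)"
    "DK_map (shift_map (scale w)) n (vbar R n (vsnd u1)) = vbar R n (vsnd w)"
    using DK_map_vbar [OF f, of n "vfst u1"] DK_map_vbar [OF f, of n "vsnd u1"] vfst_closed [OF u1] vsnd_closed [OF u1]
    by simp_all
qed

lemma div_cycle_scale:
  assumes f: "chain_map Y Y (arr LG2_shift R (scale w))" and w: "w \<in> carrier A"
  shows "m2_map (arr LG2_shift R (scale w)) 1 (div_cycle u1) = div_cycle w"
proof -
  have c: "fst (div_cycle u1) \<in> carrier (grp Y 2)" "snd (div_cycle u1) \<in> carrier (grp Y 1)"
    using div_cycle_carrier [OF u1] unfolding m2_cycles_1 cycles_1 by auto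
  have arr: "arr LG2_shift R (scale w) n = presented_map (G2_gens (K n)) (G2_rels (K n)) (G2_fun (DK_map (shift_map (scale w)) n))" for n
    by (simp add: LG2_simps G2_map_eq)
  have "arr LG2_shift R (scale w) 2 (G2_class (K 2) (shuffle u1 u1)) \<in> carrier (presented (G2_gens (K 2)) (G2_rels (K 2)))"
    using hom_in_carrier [OF chain_mapD(3) [OF f] c(1)] by (simp add: LG2_simps G2_def div_cycle_def)
  from presented_map_class' [OF G2_closed rel_class_self this [unfolded arr]]
  have "arr LG2_shift R (scale w) 2 (fst (div_cycle u1)) = fst (div_cycle w)"
    unfolding arr by (simp add: div_cycle_def shuffle_def scale_vfst [OF w])
  moreover
  have "arr LG2_shift R (scale w) 1 (gamma2 u1) \<in> carrier (presented (G2_gens (K 1)) (G2_rels (K 1)))"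
    using hom_in_carrier [OF chain_mapD(3) [OF f] c(2)] by (simp add: LG2_simps G2_def div_cycle_def)
  from presented_map_class' [OF G2_closed rel_class_self this [unfolded arr gamma2_def]]
  have "arr LG2_shift R (scale w) 1 (snd (div_cycle u1)) = snd (div_cycle w)"
    unfolding arr by (simp add: div_cycle_def gamma2_def bar1_def scale_vfst(1) [OF w, of 1, unfolded One_nat_def])
  moreover have "Suc 1 = 2" by simp
  ultimately show ?thesis by (simp only: m2_map_def prod.collapse)
qed

lemma ext_cycle_image:
  assumes i: "chain_map X Y (LS2_to_LG2 R)" and X: "chain_complex X" and w: "w \<in> carrier A" "w' \<in> carrier A"
  shows "m2_map (LS2_to_LG2 R) 1 (ext_cycle w w') = (G2_class (K 2) (wedge w w'), \<one>\<^bsub>grp Y 1\<^esub>)"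
proof -
  let ?\<psi> = "(\<lambda>g. case g of Prod a b \<Rightarrow> frag_of (Divsq (a \<otimes>\<^bsub>K 2\<^esub> b)) - frag_of (Divsq a) - frag_of (Divsq b) | _ \<Rightarrow> 0)
     :: (nat set \<Rightarrow> 'a, 'a) gen \<Rightarrow> _"
  interpret h: group_hom "grp X 1" "grp Y 1" "LS2_to_LG2 R 1" by (rule chain_map_group_hom [OF i])
  interpret K2: comm_group "K 2" by (rule K_comm_group)
  have c: "fst (ext_cycle w w') \<in> carrier (grp X 2)"
    using ext_cycle_carrier [OF X w] unfolding m2_cycles_1 by auto
  have i2: "LS2_to_LG2 R 2 = presented_map (G2_gens (K 2)) (G2_rels (K 2)) ?\<psi>"
    by (simp add: LS2_to_LG2_def S2_to_G2_def)
  have "LS2_to_LG2 R 2 (fst (ext_cycle w w')) \<in> carrier (presented (G2_gens (K 2)) (G2_rels (K 2)))"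
    using hom_in_carrier [OF chain_mapD(3) [OF i] c] by (simp add: LG2_simps G2_def)
  then have "LS2_to_LG2 R 2 (fst (ext_cycle w w')) = G2_class (K 2) (frag_extend ?\<psi> (wedge w w'))"
    unfolding i2 ext_cycle_def fst_conv by (rule presented_map_class' [OF G2_closed rel_class_self])
  also have "\<dots> = G2_class (K 2) (wedge w w')"
  proof (rule rel_class_eqI [OF G2_closed])
    have r: "frag_extend ?\<psi> (shuffle v v') - shuffle v v' \<in> rel_subgroup (G2_gens (K 2)) (G2_rels (K 2))"
      if "v \<in> carrier A" "v' \<in> carrier A" for v v'
      using rel_subgroup_incl [OF G2_relsI(2) [OF vbar_vfst [OF that(1)] vbar_vsnd [OF that(2)]]]
      by (simp add: shuffle_def algebra_simps)
    show "frag_extend ?\<psi> (wedge w w') - (wedge w w') \<in> rel_subgroup (G2_gens (K 2)) (G2_rels (K 2))"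
      using rel_subgroup_diff [OF G2_closed r [OF w(2,1)] r [OF w]] by (simp add: frag_extend_diff algebra_simps)
    show "Poly_Mapping.keys (wedge w w') \<subseteq> G2_gens (K 2)"
      by (intro keys_diff_subset shuffle_keys w)
    have k: "Poly_Mapping.keys (frag_extend ?\<psi> (shuffle v v')) \<subseteq> G2_gens (K 2)"
      if "v \<in> carrier A" "v' \<in> carrier A" for v v'
      using vbar_vfst [OF that(1), of 2] vbar_vsnd [OF that(2), of 2]
      by (auto simp: shuffle_def G2_gens_def dest!: keys_diff [THEN subsetD])
    show "Poly_Mapping.keys (frag_extend ?\<psi> (wedge w w')) \<subseteq> G2_gens (K 2)"
      unfolding frag_extend_diff by (intro keys_diff_subset k w)
  qed
  finally have "LS2_to_LG2 R 2 (fst (ext_cycle w w')) = G2_class (K 2) (wedge w w')" .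
  moreover have "LS2_to_LG2 R 1 (snd (ext_cycle w w')) = \<one>\<^bsub>grp Y 1\<^esub>"
    using h.hom_one by (simp add: ext_cycle_def LS2_simps)
  moreover have "Suc 1 = 2" by simp
  ultimately show ?thesis by (simp only: m2_map_def)
qed

lemma shuffle_bilinear:
  assumes w: "w \<in> carrier A" "w' \<in> carrier A"
  shows "shuffle (w \<otimes>\<^bsub>A\<^esub> w') (w \<otimes>\<^bsub>A\<^esub> w') - (shuffle w w + shuffle w w' + shuffle w' w + shuffle w' w')
    \<in> rel_subgroup (G2_gens (K 2)) (G2_rels (K 2))"
proof -
  interpret K2: comm_group "K 2" by (rule K_comm_group)
  let ?P = "\<lambda>a b. frag_of (Prod a b) :: (nat set \<Rightarrow> 'a, 'a) gen \<Rightarrow>\<^sub>0 int"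
  let ?N = "rel_subgroup (G2_gens (K 2)) (G2_rels (K 2)) :: ((nat set \<Rightarrow> 'a, 'a) gen \<Rightarrow>\<^sub>0 int) set"
  note incl = rel_subgroup_incl [OF G2_relsI(1)]
  have l: "?P (a \<otimes>\<^bsub>K 2\<^esub> a') b - ?P a b - ?P a' b \<in> ?N"
    if "a \<in> carrier (K 2)" "a' \<in> carrier (K 2)" "b \<in> carrier (K 2)" for a a' b
    by (intro incl prod_relsI that)
  have s: "?P a b - ?P b a \<in> ?N" if "a \<in> carrier (K 2)" "b \<in> carrier (K 2)" for a b
    by (intro incl prod_relsI that)
  have r: "?P b (a \<otimes>\<^bsub>K 2\<^esub> a') - ?P b a - ?P b a' \<in> ?N"
    if "a \<in> carrier (K 2)" "a' \<in> carrier (K 2)" "b \<in> carrier (K 2)" for a a' b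
  proof -
    have "(?P b (a \<otimes>\<^bsub>K 2\<^esub> a') - ?P (a \<otimes>\<^bsub>K 2\<^esub> a') b) + (?P (a \<otimes>\<^bsub>K 2\<^esub> a') b - ?P a b - ?P a' b)
        + ((?P a b - ?P b a) + (?P a' b - ?P b a')) \<in> ?N"
      using that by (intro rel_subgroup_add s l) auto
    then show ?thesis by (simp add: algebra_simps)
  qed
  let ?a = "vbar R 2 (vfst w)" and ?a' = "vbar R 2 (vfst w')" and ?b = "vbar R 2 (vsnd w)" and ?b' = "vbar R 2 (vsnd w')"
  note cl = vbar_vfst [OF w(1), of 2] vbar_vfst [OF w(2), of 2] vbar_vsnd [OF w(1), of 2] vbar_vsnd [OF w(2), of 2]
  have "(?P (?a \<otimes>\<^bsub>K 2\<^esub> ?a') (?b \<otimes>\<^bsub>K 2\<^esub> ?b') - ?P ?a (?b \<otimes>\<^bsub>K 2\<^esub> ?b') - ?P ?a' (?b \<otimes>\<^bsub>K 2\<^esub> ?b'))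
      + ((?P ?a (?b \<otimes>\<^bsub>K 2\<^esub> ?b') - ?P ?a ?b - ?P ?a ?b') + (?P ?a' (?b \<otimes>\<^bsub>K 2\<^esub> ?b') - ?P ?a' ?b - ?P ?a' ?b')) \<in> ?N"
    using cl by (intro rel_subgroup_add r l) auto
  then show ?thesis
    unfolding shuffle_def vfst_mult [OF w] vsnd_mult [OF w] by (simp add: algebra_simps)
qed

text \<open>
  The deviation of \<open>div_cycle\<close> from additivity is the image of \<open>ext_cycle\<close>.  The second components differ by
  \<open>\<gamma>\<^sub>2(w + w') - \<gamma>\<^sub>2(w) - \<gamma>\<^sub>2(w') = w w'\<close>, which is the boundary of \<open>b = shuffle w w'\<close>; this changes the first
  component by \<open>2 b\<close> and turns the sum of the two mixed shuffles into their difference.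
\<close>

lemma div_cycle_mult:
  assumes Y: "chain_complex Y" and i: "chain_map X Y (LS2_to_LG2 R)" and X: "chain_complex X"
    and w: "w \<in> carrier A" "w' \<in> carrier A"
  shows "m2_class Y 1 (div_cycle (w \<otimes>\<^bsub>A\<^esub> w')) =
    m2_class Y 1 (div_cycle w \<otimes>\<^bsub>m2_cycles Y 1\<^esub> div_cycle w' \<otimes>\<^bsub>m2_cycles Y 1\<^esub> m2_map (LS2_to_LG2 R) 1 (ext_cycle w w'))"
proof -
  interpret M: comm_group "m2_cycles Y 1" by (rule m2_cycles_comm_group [OF Y])
  interpret Y1: comm_group "grp Y 1" by (rule chain_complexD [OF Y])
  interpret Y2: comm_group "grp Y 2" by (rule chain_complexD [OF Y])
  interpret d: group_hom "grp Y 3" "grp Y 2" "bd Y 2"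
    using bd_group_hom [OF Y, of 2] by (simp add: Suc_2)
  note ww = R0.m_closed [OF w]
  have mc2: "G2_class (K 2) x \<otimes>\<^bsub>grp Y 2\<^esub> G2_class (K 2) y = G2_class (K 2) (x + y)"
    if "Poly_Mapping.keys x \<subseteq> G2_gens (K 2)" "Poly_Mapping.keys y \<subseteq> G2_gens (K 2)" for x y
    unfolding LG2_simps G2_def by (rule rel_class_mult [OF G2_closed that])
  have mc1: "G2_class (K 1) x \<otimes>\<^bsub>grp Y 1\<^esub> G2_class (K 1) y = G2_class (K 1) (x + y)"
    if "Poly_Mapping.keys x \<subseteq> G2_gens (K 1)" "Poly_Mapping.keys y \<subseteq> G2_gens (K 1)" for x y
    unfolding LG2_simps G2_def by (rule rel_class_mult [OF G2_closed that])
  note kp = keys_add_subset and km = keys_diff_subset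
  note sk = shuffle_keys(2)
  have dk: "Poly_Mapping.keys (frag_of (Divsq (bar1 v))) \<subseteq> G2_gens (K 1)" if "v \<in> carrier A" for v
    using bar1_closed [OF that] by (simp add: G2_gens_def)
  define b where "b = G2_class (K 2) (shuffle w w')"
  define e where "e = (b \<otimes>\<^bsub>grp Y 2\<^esub> b \<otimes>\<^bsub>grp Y 2\<^esub> bd Y 2 \<one>\<^bsub>grp Y 3\<^esub>, bd Y 1 b)"
  have b: "b \<in> carrier (grp Y 2)" "bd Y 1 b = G2_class (K 1) (frag_of (Prod (bar1 w) (bar1 w')))"
    unfolding b_def by (rule G2_shuffle [OF w])+
  have e: "e \<in> m2_bd Y 1"
    unfolding m2_bd_def e_def Suc_1 Suc_2 using b(1) d.one_closed by blast
  have ext: "m2_map (LS2_to_LG2 R) 1 (ext_cycle w w') = (G2_class (K 2) (wedge w w'), \<one>\<^bsub>grp Y 1\<^esub>)"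
    by (rule ext_cycle_image [OF i X w])
  have extc: "m2_map (LS2_to_LG2 R) 1 (ext_cycle w w') \<in> carrier (m2_cycles Y 1)"
    by (rule m2_map_carrier [OF i ext_cycle_carrier [OF X w]])
  let ?r = "div_cycle w \<otimes>\<^bsub>m2_cycles Y 1\<^esub> div_cycle w' \<otimes>\<^bsub>m2_cycles Y 1\<^esub> m2_map (LS2_to_LG2 R) 1 (ext_cycle w w')"
  have rc: "?r \<in> carrier (m2_cycles Y 1)"
    by (rule M.m_closed [OF M.m_closed [OF div_cycle_carrier [OF w(1)] div_cycle_carrier [OF w(2)]] extc])
  have "fst (div_cycle (w \<otimes>\<^bsub>A\<^esub> w')) = G2_class (K 2) ((shuffle w w' + shuffle w w') + (shuffle w w + shuffle w' w' + (wedge w w')))"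
    unfolding div_cycle_def fst_conv
  proof (rule rel_class_eqI [OF G2_closed])
    show "shuffle (w \<otimes>\<^bsub>A\<^esub> w') (w \<otimes>\<^bsub>A\<^esub> w') - ((shuffle w w' + shuffle w w') + (shuffle w w + shuffle w' w' + (wedge w w')))
        \<in> rel_subgroup (G2_gens (K 2)) (G2_rels (K 2))"
      using shuffle_bilinear [OF w] by (simp add: algebra_simps)
  qed (intro kp km sk w ww)+
  also have "\<dots> = (b \<otimes>\<^bsub>grp Y 2\<^esub> b \<otimes>\<^bsub>grp Y 2\<^esub> bd Y 2 \<one>\<^bsub>grp Y 3\<^esub>) \<otimes>\<^bsub>grp Y 2\<^esub>
     (G2_class (K 2) (shuffle w w) \<otimes>\<^bsub>grp Y 2\<^esub> G2_class (K 2) (shuffle w' w') \<otimes>\<^bsub>grp Y 2\<^esub> G2_class (K 2) (wedge w w'))"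
    unfolding b_def using Y2.r_one [OF Y2.m_closed [OF b(1) b(1)]]
    by (simp only: d.hom_one b_def mc2 sk w kp km)
  finally have 1: "fst (div_cycle (w \<otimes>\<^bsub>A\<^esub> w')) = fst e \<otimes>\<^bsub>grp Y 2\<^esub> fst ?r"
    by (simp add: e_def div_cycle_def ext [unfolded One_nat_def] numeral_2_eq_2)
  have "snd (div_cycle (w \<otimes>\<^bsub>A\<^esub> w')) =
      G2_class (K 1) (frag_of (Prod (bar1 w) (bar1 w')) + (frag_of (Divsq (bar1 w)) + frag_of (Divsq (bar1 w'))))"
    unfolding div_cycle_def snd_conv gamma2_def
  proof (rule rel_class_eqI [OF G2_closed])
    show "frag_of (Divsq (bar1 (w \<otimes>\<^bsub>A\<^esub> w'))) - (frag_of (Prod (bar1 w) (bar1 w')) + (frag_of (Divsq (bar1 w)) + frag_of (Divsq (bar1 w'))))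
        \<in> rel_subgroup (G2_gens (K 1)) (G2_rels (K 1))"
      using rel_subgroup_incl [OF G2_relsI(2) [OF bar1_closed [OF w(1)] bar1_closed [OF w(2)]]]
      unfolding bar1_def vfst_mult [OF w] by (simp add: algebra_simps)
  qed (intro kp dk prod_bar1_keys w ww)+
  also have "\<dots> = bd Y 1 b \<otimes>\<^bsub>grp Y 1\<^esub> (gamma2 w \<otimes>\<^bsub>grp Y 1\<^esub> gamma2 w')"
    unfolding gamma2_def b(2) by (simp only: mc1 kp dk prod_bar1_keys w)
  also have "gamma2 w \<otimes>\<^bsub>grp Y 1\<^esub> gamma2 w' = gamma2 w \<otimes>\<^bsub>grp Y 1\<^esub> gamma2 w' \<otimes>\<^bsub>grp Y 1\<^esub> \<one>\<^bsub>grp Y 1\<^esub>"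
    using gamma2_cycle [OF w(1)] gamma2_cycle [OF w(2)] unfolding cycles_1 by (intro Y1.r_one [symmetric] Y1.m_closed) auto
  finally have 2: "snd (div_cycle (w \<otimes>\<^bsub>A\<^esub> w')) = snd e \<otimes>\<^bsub>grp Y 1\<^esub> snd ?r"
    by (simp add: e_def div_cycle_def ext [unfolded One_nat_def])
  have "div_cycle (w \<otimes>\<^bsub>A\<^esub> w') = e \<otimes>\<^bsub>m2_cycles Y 1\<^esub> ?r"
    using 1 2 by (simp only: m2_cycles_simps(2) prod_eq_iff fst_conv snd_conv) (simp add: numeral_2_eq_2)
  then show ?thesis
    using m2_class_eq_iff [OF Y div_cycle_carrier [OF ww] rc] e by blast
qed

lemma ext_cycle_val: "has_val m (cup t1 t2) (fst (ext_cycle u1 u2)) 1"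
proof -
  have e: "{0, Suc 0} \<in> faces 2" "{Suc 0, 2} \<in> faces 2" by (auto simp: faces_def)
  have v: "vbar R 2 v {0, 1} = v 1 \<otimes>\<^bsub>A\<^esub> inv\<^bsub>A\<^esub> v 0" "vbar R 2 v {1, 2} = v 2 \<otimes>\<^bsub>A\<^esub> inv\<^bsub>A\<^esub> v 1" for v
    using vbar_edge [of 0 1 2 R v] vbar_edge [of 1 2 2 R v] by simp_all
  have t_inv: "t1 (inv\<^bsub>A\<^esub> a) = - t1 a" "t2 (inv\<^bsub>A\<^esub> a) = - t2 a" if "a \<in> carrier A" for a
    using that group_hom.hom_inv [of "A" integer_group t1 a] group_hom.hom_inv [of "A" integer_group t2 a] t1 t2
    by (simp_all add: group_hom_def group_hom_axioms_def R0.is_group)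
  have t_one: "t1 \<one>\<^bsub>A\<^esub> = 0" "t2 \<one>\<^bsub>A\<^esub> = 0"
    using hom_one [OF t1] hom_one [OF t2] R0.is_group by simp_all
  have val: "frag_eval (cup t1 t2) (shuffle a b) = - (t1 a * t2 b)"
    if "a \<in> carrier A" "b \<in> carrier A" for a b
    using that by (simp add: shuffle_def cup_def v vfst_def vsnd_def t_inv t_one del: One_nat_def)
  have "has_val m (cup t1 t2) (fst (ext_cycle u1 u2)) (frag_eval (cup t1 t2) (shuffle u2 u1 - shuffle u1 u2))"
    unfolding ext_cycle_def fst_conv by (rule has_val_rel_class [OF S2_closed cup_kills(2) [OF H0_functional_t]])
  then show ?thesis using u1 u2 by (simp add: val)
qed

lemma cup_S2_to_G2:
  assumes "H0_functional p" "H0_functional q" "x \<in> carrier (grp X 2)" "has_val m (cup p q) x v"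
  shows "has_val m (cup p q) (S2_to_G2 (K 2) x) v"
  using assms unfolding cup_def
  by (intro S2_to_G2_val K_group edge_hom_K) (simp_all add: LS2_simps)

text \<open>
  On \<open>S\<^sup>2\<close> only the polarization \<open>2 p(a) p(b)\<close> of the square is left.
\<close>

lemma edge_sq_S2_to_G2:
  assumes "H0_functional p" "x \<in> carrier (grp X 1)"
  shows "has_val 2 (edge_sq p) (S2_to_G2 (K 1) x) 0"
  unfolding edge_sq_def
proof (rule S2_to_G2_val [OF K_group])
  show x: "x \<in> carrier (S2 (K 1))" using assms(2) by (simp add: LS2_simps)
  then have x': "x \<in> carrier (presented (prod_gens (K 1)) (prod_rels (K 1)))" by (simp add: S2_def)
  have "has_val 2 (\<lambda>g. 0) x 0"
    by (rule has_val_zero [OF presented_nonempty [OF x']])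
  then show "has_val 2 (quad (\<lambda>c. p (c {0, 1})) (\<lambda>c. p (c {0, 1}))) x 0"
    by (rule has_val_cong_mod [OF S2_closed x', rotated]) (auto simp: prod_gens_def)
qed (use assms in \<open>auto intro: edge_hom_K\<close>)

text \<open>
  Let \<open>k\<close> be the image of \<open>div_cycle u1\<close> under a retraction.  By naturality the image of \<open>div_cycle w\<close> is
  \<open>scale w k\<close>, where \<open>t1 \<union> t2\<close> takes the value \<open>t1(w) t2(w) v\<close> if \<open>v\<close> is the value of \<open>t1 \<union> t1\<close> at \<open>k\<close>.  Since
  the retraction is the identity on \<open>ext_cycle u1 u2\<close>, where \<open>t1 \<union> t2\<close> is 1, comparison of the values at
  \<open>u1 + u2\<close>, \<open>u1\<close> and \<open>u2\<close> shows that \<open>v\<close> is odd.  But \<open>-v\<close> is a value of \<open>edge_sq\<close> on the image of \<open>S\<^sup>2\<close>, hence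
  even.  The comparison takes place in \<open>L\<Gamma>\<^sub>2(R[1])\<close>, since \<open>t1 \<union> t2\<close> is a cocycle there.
\<close>

theorem no_retraction:
  assumes r: "D_mor Y r X"
    and nat: "\<And>w. w \<in> carrier A \<Longrightarrow>
      D_eq Y (r @ [Fwd X X (arr LS2_shift R (scale w))]) (Fwd Y Y (arr LG2_shift R (scale w)) # r) X"
    and split: "D_eq X (Fwd X Y (LS2_to_LG2 R) # r) [] X"
  shows False
proof -
  have X: "chain_complex X" and Y: "chain_complex Y" using D_mor_complexes [OF r] by auto
  interpret MX: comm_group "m2_cycles X 1" by (rule m2_cycles_comm_group [OF X])
  interpret MY: comm_group "m2_cycles Y 1" by (rule m2_cycles_comm_group [OF Y])
  note dc = div_cycle_carrier
  have i: "chain_map X Y (LS2_to_LG2 R)"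
    using D_eq_D_mor [OF split] D_mor_FwdD(2) by blast
  obtain k where k: "k \<in> carrier (m2_cycles X 1)" "m2_word 1 r (m2_class Y 1 (div_cycle u1)) = m2_class X 1 k"
    using m2_word_carrier [OF r dc [OF u1]] by blast
  define kw where "kw w = m2_map (arr LS2_shift R (scale w)) 1 k" for w
  note n = m2_word_natural [OF nat dc [OF u1] k]
  have kw: "kw w \<in> carrier (m2_cycles X 1)" "m2_word 1 r (m2_class Y 1 (div_cycle w)) = m2_class X 1 (kw w)"
    if "w \<in> carrier A" for w
    using n(3) [OF that] m2_map_carrier [OF n(2) [OF that] k(1)] div_cycle_scale [OF n(1) [OF that] that]
    by (simp_all only: kw_def)
  define u where "u = u1 \<otimes>\<^bsub>A\<^esub> u2"
  have uc: "u \<in> carrier A" unfolding u_def using u1 u2 by simp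
  have tu: "t1 u = 1" "t2 u = 1" using hom_mult [OF t1 u1 u2] hom_mult [OF t2 u1 u2] by (simp_all add: u_def)
  note ec = ext_cycle_carrier [OF X u1 u2]
  have "m2_class X 1 (ext_cycle u1 u2) \<in> carrier (m2_homology X 1)"
    unfolding carrier_m2_homology using ec by (rule imageI)
  from m2_word_cong [OF split this]
  have ext: "m2_word 1 r (m2_class Y 1 (m2_map (LS2_to_LG2 R) 1 (ext_cycle u1 u2))) = m2_class X 1 (ext_cycle u1 u2)"
    by (simp only: m2_word.simps m2_step_Fwd [OF i ec])
  have "m2_word 1 r (m2_class Y 1 (div_cycle u)) =
      m2_class X 1 (kw u1 \<otimes>\<^bsub>m2_cycles X 1\<^esub> kw u2 \<otimes>\<^bsub>m2_cycles X 1\<^esub> ext_cycle u1 u2)"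
    unfolding u_def div_cycle_mult [OF Y i X u1 u2]
    by (intro m2_word_mult [OF r] MX.m_closed MY.m_closed dc u1 u2 m2_map_carrier [OF i] ec kw ext)
  then have eq: "m2_class X 1 (kw u) = m2_class X 1 (kw u1 \<otimes>\<^bsub>m2_cycles X 1\<^esub> kw u2 \<otimes>\<^bsub>m2_cycles X 1\<^esub> ext_cycle u1 u2)"
    using kw(2) [OF uc] by simp
  have k': "fst k \<in> carrier (grp X 2)" "snd k \<in> carrier (grp X 1)"
    using k(1) unfolding m2_cycles_1 cycles_1 by auto
  have i_comp: "fst (m2_map (LS2_to_LG2 R) 1 c) = S2_to_G2 (K 2) (fst c)"
    "snd (m2_map (LS2_to_LG2 R) 1 c) = S2_to_G2 (K 1) (snd c)" for c
    by (simp_all add: m2_map_def LS2_to_LG2_def numeral_2_eq_2)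
  obtain v where v: "has_val 0 (cup t1 t1) (fst k) v"
    by (rule has_val_exists [OF S2_closed cup_kills(2) [OF H0_functional_t(1) H0_functional_t(1)], of "fst k"])
       (use k'(1) in \<open>simp_all add: LS2_simps S2_def\<close>)
  obtain v' where v': "has_val 0 (cup t1 t1) (fst (m2_map (LS2_to_LG2 R) 1 k)) v'"
      "has_val 0 (edge_sq t1) (snd (m2_map (LS2_to_LG2 R) 1 k)) (- v')"
    using cup_edge_sq_G2 [OF m2_map_carrier [OF i k(1)]] by blast
  have "has_val 0 (cup t1 t1) (fst (m2_map (LS2_to_LG2 R) 1 k)) v"
    unfolding i_comp by (rule cup_S2_to_G2 [OF _ _ k'(1) v]) simp_all
  from has_val_unique [OF v'(1) this] have "v' = v" by simp
  moreover have "has_val 2 (edge_sq t1) (snd (m2_map (LS2_to_LG2 R) 1 k)) 0"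
    unfolding i_comp by (rule edge_sq_S2_to_G2 [OF _ k'(2)]) simp
  ultimately have even: "2 dvd v"
    using has_val_unique [OF has_val_mod [OF v'(2)], of 2 0] by simp
  have val: "has_val 2 (cup t1 t2) (fst (kw w)) (t1 w * t2 w * v)" if "w \<in> carrier A" for w
    using has_val_scale_S2 [OF that has_val_mod [OF v(1)] k'(1)] by (simp add: kw_def m2_map_def numeral_2_eq_2)
  have "has_val 2 (cup t1 t2) (fst (kw u1 \<otimes>\<^bsub>m2_cycles X 1\<^esub> kw u2 \<otimes>\<^bsub>m2_cycles X 1\<^esub> ext_cycle u1 u2))
      (t1 u1 * t2 u1 * v + t1 u2 * t2 u2 * v + 1)"
    using has_val_mult [OF has_val_mult [OF val [OF u1] val [OF u2]] ext_cycle_val, of "prod_gens (K 2)" "prod_rels (K 2)" "prod_gens (K 2)" "prod_rels (K 2)"]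
    by (simp add: LS2_simps S2_def numeral_2_eq_2)
  note sum_val = this
  have sum: "kw u1 \<otimes>\<^bsub>m2_cycles X 1\<^esub> kw u2 \<otimes>\<^bsub>m2_cycles X 1\<^esub> ext_cycle u1 u2 \<in> carrier (m2_cycles X 1)"
    by (intro MX.m_closed kw u1 u2 ec)
  have i_val: "has_val 2 (cup t1 t2) (fst (m2_map (LS2_to_LG2 R) 1 c)) a"
    if "c \<in> carrier (m2_cycles X 1)" "has_val 2 (cup t1 t2) (fst c) a" for c a
    unfolding i_comp using that unfolding m2_cycles_1 by (intro cup_S2_to_G2) auto
  have "2 dvd t1 u * t2 u * v - (t1 u1 * t2 u1 * v + t1 u2 * t2 u2 * v + 1)"
  proof (rule cup_class_G2 [OF Y H0_functional_t])
    show "m2_class Y 1 (m2_map (LS2_to_LG2 R) 1 (kw u)) =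
        m2_class Y 1 (m2_map (LS2_to_LG2 R) 1 (kw u1 \<otimes>\<^bsub>m2_cycles X 1\<^esub> kw u2 \<otimes>\<^bsub>m2_cycles X 1\<^esub> ext_cycle u1 u2))"
      using m2_step_Fwd [OF i kw(1) [OF uc]] m2_step_Fwd [OF i sum] eq by metis
  qed (intro m2_map_carrier [OF i] i_val kw(1) uc sum val sum_val)+
  then have "2 dvd v - 1" by (simp add: tu)
  with even show False by presburger
qed

end

section \<open>The free abelian group of rank two and its resolutions\<close>

text \<open>
  Every chain endomorphism of a resolution represents a morphism of the derived category, obtained by
  conjugation with the quasi-isomorphism to \<open>C\<close>; so naturality can be applied to it.
\<close>

lemma represents_endomorphism:
  assumes q: "quasi_iso (P C) C (\<epsilon> C)" and f: "chain_map (P C) (P C) f"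
  shows "represents P \<epsilon> C C [Bwd C (P C) (\<epsilon> C), Fwd (P C) (P C) f, Fwd (P C) C (\<epsilon> C)] f"
proof -
  have \<epsilon>: "chain_map (P C) C (\<epsilon> C)" using q by (simp add: quasi_iso_def)
  have v: "D_mor (P C) [Fwd (P C) (P C) f, Fwd (P C) C (\<epsilon> C)] C"
    by (intro D_mor.fwd [OF f] D_mor_Fwd \<epsilon>)
  have "D_eq (P C) ([Fwd (P C) C (\<epsilon> C), Bwd C (P C) (\<epsilon> C)] @ [Fwd (P C) (P C) f, Fwd (P C) C (\<epsilon> C)])
      ([] @ [Fwd (P C) (P C) f, Fwd (P C) C (\<epsilon> C)]) C"
    by (rule D_eq.cong [OF D_eq.inv_right [OF q] D_eq.refl [OF v]])
  from D_eq.sym [OF this] show ?thesis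
    unfolding represents_def using f D_mor.bwd [OF q v] by simp
qed

text \<open>
  Here \<open>C\<close> is \<open>Z \<times> Z\<close> in degree 0, carried into the type \<open>'a\<close> by an injection.  All its boundaries are trivial,
  so the coordinates of the augmentation are functionals that kill boundaries, and surjectivity on \<open>H\<^sub>0\<close> lifts
  the basis exactly.
\<close>

lemma dual_pair_exists:
  fixes P :: "'a cplx \<Rightarrow> 'a cplx"
  assumes inf: "infinite (UNIV :: 'a set)" and P: "projective_resolutions P \<epsilon>"
  obtains C t1 t2 u1 u2 where "chain_complex C" "dual_pair (P C) t1 t2 u1 u2"
proof -
  obtain j0 :: "nat \<Rightarrow> 'a" where j0: "inj j0" using infinite_countable_subset [OF inf] by blast
  define j :: "int \<times> int \<Rightarrow> 'a" where "j = j0 \<circ> to_nat"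
  have j: "inj j" unfolding j_def using j0 by (intro inj_compose) auto
  define c where "c = the_inv j"
  have cj [simp]: "c (j x) = x" for x unfolding c_def using j by (rule the_inv_f_f)
  define A :: "'a monoid" where
    "A = \<lparr>carrier = range j, monoid.mult = (\<lambda>x y. j (fst (c x) + fst (c y), snd (c x) + snd (c y))), one = j (0, 0)\<rparr>"
  have A: "comm_group A"
  proof (rule comm_groupI)
    show "\<exists>y\<in>carrier A. y \<otimes>\<^bsub>A\<^esub> x = \<one>\<^bsub>A\<^esub>" if "x \<in> carrier A" for x
      using that by (intro bexI [of _ "j (- fst (c x), - snd (c x))"]) (auto simp: A_def)
  qed (auto simp: A_def ac_simps)
  have c_hom: "(\<lambda>x. fst (c x)) \<in> hom A integer_group" "(\<lambda>x. snd (c x)) \<in> hom A integer_group"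
    by (auto simp: hom_def A_def)
  define C :: "'a cplx" where
    "C = \<lparr>grp = (\<lambda>n. if n = 0 then A else A\<lparr>carrier := {\<one>\<^bsub>A\<^esub>}\<rparr>), bd = (\<lambda>n x. \<one>\<^bsub>A\<^esub>)\<rparr>"
  have C: "chain_complex C"
    unfolding chain_complex_def
  proof (intro conjI allI ballI)
    interpret A: comm_group A by fact
    fix n
    show "comm_group (grp C n)"
      using A A.comm_group_subgroup [OF A.triv_subgroup] by (simp add: C_def)
    show "bd C n \<in> hom (grp C (Suc n)) (grp C n)" by (auto simp: C_def hom_def)
    show "bd C n (bd C (Suc n) x) = \<one>\<^bsub>grp C n\<^esub>" for x by (simp add: C_def)
  qed
  then have q: "quasi_iso (P C) C (\<epsilon> C)" using P by (simp add: projective_resolutions_def)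
  then have \<epsilon>: "chain_map (P C) C (\<epsilon> C)" by (simp add: quasi_iso_def)
  have lift: "\<exists>u\<in>carrier (grp (P C) 0). \<epsilon> C 0 u = j x" for x
  proof -
    have "j x \<in> cycles C 0" by (simp add: C_def A_def)
    from quasi_iso_surj [OF q this] obtain u b where "u \<in> cycles (P C) 0" "\<epsilon> C 0 u = bd C 0 b \<otimes>\<^bsub>grp C 0\<^esub> j x"
      by metis
    then show ?thesis by (auto simp: C_def A_def)
  qed
  obtain u1 u2 where u: "u1 \<in> carrier (grp (P C) 0)" "\<epsilon> C 0 u1 = j (1, 0)" "u2 \<in> carrier (grp (P C) 0)" "\<epsilon> C 0 u2 = j (0, 1)"
    using lift [of "(1, 0)"] lift [of "(0, 1)"] by blast
  have h: "\<epsilon> C 0 \<in> hom (grp (P C) 0) A" using chain_mapD(3) [OF \<epsilon>, of 0] by (simp add: C_def)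
  have bd: "\<epsilon> C 0 (bd (P C) 0 x) = j (0, 0)" if "x \<in> carrier (grp (P C) 1)" for x
    using chain_mapD(4) [OF \<epsilon>, of x 0] that by (simp add: C_def A_def)
  have "dual_pair (P C) (\<lambda>x. fst (c (\<epsilon> C 0 x))) (\<lambda>x. snd (c (\<epsilon> C 0 x))) u1 u2"
    using hom_compose [OF h c_hom(1)] hom_compose [OF h c_hom(2)] chain_mapD(1) [OF \<epsilon>]
    by unfold_locales (auto simp: u bd o_def)
  with C show thesis by (rule that)
qed

theorem proposition6p1:
  fixes P :: "'a cplx \<Rightarrow> 'a cplx"
    and \<epsilon> :: "'a cplx \<Rightarrow> nat \<Rightarrow> 'a \<Rightarrow> 'a"
  assumes "infinite (UNIV :: 'a set)"
    and "projective_resolutions P \<epsilon>"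
  shows "\<not> (\<exists>r. functorial_retraction P \<epsilon> LS2_shift LG2_shift LS2_to_LG2 r) \<and>
         \<not> (\<exists>s. functorial_section P \<epsilon> LG2_shift tensZ2_shift LG2_to_tensZ2 s)"
proof -
  obtain C t1 t2 u1 u2 where C: "chain_complex C" and dp: "dual_pair (P C) t1 t2 u1 u2"
    by (rule dual_pair_exists [OF assms])
  interpret dual_pair "P C" t1 t2 u1 u2 by (rule dp)
  have q: "quasi_iso (P C) C (\<epsilon> C)" using assms(2) C by (simp add: projective_resolutions_def)
  have rep: "\<exists>w'. represents P \<epsilon> C C w' (scale w)" if "w \<in> carrier (grp (P C) 0)" for w
    using represents_endomorphism [of P C \<epsilon>, OF q scale_chain_map [OF that]] by blast
  have False if r: "functorial_retraction P \<epsilon> LS2_shift LG2_shift LS2_to_LG2 r" for r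
  proof (rule no_retraction [of "r C"])
    show "D_mor Y (r C) X" "D_eq X (Fwd X Y (LS2_to_LG2 (P C)) # r C) [] X"
      using r C by (simp_all add: functorial_retraction_def D_natural_def)
    show "D_eq Y (r C @ [Fwd X X (arr LS2_shift (P C) (scale w))]) (Fwd Y Y (arr LG2_shift (P C) (scale w)) # r C) X"
      if "w \<in> carrier (grp (P C) 0)" for w
      using r C rep [OF that] unfolding functorial_retraction_def D_natural_def by blast
  qed
  moreover have False if s: "functorial_section P \<epsilon> LG2_shift tensZ2_shift LG2_to_tensZ2 s" for s
  proof (rule no_section [of "s C"])
    show "D_mor T (s C) Y" "D_eq T (s C @ [Fwd Y T (LG2_to_tensZ2 (P C))]) [] T"
      using s C by (simp_all add: functorial_section_def D_natural_def)
    show "D_eq T (s C @ [Fwd Y Y (arr LG2_shift (P C) (scale w))]) (Fwd T T (arr tensZ2_shift (P C) (scale w)) # s C) Y"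
      if "w \<in> carrier (grp (P C) 0)" for w
      using s C rep [OF that] unfolding functorial_section_def D_natural_def by blast
  qed
  ultimately show ?thesis by blast
qed

end
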